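(* Let $G$ be a finite group and $V$ a finite dimensional (not necessarily faithful) $\mathbb{C}G$-module. The maps $\Upsilon$ and $\Phi^*$ are inverse isomorphisms on the cohomology $\mathrm{HH}^{\bullet}(S(V),S(V)\#G)$ and on its $G$-invariant subalgebra $\mathrm{HH}^{\bullet}(S(V),S(V)\#G)^G\cong\mathrm{HH}^{\bullet}(S(V)\#G)$. (Here $\Upsilon$ maps the description of cohomology by Koszul cochains to the description by bar cochains, and $\Phi^*$ goes in the opposite direction.)
   Context: Write ${}^gv$ for the action of $g\in G$; it extends to $S(V)$. The skew group algebra $S(V)\#G$ is $S(V)\otimes\mathbb{C}G$ with product $(a\otimes g)(b\otimes h)=a({}^gb)\otimes gh$; write $a\bar g=a\otimes g$. As $S(V)$-bimodules, $S(V)\#G=\bigoplus_{g\in G}S(V)\bar g$. $S(V)^e=S(V)\otimes S(V)^{op}$; bimodules are left $S(V)^e$-modules via $(a\otimes b)m=amb$. $\mathrm{HH}^{\bullet}(A,M)=\operatorname{Ext}^{\bullet}_{A^e}(A,M)$ and $\mathrm{HH}^{\bullet}(A)=\mathrm{HH}^{\bullet}(A,A)$. Tensor and exterior products are over $\mathbb{C}$. Bar resolution of $S(V)$: $S(V)^{\otimes(p+2)}$ in degree $p\ge0$, $\delta_p(a_0\otimes\cdots\otimes a_{p+1})=\sum_{j=0}^p(-1)^ja_0\otimes\cdots\otimes a_ja_{j+1}\otimes\cdots\otimes a_{p+1}$. Koszul resolution: $S(V)^e\otimes\bigwedge^p(V)$ in degree $p\ge0$, with $S(V)^e$-linear $d_p(1\otimes1\otimes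 w_1\wedge\cdots\wedge w_p)=\sum_{i=1}^p(-1)^{i+1}(w_i\otimes1-1\otimes w_i)\otimes(w_1\wedge\cdots\wedge\hat w_i\wedge\cdots\wedge w_p)$, $w_i\in V$. Applying $\operatorname{Hom}_{S(V)^e}(-,S(V)\#G)$, the bar cochains are $\operatorname{Hom}_{\mathbb{C}}(S(V)^{\otimes p},S(V)\#G)$ and the Koszul cochains are $C^p=\bigoplus_{g\in G}C^p_g$, $C^p_g=\operatorname{Hom}_{\mathbb{C}}(\bigwedge^pV,S(V)\bar g)=S(V)\bar g\otimes\bigwedge^pV^*$; both complexes compute $\mathrm{HH}^{\bullet}(S(V),S(V)\#G)$. $\Phi$ is the $S(V)^e$-linear chain map from the Koszul to the bar resolution, the identity in degree $0$, with $\Phi_p(1\otimes1\otimes w_1\wedge\cdots\wedge w_p)=\sum_{\pi\in\mathrm{Sym}_p}\operatorname{sgn}(\pi)\,1\otimes w_{\pi(1)}\otimes\cdots\otimes w_{\pi(p)}\otimes1$ for $p\ge 1$, and $\Phi^*$ is the map induced on cochains/cohomology by precomposition. $\Upsilon=\bigoplus_{g\in G}\Upsilon_g$: for each $g\in G$ fix a basis $B_g=\{v_1,\ldots,v_n\}$ of $V$ of eigenvectors of $g$, ${}^gv_i=\epsilon_iv_i$. Let $s_i\in GL(V)$ be given by ${}^{s_i}v_j=v_j$ ($j\ne i$), ${}^{s_i}v_i=\epsilon_iv_i$; let $\partial_i(f)=\dfrac{f-{}^{s_i}f}{v_i-{}^{s_i}v_i}$ if $\epsilon_i\ne1$ and $\partial_i=\partial/\partial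 v_i$ if $\epsilon_i=1$. For $\alpha=f_g\bar g\otimes v_{j_1}^*\wedge\cdots\wedge v_{j_p}^*$ with $j_1<\cdots<j_p$ ($v_i^*$ the dual basis), $\Upsilon_g(\alpha)(f_1\otimes\cdots\otimes f_p)=\bigl(\prod_{k=1}^p{}^{s_1s_2\cdots s_{j_k-1}}(\partial_{j_k}f_k)\bigr)f_g\bar g$, extended linearly to $C^p_g$. This is a cochain map, and the same symbol denotes the induced map on cohomology. $G$ acts on $S(V)\#G$ by ${}^h(a\bar g)=({}^ha)\,\overline{hgh^{-1}}$, on $V^*$ contragrediently, and on cochains by $({}^h\theta)(x)={}^h(\theta({}^{h^{-1}}x))$; this induces the $G$-action on $\mathrm{HH}^{\bullet}(S(V),S(V)\#G)$, independent of which of the two resolutions is used. The isomorphism $\mathrm{HH}^{\bullet}(S(V)\#G)\cong\mathrm{HH}^{\bullet}(S(V),S(V)\#G)^G$ is a known result (\c{S}tefan), used to identify the two spaces. *)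

theory Defs
  imports
    Complex_Main
    "HOL-Library.Poly_Mapping"
    "HOL-Library.Multiset"
    "HOL-Library.Function_Algebras"
    "HOL-Combinatorics.Permutations"
    "HOL-Algebra.Group"
begin

section \<open>Complex vector spaces\<close>

class complex_vector = ab_group_add +
  fixes scaleC :: "complex \<Rightarrow> 'a \<Rightarrow> 'a"  (infixr "*\<^sub>C" 75)
  assumes scaleC_add_right: "a *\<^sub>C (x + y) = a *\<^sub>C x + a *\<^sub>C y"
    and scaleC_add_left: "(a + b) *\<^sub>C x = a *\<^sub>C x + b *\<^sub>C x"
    and scaleC_scaleC: "a *\<^sub>C b *\<^sub>C x = (a * b) *\<^sub>C x"
    and scaleC_one: "1 *\<^sub>C x = x"

global_interpretation complex_vector:
  vector_space "scaleC :: complex \<Rightarrow> 'a \<Rightarrow> 'a::complex_vector"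
  by standard (simp_all add: scaleC_add_right scaleC_add_left scaleC_scaleC scaleC_one)

abbreviation clinear :: "('a::complex_vector \<Rightarrow> 'b::complex_vector) \<Rightarrow> bool" where
  "clinear \<equiv> Vector_Spaces.linear scaleC scaleC"

instantiation "fun" :: (type, complex_vector) complex_vector
begin

definition scaleC_fun :: "complex \<Rightarrow> ('a \<Rightarrow> 'b) \<Rightarrow> 'a \<Rightarrow> 'b" where
  "scaleC_fun c f = (\<lambda>x. c *\<^sub>C f x)"

instance
  by standard
    (simp_all add: scaleC_fun_def fun_eq_iff scaleC_add_right scaleC_add_left
      scaleC_scaleC scaleC_one)

end


section \<open>The symmetric algebra\<close>

text \<open>
  \<^typ>\<open>'v multiset \<Rightarrow>\<^sub>0 complex\<close> is the free commutative algebra on the set \<^typ>\<open>'v\<close>: a multiset is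
  a monomial, and addition of multisets is multiplication of monomials.  Dividing by the
  ideal that makes \<^term>\<open>\<lambda>v. {#v#}\<close> linear gives \<open>S(V)\<close>, for \<open>V\<close> the whole type.
\<close>

inductive_set sym_ideal :: "('v::complex_vector multiset \<Rightarrow>\<^sub>0 complex) set" where
  zero: "0 \<in> sym_ideal"
| add: "p \<in> sym_ideal \<Longrightarrow> q \<in> sym_ideal \<Longrightarrow> p + q \<in> sym_ideal"
| mult: "p \<in> sym_ideal \<Longrightarrow> r * p \<in> sym_ideal"
| gen_add: "Poly_Mapping.single {#v + w#} 1 - Poly_Mapping.single {#v#} 1
    - Poly_Mapping.single {#w#} 1 \<in> sym_ideal"
| gen_scale: "Poly_Mapping.single {#c *\<^sub>C v#} 1 - Poly_Mapping.single {#v#} c \<in> sym_ideal"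

lemma sym_ideal_uminus: "p \<in> sym_ideal \<Longrightarrow> - p \<in> sym_ideal"
  using sym_ideal.mult[of p "-1"] by simp

lemma sym_ideal_diff: "p \<in> sym_ideal \<Longrightarrow> q \<in> sym_ideal \<Longrightarrow> p - q \<in> sym_ideal"
  using sym_ideal.add[of p "-q"] sym_ideal_uminus[of q] by simp

lemma lookup_mult_empty:
  fixes p q :: "'v multiset \<Rightarrow>\<^sub>0 complex"
  shows "Poly_Mapping.lookup (p * q) {#} = Poly_Mapping.lookup p {#} * Poly_Mapping.lookup q {#}"
proof -
  have "{#} = l + k \<longleftrightarrow> l = {#} \<and> k = {#}" for l k :: "'v multiset"
    by auto
  then show ?thesis
    by (simp add: lookup_mult flip: when_when, simp add: when_when mult_when)
qed

lemma sym_ideal_lookup_empty: "p \<in> sym_ideal \<Longrightarrow> Poly_Mapping.lookup p {#} = 0"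
  by (induction rule: sym_ideal.induct)
    (auto simp: lookup_add lookup_minus lookup_single lookup_mult_empty when_def)

lemma equivp_sym_ideal:
  "equivp (\<lambda>p q :: 'v::complex_vector multiset \<Rightarrow>\<^sub>0 complex. p - q \<in> sym_ideal)"
proof (rule equivpI)
  show "reflp (\<lambda>p q :: 'v multiset \<Rightarrow>\<^sub>0 complex. p - q \<in> sym_ideal)"
    by (simp add: reflp_def sym_ideal.zero)
  show "symp (\<lambda>p q :: 'v multiset \<Rightarrow>\<^sub>0 complex. p - q \<in> sym_ideal)"
  proof (rule sympI)
    fix p q :: "'v multiset \<Rightarrow>\<^sub>0 complex"
    assume "p - q \<in> sym_ideal"
    then show "q - p \<in> sym_ideal"
      using sym_ideal_uminus[of "p - q"] by simp
  qed
  show "transp (\<lambda>p q :: 'v multiset \<Rightarrow>\<^sub>0 complex. p - q \<in> sym_ideal)"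
  proof (rule transpI)
    fix p q r :: "'v multiset \<Rightarrow>\<^sub>0 complex"
    assume "p - q \<in> sym_ideal" "q - r \<in> sym_ideal"
    then show "p - r \<in> sym_ideal"
      using sym_ideal.add[of "p - q" "q - r"] by simp
  qed
qed

quotient_type (overloaded) 'v sym =
  "'v::complex_vector multiset \<Rightarrow>\<^sub>0 complex" / "\<lambda>p q. p - q \<in> sym_ideal"
  morphisms sym_rep sym_of
  by (rule equivp_sym_ideal)

instantiation sym :: (complex_vector) comm_ring_1
begin

lift_definition zero_sym :: "'a sym" is 0 .

lift_definition one_sym :: "'a sym" is 1 .

lift_definition plus_sym :: "'a sym \<Rightarrow> 'a sym \<Rightarrow> 'a sym" is "(+)"
proof -
  fix p p' q q' :: "'a multiset \<Rightarrow>\<^sub>0 complex"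
  assume "p - p' \<in> sym_ideal" "q - q' \<in> sym_ideal"
  then have "(p - p') + (q - q') \<in> sym_ideal"
    by (rule sym_ideal.add)
  moreover have "(p - p') + (q - q') = (p + q) - (p' + q')"
    by (simp add: algebra_simps)
  ultimately show "(p + q) - (p' + q') \<in> sym_ideal"
    by (simp only:)
qed

lift_definition minus_sym :: "'a sym \<Rightarrow> 'a sym \<Rightarrow> 'a sym" is "(-)"
proof -
  fix p p' q q' :: "'a multiset \<Rightarrow>\<^sub>0 complex"
  assume "p - p' \<in> sym_ideal" "q - q' \<in> sym_ideal"
  then have "(p - p') - (q - q') \<in> sym_ideal"
    by (rule sym_ideal_diff)
  moreover have "(p - p') - (q - q') = (p - q) - (p' - q')"
    by (simp add: algebra_simps)
  ultimately show "(p - q) - (p' - q') \<in> sym_ideal"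
    by (simp only:)
qed

lift_definition uminus_sym :: "'a sym \<Rightarrow> 'a sym" is uminus
proof -
  fix p q :: "'a multiset \<Rightarrow>\<^sub>0 complex"
  assume "p - q \<in> sym_ideal"
  then show "- p - - q \<in> sym_ideal"
    using sym_ideal_uminus[of "p - q"] by simp
qed

lift_definition times_sym :: "'a sym \<Rightarrow> 'a sym \<Rightarrow> 'a sym" is "(*)"
proof -
  fix p p' q q' :: "'a multiset \<Rightarrow>\<^sub>0 complex"
  assume "p - p' \<in> sym_ideal" "q - q' \<in> sym_ideal"
  then have "q * (p - p') + p' * (q - q') \<in> sym_ideal"
    by (intro sym_ideal.add sym_ideal.mult)
  moreover have "q * (p - p') + p' * (q - q') = p * q - p' * q'"
    by (simp add: algebra_simps)
  ultimately show "p * q - p' * q' \<in> sym_ideal"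
    by (simp only:)
qed

instance
proof
  show "(0::'a sym) \<noteq> 1"
  proof (transfer, rule notI)
    assume "(0::'a multiset \<Rightarrow>\<^sub>0 complex) - 1 \<in> sym_ideal"
    then show False
      using sym_ideal_lookup_empty[of "0 - 1 :: 'a multiset \<Rightarrow>\<^sub>0 complex"]
      by (simp add: lookup_minus lookup_one)
  qed
  fix a b c :: "'a sym"
  show "a * b * c = a * (b * c)" by transfer (simp add: mult.assoc sym_ideal.zero)
  show "a * b = b * a" by transfer (simp add: mult.commute sym_ideal.zero)
  show "1 * a = a" by transfer (simp add: sym_ideal.zero)
  show "a + b + c = a + (b + c)" by transfer (simp add: add.assoc sym_ideal.zero)
  show "a + b = b + a" by transfer (simp add: add.commute sym_ideal.zero)
  show "0 + a = a" by transfer (simp add: sym_ideal.zero)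
  show "- a + a = 0" by transfer (simp add: sym_ideal.zero)
  show "a - b = a + - b" by transfer (simp add: sym_ideal.zero)
  show "(a + b) * c = a * c + b * c" by transfer (simp add: distrib_right sym_ideal.zero)
qed

end

instantiation sym :: (complex_vector) complex_vector
begin

lift_definition scaleC_sym :: "complex \<Rightarrow> 'a sym \<Rightarrow> 'a sym"
  is "\<lambda>c p. Poly_Mapping.single {#} c * p"
  by (simp add: sym_ideal.mult flip: right_diff_distrib)

instance
proof
  fix a b :: complex and x y :: "'a sym"
  show "a *\<^sub>C (x + y) = a *\<^sub>C x + a *\<^sub>C y"
    by transfer (simp add: distrib_left sym_ideal.zero)
  show "(a + b) *\<^sub>C x = a *\<^sub>C x + b *\<^sub>C x"
    by transfer (simp add: distrib_right single_add sym_ideal.zero)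
  show "a *\<^sub>C b *\<^sub>C x = (a * b) *\<^sub>C x"
    by transfer (simp add: mult_single mult.assoc[symmetric] sym_ideal.zero)
  show "1 *\<^sub>C x = x"
    by transfer (simp add: sym_ideal.zero)
qed

end

lift_definition sym_incl :: "'v::complex_vector \<Rightarrow> 'v sym" is "\<lambda>v. Poly_Mapping.single {#v#} 1" .

text \<open>
  The algebra map \<open>S(V) \<rightarrow> S(W)\<close> extending a linear map, and the derivation of \<open>S(V)\<close> extending
  a linear functional \<open>\<lambda>\<close>, \<open>v\<^sub>1 \<dots> v\<^sub>k \<mapsto> \<Sum>\<^sub>i \<lambda>(v\<^sub>i) v\<^sub>1 \<dots> v\<^sub>i\<^sub>-\<^sub>1 v\<^sub>i\<^sub>+\<^sub>1 \<dots> v\<^sub>k\<close>.  Both are computed on a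
  representative; for linear arguments the choice does not matter
  (\<open>sym_map_sym_of\<close>, \<open>sym_deriv_sym_of\<close>).
\<close>

definition free_map :: "('v \<Rightarrow> 'w) \<Rightarrow> ('v multiset \<Rightarrow>\<^sub>0 complex) \<Rightarrow> ('w multiset \<Rightarrow>\<^sub>0 complex)" where
  "free_map T p = (\<Sum>m\<in>Poly_Mapping.keys p. Poly_Mapping.single (image_mset T m) (Poly_Mapping.lookup p m))"

definition free_deriv ::
  "('v \<Rightarrow> complex) \<Rightarrow> ('v multiset \<Rightarrow>\<^sub>0 complex) \<Rightarrow> ('v multiset \<Rightarrow>\<^sub>0 complex)" where
  "free_deriv l p =
    (\<Sum>m\<in>Poly_Mapping.keys p. \<Sum>v\<in>#m. Poly_Mapping.single (m - {#v#}) (Poly_Mapping.lookup p m * l v))"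

definition sym_map :: "('v::complex_vector \<Rightarrow> 'w::complex_vector) \<Rightarrow> 'v sym \<Rightarrow> 'w sym" where
  "sym_map T f = sym_of (free_map T (sym_rep f))"

definition sym_deriv :: "('v::complex_vector \<Rightarrow> complex) \<Rightarrow> 'v sym \<Rightarrow> 'v sym" where
  "sym_deriv l f = sym_of (free_deriv l (sym_rep f))"

lemma free_map_add: "free_map T (p + q) = free_map T p + free_map T q"
  unfolding free_map_def
  using setsum_keys_plus_distrib[of "\<lambda>m. Poly_Mapping.single (image_mset T m)" p q]
  by (simp add: single_add)

lemma free_map_single: "free_map T (Poly_Mapping.single m c) = Poly_Mapping.single (image_mset T m) c"
  by (simp add: free_map_def)

lemma free_deriv_add: "free_deriv l (p + q) = free_deriv l p + free_deriv l q"
  unfolding free_deriv_def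
  using setsum_keys_plus_distrib
    [of "\<lambda>m c. \<Sum>v\<in>#m. Poly_Mapping.single (m - {#v#}) (c * l v)" p q]
  by (simp add: single_add distrib_right sum_mset.distrib)

lemma free_deriv_single: "free_deriv l (Poly_Mapping.single m c) =
    (\<Sum>v\<in>#m. Poly_Mapping.single (m - {#v#}) (c * l v))"
  by (simp add: free_deriv_def)

lemma free_induct [case_names single add]:
  fixes p :: "'v multiset \<Rightarrow>\<^sub>0 complex"
  assumes "\<And>m c. P (Poly_Mapping.single m c)" and "\<And>p q. P p \<Longrightarrow> P q \<Longrightarrow> P (p + q)"
  shows "P p"
proof -
  have "P (\<Sum>m\<in>M. Poly_Mapping.single m (c m))" if "finite M" for M and c :: "'v multiset \<Rightarrow> complex"
    using that
  proof (induction M)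
    case empty
    show ?case using assms(1)[of 0 0] by simp
  next
    case (insert m M)
    then show ?case by (simp add: assms)
  qed
  moreover have "p = (\<Sum>m\<in>Poly_Mapping.keys p. Poly_Mapping.single m (Poly_Mapping.lookup p m))"
    by (rule poly_mapping_eqI)
      (auto simp: lookup_sum lookup_single when_def sum.delta in_keys_iff)
  ultimately show ?thesis
    by (metis finite_keys)
qed

lemma free_map_mult: "free_map T (p * q) = free_map T p * free_map T q"
proof (induction p rule: free_induct)
  case (single m c)
  show ?case
    by (induction q rule: free_induct)
      (simp_all add: free_map_single mult_single distrib_left free_map_add)
qed (simp add: distrib_right free_map_add)

lemma free_deriv_mult: "free_deriv l (p * q) = free_deriv l p * q + p * free_deriv l q"
proof (induction p rule: free_induct)
  case (single m c)
  show ?case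
  proof (induction q rule: free_induct)
    case (single k d)
    have 1: "(\<Sum>v\<in>#m. Poly_Mapping.single (m + k - {#v#}) (c * d * l v)) =
        (\<Sum>v\<in>#m. Poly_Mapping.single (m - {#v#}) (c * l v)) * Poly_Mapping.single k d"
      unfolding sum_mset_distrib_right
      by (rule arg_cong[where f = sum_mset], rule image_mset_cong)
        (auto simp: mult_single ac_simps)
    have 2: "(\<Sum>v\<in>#k. Poly_Mapping.single (m + k - {#v#}) (c * d * l v)) =
        Poly_Mapping.single m c * (\<Sum>v\<in>#k. Poly_Mapping.single (k - {#v#}) (d * l v))"
      unfolding sum_mset_distrib_left
      by (rule arg_cong[where f = sum_mset], rule image_mset_cong)
        (auto simp: mult_single ac_simps)
    show ?case
      by (simp add: mult_single free_deriv_single 1 2)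
  qed (simp add: distrib_left free_deriv_add)
qed (simp add: distrib_right free_deriv_add)

lemma free_map_diff: "free_map T (p - q) = free_map T p - free_map T q"
  using free_map_add[of T "p - q" q] by simp

lemma free_deriv_diff: "free_deriv l (p - q) = free_deriv l p - free_deriv l q"
  using free_deriv_add[of l "p - q" q] by simp

lemma single_scale_const:
  "Poly_Mapping.single m (c::complex) = Poly_Mapping.single {#} c * Poly_Mapping.single m 1"
  by (simp add: mult_single)

lemma free_map_sym_ideal:
  assumes "clinear T" and "p \<in> sym_ideal"
  shows "free_map T p \<in> sym_ideal"
  using assms(2)
proof induction
  case zero
  show ?case by (simp add: free_map_def sym_ideal.zero)
next
  case (gen_add v w)
  interpret Vector_Spaces.linear scaleC scaleC T by fact
  show ?case
    by (simp add: free_map_diff free_map_single add sym_ideal.gen_add)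
next
  case (gen_scale c v)
  interpret Vector_Spaces.linear scaleC scaleC T by fact
  show ?case
    by (simp add: free_map_diff free_map_single scale sym_ideal.gen_scale)
qed (simp_all add: free_map_add free_map_mult sym_ideal.add sym_ideal.mult)

lemma free_deriv_sym_ideal:
  assumes "Vector_Spaces.linear scaleC (*) l" and "p \<in> sym_ideal"
  shows "free_deriv l p \<in> sym_ideal"
  using assms(2)
proof induction
  case zero
  show ?case by (simp add: free_deriv_def sym_ideal.zero)
next
  case (mult p r)
  then show ?case
    by (simp add: free_deriv_mult sym_ideal.add sym_ideal.mult)
next
  case (gen_add v w)
  interpret Vector_Spaces.linear scaleC "(*)" l by fact
  show ?case
    by (simp add: free_deriv_diff free_deriv_single add single_add sym_ideal.zero)
next
  case (gen_scale c v)
  interpret Vector_Spaces.linear scaleC "(*)" l by fact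
  show ?case
    by (simp add: free_deriv_diff free_deriv_single scale sym_ideal.zero)
qed (simp_all add: free_deriv_add sym_ideal.add)

lemma sym_of_eq_iff: "sym_of p = sym_of q \<longleftrightarrow> p - q \<in> sym_ideal"
  by (rule sym.abs_eq_iff)

lemma sym_rep_sym_of: "sym_rep (sym_of p) - p \<in> sym_ideal"
  by (rule Quotient3_rep_abs[OF Quotient3_sym]) (simp add: sym_ideal.zero)

lemma sym_map_sym_of: "clinear T \<Longrightarrow> sym_map T (sym_of p) = sym_of (free_map T p)"
  unfolding sym_map_def sym_of_eq_iff free_map_diff[symmetric]
  by (intro free_map_sym_ideal sym_rep_sym_of)

lemma sym_deriv_sym_of:
  "Vector_Spaces.linear scaleC (*) l \<Longrightarrow> sym_deriv l (sym_of p) = sym_of (free_deriv l p)"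
  unfolding sym_deriv_def sym_of_eq_iff free_deriv_diff[symmetric]
  by (intro free_deriv_sym_ideal sym_rep_sym_of)


section \<open>Group actions and the skew group algebra\<close>

definition linear_action :: "('g, 'x) monoid_scheme \<Rightarrow> ('g \<Rightarrow> 'v::complex_vector \<Rightarrow> 'v) \<Rightarrow> bool" where
  "linear_action G \<rho> \<longleftrightarrow>
    (\<forall>g\<in>carrier G. clinear (\<rho> g)) \<and> (\<forall>v. \<rho> \<one>\<^bsub>G\<^esub> v = v) \<and>
    (\<forall>g\<in>carrier G. \<forall>h\<in>carrier G. \<forall>v. \<rho> (g \<otimes>\<^bsub>G\<^esub> h) v = \<rho> g (\<rho> h v))"

text \<open>
  \<open>\<Sum>\<^sub>g a\<^sub>g g\<close> is represented by the coefficient function \<open>g \<mapsto> a\<^sub>g\<close>, vanishing outside the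
  carrier.  The additive structure is the pointwise one; the product is \<open>skew_mult\<close>, not the
  pointwise product that functions also carry.
\<close>

definition skew_carrier :: "('g, 'x) monoid_scheme \<Rightarrow> ('g \<Rightarrow> 'v::complex_vector sym) set" where
  "skew_carrier G = {F. \<forall>g. g \<notin> carrier G \<longrightarrow> F g = 0}"

definition skew_single :: "'g \<Rightarrow> 'v::complex_vector sym \<Rightarrow> 'g \<Rightarrow> 'v sym" where
  "skew_single g a = (\<lambda>k. if k = g then a else 0)"

definition skew_mult :: "('g, 'x) monoid_scheme \<Rightarrow> ('g \<Rightarrow> 'v::complex_vector \<Rightarrow> 'v) \<Rightarrow>
    ('g \<Rightarrow> 'v sym) \<Rightarrow> ('g \<Rightarrow> 'v sym) \<Rightarrow> 'g \<Rightarrow> 'v sym" where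
  "skew_mult G \<rho> F H =
    (\<Sum>g\<in>carrier G. \<Sum>h\<in>carrier G. skew_single (g \<otimes>\<^bsub>G\<^esub> h) (F g * sym_map (\<rho> g) (H h)))"

definition skew_emb :: "('g, 'x) monoid_scheme \<Rightarrow> 'v::complex_vector sym \<Rightarrow> 'g \<Rightarrow> 'v sym" where
  "skew_emb G a = skew_single \<one>\<^bsub>G\<^esub> a"

definition skew_act :: "('g, 'x) monoid_scheme \<Rightarrow> ('g \<Rightarrow> 'v::complex_vector \<Rightarrow> 'v) \<Rightarrow>
    'g \<Rightarrow> ('g \<Rightarrow> 'v sym) \<Rightarrow> 'g \<Rightarrow> 'v sym" where
  "skew_act G \<rho> h F =
    (\<Sum>g\<in>carrier G. skew_single (h \<otimes>\<^bsub>G\<^esub> g \<otimes>\<^bsub>G\<^esub> inv\<^bsub>G\<^esub> h) (sym_map (\<rho> h) (F g)))"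


section \<open>Cochain complexes and cohomology\<close>

record 'c cochain_complex =
  cochains :: "nat \<Rightarrow> 'c set"
  codiff :: "nat \<Rightarrow> 'c \<Rightarrow> 'c"

definition cocycles :: "'c::complex_vector cochain_complex \<Rightarrow> nat \<Rightarrow> 'c set" where
  "cocycles K p = {x \<in> cochains K p. codiff K p x = 0}"

definition coboundaries :: "'c::complex_vector cochain_complex \<Rightarrow> nat \<Rightarrow> 'c set" where
  "coboundaries K p = (case p of 0 \<Rightarrow> {0} | Suc q \<Rightarrow> codiff K q ` cochains K q)"

definition cohomologous :: "'c::complex_vector cochain_complex \<Rightarrow> nat \<Rightarrow> ('c \<times> 'c) set" where
  "cohomologous K p =
    {(x, y). x \<in> cocycles K p \<and> y \<in> cocycles K p \<and> x - y \<in> coboundaries K p}"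

definition cohomology :: "'c::complex_vector cochain_complex \<Rightarrow> nat \<Rightarrow> 'c set set" where
  "cohomology K p = cocycles K p // cohomologous K p"

text \<open>
  Operations on cohomology classes are induced from operations on cocycles by the usual union
  over representatives.  If \<open>f\<close> does not respect the relation, \<open>coh_map L p f\<close> does not take
  values in \<^term>\<open>cohomology L p\<close>.
\<close>

definition coh_map :: "'d::complex_vector cochain_complex \<Rightarrow> nat \<Rightarrow> ('c \<Rightarrow> 'd) \<Rightarrow> 'c set \<Rightarrow> 'd set"
  where "coh_map L p f X = (\<Union>x\<in>X. cohomologous L p `` {f x})"

definition coh_add :: "'c::complex_vector cochain_complex \<Rightarrow> nat \<Rightarrow> 'c set \<Rightarrow> 'c set \<Rightarrow> 'c set" where
  "coh_add K p X Y = (\<Union>x\<in>X. \<Union>y\<in>Y. cohomologous K p `` {x + y})"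

definition coh_scale :: "'c::complex_vector cochain_complex \<Rightarrow> nat \<Rightarrow> complex \<Rightarrow> 'c set \<Rightarrow> 'c set" where
  "coh_scale K p a X = (\<Union>x\<in>X. cohomologous K p `` {a *\<^sub>C x})"

definition coh_invariants :: "('g, 'x) monoid_scheme \<Rightarrow> ('g \<Rightarrow> 'c \<Rightarrow> 'c) \<Rightarrow>
    'c::complex_vector cochain_complex \<Rightarrow> nat \<Rightarrow> 'c set set" where
  "coh_invariants G act K p =
    {X \<in> cohomology K p. \<forall>h\<in>carrier G. coh_map K p (act h) X = X}"

text \<open>\<open>F\<close> is a linear isomorphism from the subspace \<open>A\<close> of \<open>H\<^sup>p(K)\<close> onto the subspace \<open>B\<close> of \<open>H\<^sup>p(L)\<close>.\<close>

definition coh_iso :: "'c::complex_vector cochain_complex \<Rightarrow> 'd::complex_vector cochain_complex \<Rightarrow>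
    nat \<Rightarrow> 'c set set \<Rightarrow> 'd set set \<Rightarrow> ('c set \<Rightarrow> 'd set) \<Rightarrow> bool" where
  "coh_iso K L p A B F \<longleftrightarrow>
    bij_betw F A B \<and>
    (\<forall>X\<in>A. \<forall>Y\<in>A. F (coh_add K p X Y) = coh_add L p (F X) (F Y)) \<and>
    (\<forall>a. \<forall>X\<in>A. F (coh_scale K p a X) = coh_scale L p a (F X))"

definition inverse_coh_isos :: "'c::complex_vector cochain_complex \<Rightarrow>
    'd::complex_vector cochain_complex \<Rightarrow> nat \<Rightarrow> 'c set set \<Rightarrow> 'd set set \<Rightarrow>
    ('c set \<Rightarrow> 'd set) \<Rightarrow> ('d set \<Rightarrow> 'c set) \<Rightarrow> bool" where
  "inverse_coh_isos K L p A B F F' \<longleftrightarrow>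
    coh_iso K L p A B F \<and> coh_iso L K p B A F' \<and>
    (\<forall>X\<in>A. F' (F X) = X) \<and> (\<forall>Y\<in>B. F (F' Y) = Y)"


section \<open>Bar and Koszul cochains\<close>

text \<open>
  \<open>Hom(A\<^sup>\<otimes>\<^sup>p, M)\<close> as multilinear maps on lists of length \<open>p\<close> over the carrier \<open>A\<close>, with value 0 on
  all other lists, so that cochains are equal as functions iff they agree on their domain.
\<close>

definition multilinear_maps :: "'a::complex_vector set \<Rightarrow> 'm::complex_vector set \<Rightarrow> nat \<Rightarrow>
    ('a list \<Rightarrow> 'm) set" where
  "multilinear_maps A M p = {f.
    (\<forall>xs. length xs = p \<and> set xs \<subseteq> A \<longrightarrow> f xs \<in> M) \<and>
    (\<forall>xs. \<not> (length xs = p \<and> set xs \<subseteq> A) \<longrightarrow> f xs = 0) \<and>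
    (\<forall>xs ys. length xs + Suc (length ys) = p \<and> set xs \<subseteq> A \<and> set ys \<subseteq> A \<longrightarrow>
      (\<forall>x\<in>A. \<forall>y\<in>A. f (xs @ (x + y) # ys) = f (xs @ x # ys) + f (xs @ y # ys)) \<and>
      (\<forall>a. \<forall>x\<in>A. f (xs @ (a *\<^sub>C x) # ys) = a *\<^sub>C f (xs @ x # ys)))}"

text \<open>\<open>Hom(\<And>\<^sup>pV, M)\<close> as alternating multilinear maps.\<close>

definition alternating_maps :: "'m::complex_vector set \<Rightarrow> nat \<Rightarrow> ('v::complex_vector list \<Rightarrow> 'm) set" where
  "alternating_maps M p = {f \<in> multilinear_maps UNIV M p. \<forall>ws. \<not> distinct ws \<longrightarrow> f ws = 0}"

text \<open>
  \<open>bar_complex A mul M lact ract\<close> is \<open>Hom\<^bsub>A\<^sup>e\<^esub>(Bar(A), M)\<close>, where \<open>f\<close> corresponds to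
  \<open>a\<^sub>0 \<otimes> \<dots> \<otimes> a\<^bsub>p+1\<^esub> \<mapsto> a\<^sub>0 f(a\<^sub>1, \<dots>, a\<^sub>p) a\<^bsub>p+1\<^esub>\<close>; the outer two terms of the differential are the
  summands \<open>j = 0\<close> and \<open>j = p + 1\<close> of \<open>f \<circ> \<delta>\<^bsub>p+1\<^esub>\<close>, and the index \<open>i\<close> below is \<open>j - 1\<close>.
\<close>

definition bar_complex :: "'a::complex_vector set \<Rightarrow> ('a \<Rightarrow> 'a \<Rightarrow> 'a) \<Rightarrow> 'm::complex_vector set \<Rightarrow>
    ('a \<Rightarrow> 'm \<Rightarrow> 'm) \<Rightarrow> ('m \<Rightarrow> 'a \<Rightarrow> 'm) \<Rightarrow> ('a list \<Rightarrow> 'm) cochain_complex" where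
  "bar_complex A mul M lact ract =
    \<lparr>cochains = multilinear_maps A M,
     codiff = (\<lambda>p f xs.
       if length xs = Suc p \<and> set xs \<subseteq> A then
         lact (hd xs) (f (tl xs))
         + (\<Sum>i<p. ((-1) ^ Suc i) *\<^sub>C
             f (take i xs @ mul (xs ! i) (xs ! Suc i) # drop (Suc (Suc i)) xs))
         + ((-1) ^ Suc p) *\<^sub>C ract (f (butlast xs)) (last xs)
       else 0)\<rparr>"

text \<open>\<open>Hom\<^bsub>S(V)\<^sup>e\<^esub>(Kos, M)\<close>.  Positions are numbered from 0, so the sign is \<open>(-1)\<^sup>i\<close>.\<close>

definition koszul_complex :: "'m::complex_vector set \<Rightarrow> ('v::complex_vector sym \<Rightarrow> 'm \<Rightarrow> 'm) \<Rightarrow>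
    ('m \<Rightarrow> 'v sym \<Rightarrow> 'm) \<Rightarrow> ('v list \<Rightarrow> 'm) cochain_complex" where
  "koszul_complex M lact ract =
    \<lparr>cochains = alternating_maps M,
     codiff = (\<lambda>p f ws.
       if length ws = Suc p then
         (\<Sum>i<Suc p. let w = sym_incl (ws ! i); y = f (take i ws @ drop (Suc i) ws)
            in ((-1) ^ i) *\<^sub>C (lact w y - ract y w))
       else 0)\<rparr>"

text \<open>
  The complexes computing \<open>HH(S(V), S(V)#G)\<close> from the bar and Koszul resolutions of \<open>S(V)\<close>, and
  \<open>HH(S(V)#G)\<close> from the bar resolution of \<open>S(V)#G\<close>.  The bimodule structure of \<open>S(V)#G\<close> is given
  by multiplication in \<open>S(V)#G\<close>, restricted along \<open>skew_emb\<close> in the first two cases.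
\<close>

definition sym_bar :: "('g, 'x) monoid_scheme \<Rightarrow> ('g \<Rightarrow> 'v::complex_vector \<Rightarrow> 'v) \<Rightarrow>
    ('v sym list \<Rightarrow> 'g \<Rightarrow> 'v sym) cochain_complex" where
  "sym_bar G \<rho> = bar_complex UNIV (*) (skew_carrier G)
    (\<lambda>a F. skew_mult G \<rho> (skew_emb G a) F) (\<lambda>F a. skew_mult G \<rho> F (skew_emb G a))"

definition sym_koszul :: "('g, 'x) monoid_scheme \<Rightarrow> ('g \<Rightarrow> 'v::complex_vector \<Rightarrow> 'v) \<Rightarrow>
    ('v list \<Rightarrow> 'g \<Rightarrow> 'v sym) cochain_complex" where
  "sym_koszul G \<rho> = koszul_complex (skew_carrier G)
    (\<lambda>a F. skew_mult G \<rho> (skew_emb G a) F) (\<lambda>F a. skew_mult G \<rho> F (skew_emb G a))"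

definition skew_bar :: "('g, 'x) monoid_scheme \<Rightarrow> ('g \<Rightarrow> 'v::complex_vector \<Rightarrow> 'v) \<Rightarrow>
    (('g \<Rightarrow> 'v sym) list \<Rightarrow> 'g \<Rightarrow> 'v sym) cochain_complex" where
  "skew_bar G \<rho> = bar_complex (skew_carrier G) (skew_mult G \<rho>) (skew_carrier G)
    (skew_mult G \<rho>) (skew_mult G \<rho>)"

definition act_bar :: "('g, 'x) monoid_scheme \<Rightarrow> ('g \<Rightarrow> 'v::complex_vector \<Rightarrow> 'v) \<Rightarrow> 'g \<Rightarrow>
    ('v sym list \<Rightarrow> 'g \<Rightarrow> 'v sym) \<Rightarrow> 'v sym list \<Rightarrow> 'g \<Rightarrow> 'v sym" where
  "act_bar G \<rho> h f = (\<lambda>fs. skew_act G \<rho> h (f (map (sym_map (\<rho> (inv\<^bsub>G\<^esub> h))) fs)))"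

definition act_koszul :: "('g, 'x) monoid_scheme \<Rightarrow> ('g \<Rightarrow> 'v::complex_vector \<Rightarrow> 'v) \<Rightarrow> 'g \<Rightarrow>
    ('v list \<Rightarrow> 'g \<Rightarrow> 'v sym) \<Rightarrow> 'v list \<Rightarrow> 'g \<Rightarrow> 'v sym" where
  "act_koszul G \<rho> h \<alpha> = (\<lambda>ws. skew_act G \<rho> h (\<alpha> (map (\<rho> (inv\<^bsub>G\<^esub> h)) ws)))"

text \<open>Restriction of bar cochains along \<open>S(V) \<subseteq> S(V)#G\<close>, which induces the isomorphism of Stefan.\<close>

definition restrict_cochain :: "('g, 'x) monoid_scheme \<Rightarrow>
    (('g \<Rightarrow> 'v::complex_vector sym) list \<Rightarrow> 'g \<Rightarrow> 'v sym) \<Rightarrow> 'v sym list \<Rightarrow> 'g \<Rightarrow> 'v sym" where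
  "restrict_cochain G f = (\<lambda>fs. f (map (skew_emb G) fs))"


section \<open>The chain maps\<close>

definition phi_star :: "nat \<Rightarrow> ('v::complex_vector sym list \<Rightarrow> 'm::complex_vector) \<Rightarrow> 'v list \<Rightarrow> 'm" where
  "phi_star p f = (\<lambda>ws.
    if length ws = p then
      (\<Sum>\<pi> | \<pi> permutes {..<p}.
        of_int (sign \<pi>) *\<^sub>C f (map (\<lambda>k. sym_incl (ws ! \<pi> k)) [0..<p]))
    else 0)"

text \<open>
  An ordered basis \<open>v\<^sub>0, \<dots>, v\<^bsub>n-1\<^esub>\<close> is a list \<open>bs\<close>; \<open>eps i\<close> is the eigenvalue of \<open>v\<^sub>i\<close>.
\<close>

definition eigenbasis :: "('v::complex_vector \<Rightarrow> 'v) \<Rightarrow> 'v list \<Rightarrow> (nat \<Rightarrow> complex) \<Rightarrow> bool" where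
  "eigenbasis T bs eps \<longleftrightarrow>
    distinct bs \<and> \<not> complex_vector.dependent (set bs) \<and> complex_vector.span (set bs) = UNIV \<and>
    (\<forall>i<length bs. T (bs ! i) = eps i *\<^sub>C (bs ! i))"

definition coord :: "'v::complex_vector list \<Rightarrow> nat \<Rightarrow> 'v \<Rightarrow> complex" where
  "coord bs i v = complex_vector.representation (set bs) v (bs ! i)"

definition diag_refl :: "'v::complex_vector list \<Rightarrow> (nat \<Rightarrow> complex) \<Rightarrow> nat \<Rightarrow> 'v \<Rightarrow> 'v" where
  "diag_refl bs eps i v =
    (\<Sum>j<length bs. coord bs j v *\<^sub>C (if j = i then eps i *\<^sub>C (bs ! j) else bs ! j))"

text \<open>
  The quantum partial derivative.  In the first case the quotient exists, and it is unique because
  \<open>S(V)\<close> is a domain and the divisor \<open>(1 - \<epsilon>\<^sub>i) v\<^sub>i\<close> is nonzero.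
\<close>

definition quantum_deriv :: "'v::complex_vector list \<Rightarrow> (nat \<Rightarrow> complex) \<Rightarrow> nat \<Rightarrow> 'v sym \<Rightarrow> 'v sym" where
  "quantum_deriv bs eps i f =
    (if eps i \<noteq> 1 then
       (THE q. q * (sym_incl (bs ! i) - sym_map (diag_refl bs eps i) (sym_incl (bs ! i)))
         = f - sym_map (diag_refl bs eps i) f)
     else sym_deriv (coord bs i) f)"

text \<open>
  The list \<open>js\<close> runs through \<open>j\<^sub>1 < \<dots> < j\<^sub>p\<close>.  The coefficient of
  \<open>v\<^bsub>j\<^sub>1\<^esub>\<^sup>* \<and> \<dots> \<and> v\<^bsub>j\<^sub>p\<^esub>\<^sup>*\<close> in an alternating map \<open>\<alpha>\<close> is \<open>\<alpha>(v\<^bsub>j\<^sub>1\<^esub>, \<dots>, v\<^bsub>j\<^sub>p\<^esub>)\<close>, under the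
  convention that this form takes the value 1 on \<open>(v\<^bsub>j\<^sub>1\<^esub>, \<dots>, v\<^bsub>j\<^sub>p\<^esub>)\<close>.
\<close>

definition upsilon_component :: "'v::complex_vector list \<Rightarrow> (nat \<Rightarrow> complex) \<Rightarrow> nat \<Rightarrow>
    ('v list \<Rightarrow> 'v sym) \<Rightarrow> 'v sym list \<Rightarrow> 'v sym" where
  "upsilon_component bs eps p \<alpha> fs =
    (\<Sum>js | length js = p \<and> sorted_wrt (<) js \<and> set js \<subseteq> {..<length bs}.
      (\<Prod>k<p. foldr (\<lambda>i. sym_map (diag_refl bs eps i)) [0..<js ! k]
        (quantum_deriv bs eps (js ! k) (fs ! k)))
      * \<alpha> (map ((!) bs) js))"

definition upsilon :: "('g, 'x) monoid_scheme \<Rightarrow> ('g \<Rightarrow> 'v::complex_vector list) \<Rightarrow>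
    ('g \<Rightarrow> nat \<Rightarrow> complex) \<Rightarrow> nat \<Rightarrow> ('v list \<Rightarrow> 'g \<Rightarrow> 'v sym) \<Rightarrow> 'v sym list \<Rightarrow> 'g \<Rightarrow> 'v sym" where
  "upsilon G b eps p \<alpha> = (\<lambda>fs.
    if length fs = p then
      (\<Sum>g\<in>carrier G. skew_single g (upsilon_component (b g) (eps g) p (\<lambda>ws. \<alpha> ws g) fs))
    else 0)"

end

theory Submission
  imports Defs
begin

text \<open>
  The maps \<open>\<Upsilon>\<close> and \<open>\<Phi>\<^sup>*\<close> compare Koszul and bar cochains of \<open>S(V)\<close> with values in \<open>S(V)#G\<close>.  In one order
  the composition is the identity already on cochains (\<open>phi_star_upsilon\<close>): on vectors the difference
  operators in \<open>\<Upsilon>(\<alpha>)\<close> evaluate to coordinates, and antisymmetrizing the products of coordinates is the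
  expansion of an alternating map in a basis.  That \<open>\<Upsilon>\<close> is a cochain map (\<open>Ups_chain\<close>) rests on two
  properties of these operators, a twisted Leibniz rule and a telescoping sum which decomposes the
  difference of the left and the right action.

  What remains is that \<open>\<Phi>\<^sup>*\<close> is injective in cohomology (\<open>pointwise_cocycle_trivial\<close>,
  \<open>phi_star_injective\<close>).  This is proved by dimension shifting.  A cocycle of degree \<open>q + 1\<close> with values
  in a bimodule \<open>N\<close> is a cochain of degree \<open>q\<close> with values in the coinduced bimodule \<open>Hom(S(V), N)\<close>, and
  a cocycle modulo \<open>N\<close>.  Difference operators, and hence a map \<open>\<Upsilon>\<close>, exist for coinduced bimodules too,
  because polynomials with coefficients in \<open>S(V)\<close> act on them.  With this \<open>\<Upsilon>\<close> the antisymmetrization of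
  the cochain is removed at the cost of a coboundary.  Then the quotient \<open>Hom(S(V), N)/N\<close> takes the role
  of \<open>N\<close> in degree \<open>q\<close>, and in degree \<open>0\<close> the map \<open>\<Phi>\<^sup>*\<close> is the identity.

  The map \<open>\<Phi>\<^sup>*\<close> commutes with the action of \<open>G\<close>, so both isomorphisms restrict to invariant classes.

  For the cohomology of \<open>S(V)#G\<close> a cochain is averaged over the group in each gap between its arguments.
  The averaged cochain differs from the given one by an explicit homotopy (\<open>full_homotopy_formula\<close>).
  It is balanced over the group algebra, so it is determined by its restriction to \<open>S(V)\<close>, which is
  equivariant (\<open>extend_relative_part\<close>, \<open>relative_part_equivariant\<close>); conversely every equivariant cochain
  on \<open>S(V)\<close> extends (\<open>extend_cocycle\<close>).  As the order of \<open>G\<close> is invertible, invariant classes have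
  equivariant representatives and equivariant coboundaries have equivariant primitives.
\<close>

section \<open>Maps on cohomology classes\<close>

definition linear_complex :: "'c::complex_vector cochain_complex \<Rightarrow> bool" where
  "linear_complex K \<longleftrightarrow> (\<forall>p. complex_vector.subspace (cochains K p) \<and>
    (\<forall>x\<in>cochains K p. \<forall>y\<in>cochains K p. codiff K p (x + y) = codiff K p x + codiff K p y) \<and>
    (\<forall>a. \<forall>x\<in>cochains K p. codiff K p (a *\<^sub>C x) = a *\<^sub>C codiff K p x))"

lemma linear_complexD:
  assumes "linear_complex K"
  shows "complex_vector.subspace (cochains K p)"
    and "x \<in> cochains K p \<Longrightarrow> y \<in> cochains K p \<Longrightarrow> codiff K p (x + y) = codiff K p x + codiff K p y"
    and "x \<in> cochains K p \<Longrightarrow> codiff K p (a *\<^sub>C x) = a *\<^sub>C codiff K p x"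
  using assms unfolding linear_complex_def by blast+

lemma linear_complex_codiff_zero:
  assumes "linear_complex K"
  shows "codiff K p 0 = 0"
  using linear_complexD(3)[OF assms, where x = 0 and p = p and a = 0] linear_complexD(1)[OF assms, of p]
  by (simp add: complex_vector.subspace_0)

lemma subspace_cocycles:
  assumes "linear_complex K"
  shows "complex_vector.subspace (cocycles K p)"
  using linear_complexD(2,3)[OF assms, where p = p] linear_complexD(1)[OF assms, of p]
    linear_complex_codiff_zero[OF assms]
  by (auto simp: complex_vector.subspace_def cocycles_def)

lemma subspace_coboundaries:
  assumes "linear_complex K"
  shows "complex_vector.subspace (coboundaries K p)"
proof (cases p)
  case 0
  then show ?thesis by (simp add: coboundaries_def)
next
  case (Suc q)
  have sub: "complex_vector.subspace (cochains K q)"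
    by (rule linear_complexD(1)[OF assms])
  show ?thesis
  proof (rule complex_vector.subspaceI)
    show "0 \<in> coboundaries K p"
      using linear_complex_codiff_zero[OF assms, of q] complex_vector.subspace_0[OF sub]
      by (auto simp: coboundaries_def Suc image_iff intro!: bexI[of _ 0])
  next
    fix x y assume "x \<in> coboundaries K p" "y \<in> coboundaries K p"
    then obtain u v where "u \<in> cochains K q" "v \<in> cochains K q"
      "x = codiff K q u" "y = codiff K q v"
      by (auto simp: coboundaries_def Suc)
    then have "x + y = codiff K q (u + v)" "u + v \<in> cochains K q"
      using linear_complexD(2)[OF assms] complex_vector.subspace_add[OF sub] by auto
    then show "x + y \<in> coboundaries K p"
      by (auto simp: coboundaries_def Suc)
  next
    fix c x assume "x \<in> coboundaries K p"
    then obtain u where "u \<in> cochains K q" "x = codiff K q u"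
      by (auto simp: coboundaries_def Suc)
    then have "c *\<^sub>C x = codiff K q (c *\<^sub>C u)" "c *\<^sub>C u \<in> cochains K q"
      using linear_complexD(3)[OF assms] complex_vector.subspace_scale[OF sub] by auto
    then show "c *\<^sub>C x \<in> coboundaries K p"
      by (auto simp: coboundaries_def Suc)
  qed
qed

definition coh_class :: "'c::complex_vector cochain_complex \<Rightarrow> nat \<Rightarrow> 'c \<Rightarrow> 'c set" where
  "coh_class K p x = cohomologous K p `` {x}"

lemma mem_coh_class:
  "y \<in> coh_class K p x \<longleftrightarrow> x \<in> cocycles K p \<and> y \<in> cocycles K p \<and> x - y \<in> coboundaries K p"
  by (auto simp: coh_class_def cohomologous_def)

lemma cohomology_iff: "X \<in> cohomology K p \<longleftrightarrow> (\<exists>x\<in>cocycles K p. X = coh_class K p x)"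
  by (auto simp: cohomology_def quotient_def coh_class_def)

lemma coh_class_eq_iff:
  assumes "linear_complex K" "x \<in> cocycles K p" "y \<in> cocycles K p"
  shows "coh_class K p x = coh_class K p y \<longleftrightarrow> x - y \<in> coboundaries K p"
proof
  note sub = subspace_coboundaries[OF assms(1), of p]
  show "x - y \<in> coboundaries K p" if eq: "coh_class K p x = coh_class K p y"
  proof -
    have "y \<in> coh_class K p y"
      using assms by (simp add: mem_coh_class complex_vector.subspace_0[OF sub])
    with eq have "y \<in> coh_class K p x" by simp
    then show ?thesis by (simp add: mem_coh_class)
  qed
  assume xy: "x - y \<in> coboundaries K p"
  show "coh_class K p x = coh_class K p y"
  proof (rule Set.set_eqI)
    fix z
    have "x - z \<in> coboundaries K p \<longleftrightarrow> y - z \<in> coboundaries K p"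
    proof
      assume "x - z \<in> coboundaries K p"
      from complex_vector.subspace_diff[OF sub this xy] show "y - z \<in> coboundaries K p" by simp
    next
      assume "y - z \<in> coboundaries K p"
      from complex_vector.subspace_add[OF sub this xy] show "x - z \<in> coboundaries K p" by simp
    qed
    then show "z \<in> coh_class K p x \<longleftrightarrow> z \<in> coh_class K p y"
      using assms by (simp add: mem_coh_class)
  qed
qed

definition coh_hom :: "'c::complex_vector cochain_complex \<Rightarrow> 'd::complex_vector cochain_complex \<Rightarrow>
    nat \<Rightarrow> ('c \<Rightarrow> 'd) \<Rightarrow> bool" where
  "coh_hom K L p F \<longleftrightarrow>
    (\<forall>x\<in>cocycles K p. F x \<in> cocycles L p) \<and>
    (\<forall>x\<in>cocycles K p. \<forall>y\<in>cocycles K p. F (x + y) = F x + F y) \<and>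
    (\<forall>a. \<forall>x\<in>cocycles K p. F (a *\<^sub>C x) = a *\<^sub>C F x) \<and>
    (\<forall>x\<in>cocycles K p. x \<in> coboundaries K p \<longrightarrow> F x \<in> coboundaries L p)"

lemma coh_hom_cocycle: "coh_hom K L p F \<Longrightarrow> x \<in> cocycles K p \<Longrightarrow> F x \<in> cocycles L p"
  by (simp add: coh_hom_def)

lemma coh_hom_diff:
  assumes "linear_complex K" "coh_hom K L p F" "x \<in> cocycles K p" "y \<in> cocycles K p"
  shows "F (x - y) = F x - F y"
proof -
  have "x - y \<in> cocycles K p"
    using assms complex_vector.subspace_diff[OF subspace_cocycles[OF assms(1)]] by blast
  then have "F (x - y + y) = F (x - y) + F y"
    using assms unfolding coh_hom_def by blast
  then show ?thesis by simp
qed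

lemma coh_class_coh_hom:
  assumes "linear_complex K" "linear_complex L" "coh_hom K L p F"
    "x \<in> cocycles K p" "y \<in> cocycles K p" "x - y \<in> coboundaries K p"
  shows "coh_class L p (F x) = coh_class L p (F y)"
proof -
  have "x - y \<in> cocycles K p"
    using assms complex_vector.subspace_diff[OF subspace_cocycles[OF assms(1)]] by blast
  then have "F (x - y) \<in> coboundaries L p"
    using assms unfolding coh_hom_def by blast
  then show ?thesis
    using assms coh_hom_cocycle[OF assms(3)] by (simp add: coh_class_eq_iff coh_hom_diff[OF assms(1,3)])
qed

lemma coh_map_class:
  assumes "linear_complex K" "linear_complex L" "coh_hom K L p F" "x \<in> cocycles K p"
  shows "coh_map L p F (coh_class K p x) = coh_class L p (F x)"
proof -
  have "x \<in> coh_class K p x"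
    using assms by (simp add: mem_coh_class complex_vector.subspace_0[OF subspace_coboundaries])
  moreover have "coh_class L p (F y) = coh_class L p (F x)" if "y \<in> coh_class K p x" for y
    using coh_class_coh_hom[OF assms(1,2,3), of x y] that by (auto simp: mem_coh_class)
  ultimately show ?thesis
    unfolding coh_map_def coh_class_def[symmetric] by blast
qed

lemma coh_scale_class:
  assumes "linear_complex K" "x \<in> cocycles K p"
  shows "coh_scale K p a (coh_class K p x) = coh_class K p (a *\<^sub>C x)"
proof -
  have "coh_hom K K p ((*\<^sub>C) a)"
    using complex_vector.subspace_scale[OF subspace_cocycles[OF assms(1)], of _ p a]
      complex_vector.subspace_scale[OF subspace_coboundaries[OF assms(1)], of _ p a]
    by (simp add: coh_hom_def scaleC_add_right scaleC_scaleC mult.commute)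
  from coh_map_class[OF assms(1,1) this assms(2)] show ?thesis
    by (simp add: coh_map_def coh_scale_def)
qed

lemma coh_add_class:
  assumes "linear_complex K" "x \<in> cocycles K p" "y \<in> cocycles K p"
  shows "coh_add K p (coh_class K p x) (coh_class K p y) = coh_class K p (x + y)"
proof -
  note subZ = subspace_cocycles[OF assms(1), of p] and subB = subspace_coboundaries[OF assms(1), of p]
  have refl: "x \<in> coh_class K p x" "y \<in> coh_class K p y"
    using assms by (simp_all add: mem_coh_class complex_vector.subspace_0[OF subB])
  have "coh_class K p (x' + y') = coh_class K p (x + y)"
    if "x' \<in> coh_class K p x" "y' \<in> coh_class K p y" for x' y'
  proof -
    have "(x - x') + (y - y') \<in> coboundaries K p"
      using that by (auto simp: mem_coh_class intro: complex_vector.subspace_add[OF subB])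
    then have "(x + y) - (x' + y') \<in> coboundaries K p" by (simp add: algebra_simps)
    then show ?thesis
      using that assms by (subst eq_commute, subst coh_class_eq_iff)
        (auto simp: mem_coh_class intro: complex_vector.subspace_add[OF subZ])
  qed
  with refl show ?thesis
    unfolding coh_add_def coh_class_def[symmetric] by blast
qed

text \<open>A bijection of classes that comes from a cochain-level homomorphism is automatically linear.\<close>

lemma coh_isoI:
  assumes "linear_complex K" "linear_complex L" "coh_hom K L p F"
    "A \<subseteq> cohomology K p" "bij_betw (coh_map L p F) A B"
  shows "coh_iso K L p A B (coh_map L p F)"
  unfolding coh_iso_def
proof (intro conjI ballI allI)
  show "bij_betw (coh_map L p F) A B" by fact
next
  fix X Y assume "X \<in> A" "Y \<in> A"
  then obtain x y where xy: "x \<in> cocycles K p" "y \<in> cocycles K p"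
      "X = coh_class K p x" "Y = coh_class K p y"
    using assms(4) by (metis cohomology_iff subsetD)
  have "x + y \<in> cocycles K p"
    using xy complex_vector.subspace_add[OF subspace_cocycles[OF assms(1)]] by blast
  moreover have "F (x + y) = F x + F y"
    using xy assms(3) unfolding coh_hom_def by blast
  ultimately show "coh_map L p F (coh_add K p X Y) = coh_add L p (coh_map L p F X) (coh_map L p F Y)"
    using xy assms coh_hom_cocycle[OF assms(3)] by (simp add: coh_add_class coh_map_class)
next
  fix a X assume "X \<in> A"
  then obtain x where x: "x \<in> cocycles K p" "X = coh_class K p x"
    using assms(4) by (auto simp: cohomology_iff subset_iff)
  have "a *\<^sub>C x \<in> cocycles K p"
    using x complex_vector.subspace_scale[OF subspace_cocycles[OF assms(1)]] by blast
  moreover have "F (a *\<^sub>C x) = a *\<^sub>C F x"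
    using x assms(3) unfolding coh_hom_def by blast
  ultimately show "coh_map L p F (coh_scale K p a X) = coh_scale L p a (coh_map L p F X)"
    using x assms coh_hom_cocycle[OF assms(3)] by (simp add: coh_scale_class coh_map_class)
qed

lemma inverse_coh_isosI:
  assumes K: "linear_complex K" and L: "linear_complex L"
    and F: "coh_hom K L p F" and F': "coh_hom L K p F'"
    and F'F: "\<And>x. x \<in> cocycles K p \<Longrightarrow> F' (F x) - x \<in> coboundaries K p"
    and FF': "\<And>y. y \<in> cocycles L p \<Longrightarrow> F (F' y) - y \<in> coboundaries L p"
    and A: "A \<subseteq> cohomology K p" and B: "B \<subseteq> cohomology L p"
    and AB: "\<And>X. X \<in> A \<Longrightarrow> coh_map L p F X \<in> B" and BA: "\<And>Y. Y \<in> B \<Longrightarrow> coh_map K p F' Y \<in> A"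
  shows "inverse_coh_isos K L p A B (coh_map L p F) (coh_map K p F')"
proof -
  have 1: "coh_map K p F' (coh_map L p F X) = X" if "X \<in> A" for X
  proof -
    from that A obtain x where x: "x \<in> cocycles K p" "X = coh_class K p x"
      by (auto simp: cohomology_iff subset_iff)
    then show ?thesis
      using F'F[of x] coh_hom_cocycle[OF F] coh_hom_cocycle[OF F']
      by (simp add: coh_map_class[OF K L F] coh_map_class[OF L K F'] coh_class_eq_iff[OF K])
  qed
  have 2: "coh_map L p F (coh_map K p F' Y) = Y" if "Y \<in> B" for Y
  proof -
    from that B obtain y where y: "y \<in> cocycles L p" "Y = coh_class L p y"
      by (auto simp: cohomology_iff subset_iff)
    then show ?thesis
      using FF'[of y] coh_hom_cocycle[OF F] coh_hom_cocycle[OF F']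
      by (simp add: coh_map_class[OF K L F] coh_map_class[OF L K F'] coh_class_eq_iff[OF L])
  qed
  have "bij_betw (coh_map L p F) A B"
    by (rule bij_betw_byWitness[where f' = "coh_map K p F'"]) (use 1 2 AB BA in auto)
  moreover have "bij_betw (coh_map K p F') B A"
    by (rule bij_betw_byWitness[where f' = "coh_map L p F"]) (use 1 2 AB BA in auto)
  ultimately show ?thesis
    unfolding inverse_coh_isos_def
    using coh_isoI[OF K L F A] coh_isoI[OF L K F' B] 1 2 by blast
qed

lemma coh_invariants_iff:
  assumes "linear_complex K" "\<And>h. h \<in> carrier G \<Longrightarrow> coh_hom K K p (act h)" "x \<in> cocycles K p"
  shows "coh_class K p x \<in> coh_invariants G act K p \<longleftrightarrow>
    (\<forall>h\<in>carrier G. act h x - x \<in> coboundaries K p)"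
  using assms coh_hom_cocycle[OF assms(2)]
  by (auto simp: coh_invariants_def coh_map_class coh_class_eq_iff)
    (auto simp: cohomology_iff)

section \<open>Recursive forms of the differentials\<close>

text \<open>
  Up to sign, the bar differential without its leftmost term.  This part treats the first
  argument as a spectator, so that it recurses along the list; the leftmost term of the
  differential is then the only one that uses the left action.
\<close>

fun bdry :: "('a \<Rightarrow> 'a \<Rightarrow> 'a) \<Rightarrow> ('m::complex_vector \<Rightarrow> 'a \<Rightarrow> 'm) \<Rightarrow> ('a list \<Rightarrow> 'm) \<Rightarrow> 'a list \<Rightarrow> 'm" where
  "bdry mul ra f [] = 0"
| "bdry mul ra f [x] = ra (f []) x"
| "bdry mul ra f (x # y # zs) = f (mul x y # zs) - bdry mul ra (\<lambda>l. f (x # l)) (y # zs)"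

lemma bdry_eq_sum:
  assumes "length xs = Suc p"
  shows "bdry mul ra f xs =
    (\<Sum>i<p. ((-1) ^ i) *\<^sub>C f (take i xs @ mul (xs ! i) (xs ! Suc i) # drop (Suc (Suc i)) xs))
    + ((-1) ^ p) *\<^sub>C ra (f (butlast xs)) (last xs)"
  using assms
proof (induction p arbitrary: f xs)
  case 0
  then obtain x where "xs = [x]" by (auto simp: length_Suc_conv)
  then show ?case by (simp add: scaleC_one)
next
  case (Suc p)
  then obtain x y zs where xs: "xs = x # y # zs" "length zs = p"
    by (auto simp: length_Suc_conv)
  have "bdry mul ra f xs = f (mul x y # zs) - bdry mul ra (\<lambda>l. f (x # l)) (y # zs)"
    by (simp add: xs)
  also have "bdry mul ra (\<lambda>l. f (x # l)) (y # zs) =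
     (\<Sum>i<p. ((-1) ^ i) *\<^sub>C f (x # take i (y # zs) @ mul ((y # zs) ! i) ((y # zs) ! Suc i) # drop (Suc (Suc i)) (y # zs)))
    + ((-1) ^ p) *\<^sub>C ra (f (x # butlast (y # zs))) (last (y # zs))"
    by (rule Suc.IH) (simp add: xs)
  also have "f (mul x y # zs) - \<dots> = (\<Sum>i<Suc p. ((-1) ^ i) *\<^sub>C f (take i xs @ mul (xs ! i) (xs ! Suc i) # drop (Suc (Suc i)) xs))
    + ((-1) ^ Suc p) *\<^sub>C ra (f (butlast xs)) (last xs)"
    unfolding sum.lessThan_Suc_shift
    by (simp add: xs scaleC_one sum_negf)
  finally show ?case .
qed

definition bar_d :: "('a \<Rightarrow> 'a \<Rightarrow> 'a) \<Rightarrow> ('a \<Rightarrow> 'm \<Rightarrow> 'm) \<Rightarrow> ('m::complex_vector \<Rightarrow> 'a \<Rightarrow> 'm) \<Rightarrow>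
    ('a list \<Rightarrow> 'm) \<Rightarrow> 'a list \<Rightarrow> 'm" where
  "bar_d mul la ra f xs = la (hd xs) (f (tl xs)) - bdry mul ra f xs"

lemma codiff_bar:
  "codiff (bar_complex A mul M la ra) p f xs =
    (if length xs = Suc p \<and> set xs \<subseteq> A then bar_d mul la ra f xs else 0)"
  by (simp add: bar_complex_def bar_d_def bdry_eq_sum sum_negf)

text \<open>
  The alternating sum over all ways to remove one entry of a list, which is the shape of the Koszul
  differential.  It is written so that it recurses along the list just as \<^const>\<open>bdry\<close> does.
\<close>

fun altsum :: "('v \<Rightarrow> 'v list \<Rightarrow> 'm::ab_group_add) \<Rightarrow> 'v list \<Rightarrow> 'm" where
  "altsum h [] = 0"
| "altsum h (w # ws) = h w ws - altsum (\<lambda>x l. h x (w # l)) ws"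

lemma altsum_eq_sum:
  fixes h :: "'v \<Rightarrow> 'v list \<Rightarrow> 'm::complex_vector"
  shows "altsum h ws = (\<Sum>i<length ws. ((-1) ^ i) *\<^sub>C h (ws ! i) (take i ws @ drop (Suc i) ws))"
proof (induction ws arbitrary: h)
  case (Cons w ws)
  show ?case
    unfolding length_Cons sum.lessThan_Suc_shift
    by (simp add: Cons.IH scaleC_one sum_negf)
qed simp

lemma codiff_koszul:
  "codiff (koszul_complex M la ra) p f ws =
    (if length ws = Suc p then
      altsum (\<lambda>w l. la (sym_incl w) (f l) - ra (f l) (sym_incl w)) ws else 0)"
  by (simp add: koszul_complex_def altsum_eq_sum Let_def)

lemma altsum_cong:
  assumes "\<And>x l. Suc (length l) = length ws \<Longrightarrow> insert x (set l) \<subseteq> set ws \<Longrightarrow> h x l = h' x l"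
  shows "altsum h ws = altsum h' ws"
  using assms
proof (induction ws arbitrary: h h')
  case (Cons w ws)
  have "altsum (\<lambda>x l. h x (w # l)) ws = altsum (\<lambda>x l. h' x (w # l)) ws"
    by (rule Cons.IH) (rule Cons.prems, auto)
  then show ?case using Cons.prems[of ws w] by auto
qed simp

lemma altsum_additive:
  assumes "T 0 = 0" "\<And>x y. T (x - y) = T x - T y"
  shows "altsum (\<lambda>x l. T (h x l)) ws = T (altsum h ws)"
  by (induction ws arbitrary: h) (simp_all add: assms)

lemma altsum_diff: "altsum (\<lambda>x l. h x l - h' x l) ws = altsum h ws - altsum h' ws"
  by (induction ws arbitrary: h h') (simp_all add: algebra_simps)

lemma altsum_add: "altsum (\<lambda>x l. h x l + h' x l) ws = altsum h ws + altsum h' ws"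
  by (induction ws arbitrary: h h') (simp_all add: algebra_simps)

lemma altsum_zero: "altsum (\<lambda>x l. 0) ws = 0"
  by (induction ws) simp_all

lemma altsum_sum: "altsum (\<lambda>x l. \<Sum>i\<in>I. h i x l) ws = (\<Sum>i\<in>I. altsum (h i) ws)"
  by (induction I rule: infinite_finite_induct) (simp_all add: altsum_zero altsum_add)

text \<open>
  Of two removals, the second one finds its entry shifted by one position in exactly one of the two
  orders, hence the sign.
\<close>

lemma altsum_altsum_swap:
  "altsum (\<lambda>x l. altsum (\<lambda>y m. H x y m) l) ws = - altsum (\<lambda>x l. altsum (\<lambda>y m. H y x m) l) ws"
proof (induction ws arbitrary: H)
  case (Cons w ws)
  show ?case
    using Cons.IH[of "\<lambda>x y m. H x y (w # m)"]
    by (simp add: altsum_diff)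
qed simp

section \<open>Antisymmetrization\<close>

definition antisymmetrize :: "nat \<Rightarrow> ('x list \<Rightarrow> 'm::complex_vector) \<Rightarrow> 'x list \<Rightarrow> 'm" where
  "antisymmetrize p f ws = (\<Sum>\<pi> | \<pi> permutes {..<p}. of_int (sign \<pi>) *\<^sub>C f (map (\<lambda>k. ws ! \<pi> k) [0..<p]))"

text \<open>Reindexing the sum over permutations by a transposition changes the sign of every summand.\<close>

lemma antisymmetrize_transpose:
  assumes "i < p" "j < p" "i \<noteq> j"
    and ws': "\<And>k. k < p \<Longrightarrow> ws' ! k = ws ! transpose i j k"
  shows "antisymmetrize p f ws' = - antisymmetrize p f ws"
proof -
  have tr: "transpose i j permutes {..<p}"
    using assms by (intro permutes_swap_id) auto
  have "antisymmetrize p f ws = (\<Sum>\<pi> | \<pi> permutes {..<p}. of_int (sign (transpose i j \<circ> \<pi>)) *\<^sub>C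
      f (map (\<lambda>k. ws ! (transpose i j \<circ> \<pi>) k) [0..<p]))"
    unfolding antisymmetrize_def by (rule setum_permutations_compose_left[OF tr])
  also have "\<dots> = (\<Sum>\<pi> | \<pi> permutes {..<p}. - (of_int (sign \<pi>) *\<^sub>C f (map (\<lambda>k. ws' ! \<pi> k) [0..<p])))"
  proof (rule sum.cong[OF refl])
    fix \<pi> assume "\<pi> \<in> {\<pi>. \<pi> permutes {..<p}}"
    then have \<pi>: "\<pi> permutes {..<p}" by simp
    have sgn: "sign (transpose i j \<circ> \<pi>) = - sign \<pi>"
      using permutes_imp_permutation[OF _ \<pi>] permutes_imp_permutation[OF _ tr] \<open>i \<noteq> j\<close>
      by (simp add: sign_compose sign_swap_id)
    have lst: "map (\<lambda>k. ws ! (transpose i j \<circ> \<pi>) k) [0..<p] = map (\<lambda>k. ws' ! \<pi> k) [0..<p]"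
      using permutes_in_image[OF \<pi>] by (intro map_cong) (auto simp: ws')
    show "of_int (sign (transpose i j \<circ> \<pi>)) *\<^sub>C
      f (map (\<lambda>k. ws ! (transpose i j \<circ> \<pi>) k) [0..<p]) = - (of_int (sign \<pi>) *\<^sub>C f (map (\<lambda>k. ws' ! \<pi> k) [0..<p]))"
      unfolding sgn lst by simp
  qed
  also have "\<dots> = - antisymmetrize p f ws'"
    by (simp add: antisymmetrize_def sum_negf)
  finally show ?thesis by simp
qed

lemma complex_vector_eq_uminus:
  fixes x :: "'m::complex_vector"
  assumes "x = - x"
  shows "x = 0"
proof -
  have "2 *\<^sub>C x = x + x"
    by (metis one_add_one scaleC_add_left scaleC_one)
  also have "\<dots> = 0" using assms by (metis add.right_inverse)
  finally show ?thesis by simp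
qed

lemma antisymmetrize_not_distinct:
  assumes "length ws = p" "\<not> distinct ws"
  shows "antisymmetrize p f ws = 0"
proof -
  obtain i j where ij: "i < p" "j < p" "i \<noteq> j" "ws ! i = ws ! j"
    using assms by (auto simp: distinct_conv_nth)
  have "antisymmetrize p f ws = - antisymmetrize p f ws"
    by (rule antisymmetrize_transpose[OF ij(1-3)]) (use ij in \<open>auto simp: transpose_def\<close>)
  then show ?thesis by (rule complex_vector_eq_uminus)
qed

lemma antisymmetrize_swap:
  assumes "p = Suc (Suc (length xs + length ys))"
  shows "antisymmetrize p f (xs @ x # y # ys) = - antisymmetrize p f (xs @ y # x # ys)"
proof (rule antisymmetrize_transpose)
  show "length xs < p" "Suc (length xs) < p" "length xs \<noteq> Suc (length xs)" using assms by auto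
  fix k assume "k < p"
  consider "k < length xs" | "k = length xs" | "k = Suc (length xs)" | "Suc (length xs) < k" by linarith
  then show "(xs @ x # y # ys) ! k = (xs @ y # x # ys) ! transpose (length xs) (Suc (length xs)) k"
    by cases (auto simp: nth_append transpose_def nth_Cons split: nat.split)
qed

lemma antisymmetrize_move_to_front:
  "antisymmetrize (Suc (length xs + length ys)) f (xs @ x # ys) =
    ((-1) ^ length xs) *\<^sub>C antisymmetrize (Suc (length xs + length ys)) f (x # xs @ ys)"
proof (induction xs arbitrary: ys rule: rev_induct)
  case (snoc z xs)
  have "antisymmetrize (Suc (length (xs @ [z]) + length ys)) f ((xs @ [z]) @ x # ys) =
    - antisymmetrize (Suc (length (xs @ [z]) + length ys)) f (xs @ x # z # ys)"
    using antisymmetrize_swap[of _ xs ys f z x] by simp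
  also have "\<dots> = ((-1) ^ length (xs @ [z])) *\<^sub>C
      antisymmetrize (Suc (length (xs @ [z]) + length ys)) f (x # (xs @ [z]) @ ys)"
    using snoc[of "z # ys"] by simp
  finally show ?case .
qed (simp add: scaleC_one)

lemma permutations_Suc_image:
  "bij_betw (map_permutation {..<p} Suc) {\<pi>. \<pi> permutes {..<p}} {\<pi>. \<pi> permutes Suc ` {..<p}}"
proof (rule bij_betw_byWitness[where f' = "map_permutation (Suc ` {..<p}) (inv_into {..<p} Suc)"])
  have bij1: "bij_betw Suc {..<p} (Suc ` {..<p})"
    by (simp add: bij_betw_def)
  note bij = bij1 bij_betw_inv_into[OF bij1]
  show "\<forall>\<pi>\<in>{\<pi>. \<pi> permutes {..<p}}.
      map_permutation (Suc ` {..<p}) (inv_into {..<p} Suc) (map_permutation {..<p} Suc \<pi>) = \<pi>"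
    using bij by (auto intro!: map_permutation_compose_inv)
  show "\<forall>\<pi>\<in>{\<pi>. \<pi> permutes Suc ` {..<p}}.
      map_permutation {..<p} Suc (map_permutation (Suc ` {..<p}) (inv_into {..<p} Suc) \<pi>) = \<pi>"
    using bij by (auto intro!: map_permutation_compose_inv)
  show "map_permutation {..<p} Suc ` {\<pi>. \<pi> permutes {..<p}} \<subseteq> {\<pi>. \<pi> permutes Suc ` {..<p}}"
    using bij by (auto intro!: map_permutation_permutes)
  show "map_permutation (Suc ` {..<p}) (inv_into {..<p} Suc) ` {\<pi>. \<pi> permutes Suc ` {..<p}}
      \<subseteq> {\<pi>. \<pi> permutes {..<p}}"
    using bij by (auto intro!: map_permutation_permutes)
qed

text \<open>
  The permutations are sorted by the image \<open>b\<close> of the first position.  The transposition of \<open>0\<close> and \<open>b\<close>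
  leaves a list in which the first entry has taken the place of the \<open>b\<close>-th one; bringing it back to the
  front costs \<open>b - 1\<close> further changes of sign.
\<close>

lemma antisymmetrize_Suc:
  assumes "length ws = Suc p"
  shows "antisymmetrize (Suc p) f ws = altsum (\<lambda>x l. antisymmetrize p (\<lambda>l'. f (x # l')) l) ws"
proof -
  let ?mp = "map_permutation {..<p} Suc"
  have dom: "{..<Suc p} = insert 0 (Suc ` {..<p})"
    by (rule lessThan_Suc_eq_insert_0)
  have "antisymmetrize (Suc p) f ws = (\<Sum>b\<in>{..<Suc p}. \<Sum>q | q permutes Suc ` {..<p}.
      of_int (sign (transpose 0 b \<circ> q)) *\<^sub>C f (map (\<lambda>k. ws ! (transpose 0 b \<circ> q) k) [0..<Suc p]))"
    unfolding antisymmetrize_def dom by (rule sum_over_permutations_insert) auto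
  also have "\<dots> = (\<Sum>b\<in>{..<Suc p}. \<Sum>\<sigma> | \<sigma> permutes {..<p}.
      of_int (sign (transpose 0 b \<circ> ?mp \<sigma>)) *\<^sub>C f (map (\<lambda>k. ws ! (transpose 0 b \<circ> ?mp \<sigma>) k) [0..<Suc p]))"
    by (intro sum.cong refl sum.reindex_bij_betw[symmetric] permutations_Suc_image)
  also have "\<dots> = (\<Sum>b\<in>{..<Suc p}. ((-1) ^ b) *\<^sub>C
      antisymmetrize p (\<lambda>l'. f (ws ! b # l')) (take b ws @ drop (Suc b) ws))"
  proof (rule sum.cong[OF refl])
    fix b assume b: "b \<in> {..<Suc p}"
    let ?e = "if b = 0 then 1 else - 1 :: int"
    let ?ws = "tl (ws[b := ws ! 0])"
    have "(\<Sum>\<sigma> | \<sigma> permutes {..<p}. of_int (sign (transpose 0 b \<circ> ?mp \<sigma>)) *\<^sub>C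
          f (map (\<lambda>k. ws ! (transpose 0 b \<circ> ?mp \<sigma>) k) [0..<Suc p]))
      = (\<Sum>\<sigma> | \<sigma> permutes {..<p}. of_int ?e *\<^sub>C of_int (sign \<sigma>) *\<^sub>C
          f (ws ! b # map (\<lambda>k. ?ws ! \<sigma> k) [0..<p]))"
    proof (rule sum.cong[OF refl])
      fix \<sigma> assume "\<sigma> \<in> {\<sigma>. \<sigma> permutes {..<p}}"
      then have \<sigma>: "\<sigma> permutes {..<p}" by simp
      have mp: "?mp \<sigma> permutes Suc ` {..<p}"
        by (intro map_permutation_permutes \<sigma>) (auto simp: bij_betw_def)
      have mp0: "?mp \<sigma> 0 = 0"
        using mp by (auto intro!: permutes_not_in)
      have mpS: "?mp \<sigma> (Suc k) = Suc (\<sigma> k)" if "k < p" for k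
        using that \<sigma> by (auto intro!: map_permutation_apply)
      have "sign (?mp \<sigma>) = sign \<sigma>"
        using sign_map_permutation[of Suc "{..<p}" \<sigma>] \<sigma> by simp
      moreover have "permutation (?mp \<sigma>)"
        using permutes_imp_permutation[OF _ mp] by simp
      ultimately have sgn: "sign (transpose 0 b \<circ> ?mp \<sigma>) = ?e * sign \<sigma>"
        by (simp add: sign_compose sign_swap_id permutation_swap_id)
      have tr: "ws ! transpose 0 b (Suc j) = ?ws ! j" if "j < p" for j
        using that b assms by (cases ws; cases b) (auto simp: transpose_def nth_list_update)
      have lst: "map (\<lambda>k. ws ! (transpose 0 b \<circ> ?mp \<sigma>) k) [0..<Suc p] = ws ! b # map (\<lambda>k. ?ws ! \<sigma> k) [0..<p]"
      proof -
        have "ws ! (transpose 0 b \<circ> ?mp \<sigma>) (Suc k) = ?ws ! \<sigma> k" if "k < p" for k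
          using permutes_in_image[OF \<sigma>, of k] that by (simp add: mpS tr)
        then have "map (\<lambda>k. ws ! (transpose 0 b \<circ> ?mp \<sigma>) (Suc k)) [0..<p] = map (\<lambda>k. ?ws ! \<sigma> k) [0..<p]"
          by (intro map_cong) auto
        then show ?thesis by (simp only: map_upt_Suc) (simp add: mp0)
      qed
      show "of_int (sign (transpose 0 b \<circ> ?mp \<sigma>)) *\<^sub>C
          f (map (\<lambda>k. ws ! (transpose 0 b \<circ> ?mp \<sigma>) k) [0..<Suc p])
        = of_int ?e *\<^sub>C of_int (sign \<sigma>) *\<^sub>C f (ws ! b # map (\<lambda>k. ?ws ! \<sigma> k) [0..<p])"
        unfolding sgn lst by (simp only: scaleC_scaleC of_int_mult)
    qed
    also have "\<dots> = of_int ?e *\<^sub>C antisymmetrize p (\<lambda>l'. f (ws ! b # l')) ?ws"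
      by (simp add: antisymmetrize_def complex_vector.scale_sum_right)
    also have "\<dots> = ((-1) ^ b) *\<^sub>C antisymmetrize p (\<lambda>l'. f (ws ! b # l')) (take b ws @ drop (Suc b) ws)"
    proof (cases b)
      case 0
      then show ?thesis using assms by (cases ws) (simp_all add: scaleC_one)
    next
      case (Suc c)
      obtain w us where ws: "ws = w # us" using assms by (cases ws) auto
      have len: "length us = p" "c < p" using assms b Suc ws by auto
      have tl: "?ws = take c us @ w # drop (Suc c) us"
        using len by (simp add: ws Suc upd_conv_take_nth_drop)
      have e: "Suc (length (take c us) + length (drop (Suc c) us)) = p" and c: "length (take c us) = c"
        using len by simp_all
      show ?thesis
        unfolding tl antisymmetrize_move_to_front[of "take c us" "drop (Suc c) us" _ w, unfolded e, unfolded c]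
        by (simp add: ws Suc)
    qed
    finally show "(\<Sum>\<sigma> | \<sigma> permutes {..<p}. of_int (sign (transpose 0 b \<circ> ?mp \<sigma>)) *\<^sub>C
          f (map (\<lambda>k. ws ! (transpose 0 b \<circ> ?mp \<sigma>) k) [0..<Suc p]))
      = ((-1) ^ b) *\<^sub>C antisymmetrize p (\<lambda>l'. f (ws ! b # l')) (take b ws @ drop (Suc b) ws)" .
  qed
  also have "\<dots> = altsum (\<lambda>x l. antisymmetrize p (\<lambda>l'. f (x # l')) l) ws"
    by (simp add: altsum_eq_sum assms)
  finally show ?thesis .
qed

lemma antisymmetrize_0: "antisymmetrize 0 f ws = f []"
  by (simp add: antisymmetrize_def scaleC_one)

lemma antisymmetrize_diff: "antisymmetrize p (\<lambda>l. f l - g l) ws = antisymmetrize p f ws - antisymmetrize p g ws"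
  by (simp add: antisymmetrize_def complex_vector.scale_right_diff_distrib sum_subtractf)

lemma antisymmetrize_scaleC: "antisymmetrize p (\<lambda>l. c *\<^sub>C f l) ws = c *\<^sub>C antisymmetrize p f ws"
  by (simp add: antisymmetrize_def complex_vector.scale_sum_right scaleC_scaleC mult.commute)

lemma antisymmetrize_add: "antisymmetrize p (\<lambda>l. f l + g l) ws = antisymmetrize p f ws + antisymmetrize p g ws"
  by (simp add: antisymmetrize_def scaleC_add_right sum.distrib)

lemma antisymmetrize_linear:
  assumes "clinear T"
  shows "antisymmetrize p (\<lambda>l. T (f l)) ws = T (antisymmetrize p f ws)"
proof -
  interpret Vector_Spaces.linear scaleC scaleC T by fact
  show ?thesis by (simp add: antisymmetrize_def sum scale)
qed

lemma antisymmetrize_cong: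
  assumes "\<And>l. length l = p \<Longrightarrow> f l = g l"
  shows "antisymmetrize p f ws = antisymmetrize p g ws"
  unfolding antisymmetrize_def by (intro sum.cong refl arg_cong2[where f = scaleC] assms) auto

text \<open>
  Antisymmetrization kills the terms of \<^const>\<open>bdry\<close> that multiply two neighbours, since
  these are symmetric in the two factors.
\<close>

lemma antisymmetrize_bdry:
  fixes f :: "'a list \<Rightarrow> 'm::complex_vector"
  assumes comm: "\<And>x y. mul x y = mul y x" and lin: "\<And>x. clinear (\<lambda>m. ra m x)"
    and "length ws = Suc p"
  shows "antisymmetrize (Suc p) (bdry mul ra f) ws = altsum (\<lambda>w l. ra (antisymmetrize p f l) w) ws"
  using assms(3)
proof (induction p arbitrary: f ws)
  case 0
  then obtain w where "ws = [w]" by (auto simp: length_Suc_conv)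
  then show ?case by (simp add: antisymmetrize_Suc antisymmetrize_0)
next
  case (Suc p)
  have "antisymmetrize (Suc (Suc p)) (bdry mul ra f) ws =
      altsum (\<lambda>x l. altsum (\<lambda>y m. antisymmetrize p (\<lambda>l'. bdry mul ra f (x # y # l')) m) l) ws"
    unfolding antisymmetrize_Suc[OF Suc.prems]
    by (rule altsum_cong) (simp add: antisymmetrize_Suc Suc.prems)
  also have "\<dots> = altsum (\<lambda>x l. altsum (\<lambda>y m. antisymmetrize p (\<lambda>l'. f (mul x y # l')) m) l) ws -
      altsum (\<lambda>x l. altsum (\<lambda>y m. antisymmetrize p (\<lambda>l'. bdry mul ra (\<lambda>k. f (x # k)) (y # l')) m) l) ws"
    by (simp add: antisymmetrize_diff altsum_diff)
  also have "altsum (\<lambda>x l. altsum (\<lambda>y m. antisymmetrize p (\<lambda>l'. f (mul x y # l')) m) l) ws = 0"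
  proof (rule complex_vector_eq_uminus)
    have "altsum (\<lambda>x l. altsum (\<lambda>y m. antisymmetrize p (\<lambda>l'. f (mul x y # l')) m) l) ws =
        - altsum (\<lambda>x l. altsum (\<lambda>y m. antisymmetrize p (\<lambda>l'. f (mul y x # l')) m) l) ws"
      by (rule altsum_altsum_swap)
    then show "altsum (\<lambda>x l. altsum (\<lambda>y m. antisymmetrize p (\<lambda>l'. f (mul x y # l')) m) l) ws =
        - altsum (\<lambda>x l. altsum (\<lambda>y m. antisymmetrize p (\<lambda>l'. f (mul x y # l')) m) l) ws"
      by (simp only: comm)
  qed
  also have "altsum (\<lambda>x l. altsum (\<lambda>y m. antisymmetrize p (\<lambda>l'. bdry mul ra (\<lambda>k. f (x # k)) (y # l')) m) l) ws
      = altsum (\<lambda>x l. altsum (\<lambda>y m. ra (antisymmetrize p (\<lambda>k. f (x # k)) m) y) l) ws"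
  proof (rule altsum_cong)
    fix x and l :: "'a list" assume "Suc (length l) = length ws"
    then have l: "length l = Suc p" using Suc.prems by simp
    show "altsum (\<lambda>y m. antisymmetrize p (\<lambda>l'. bdry mul ra (\<lambda>k. f (x # k)) (y # l')) m) l =
        altsum (\<lambda>y m. ra (antisymmetrize p (\<lambda>k. f (x # k)) m) y) l"
      using Suc.IH[OF l, of "\<lambda>k. f (x # k)"] by (simp add: antisymmetrize_Suc[OF l])
  qed
  also have "0 - \<dots> = altsum (\<lambda>w l. altsum (\<lambda>x m. ra (antisymmetrize p (\<lambda>k. f (x # k)) m) w) l) ws"
    by (subst altsum_altsum_swap) simp
  also have "\<dots> = altsum (\<lambda>w l. ra (antisymmetrize (Suc p) f l) w) ws"
  proof (rule altsum_cong)
    fix w and l :: "'a list" assume "Suc (length l) = length ws"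
    then have l: "length l = Suc p" using Suc.prems by simp
    interpret Vector_Spaces.linear scaleC scaleC "\<lambda>m. ra m w" by (rule lin)
    show "altsum (\<lambda>x m. ra (antisymmetrize p (\<lambda>k. f (x # k)) m) w) l = ra (antisymmetrize (Suc p) f l) w"
      unfolding antisymmetrize_Suc[OF l] by (rule altsum_additive) (simp_all add: zero diff)
  qed
  finally show ?case .
qed

section \<open>Multilinear cochains and the antisymmetrization map\<close>

lemma multilinear_maps_0:
  "f \<in> multilinear_maps A M 0 \<longleftrightarrow> f [] \<in> M \<and> (\<forall>xs. xs \<noteq> [] \<longrightarrow> f xs = 0)"
  by (auto simp: multilinear_maps_def)

text \<open>The form in which multilinearity enters the inductions on the degree of a cochain.\<close>

lemma multilinear_maps_Suc:
  "f \<in> multilinear_maps A M (Suc p) \<longleftrightarrow>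
    f [] = 0 \<and> (\<forall>x. x \<notin> A \<longrightarrow> (\<forall>l. f (x # l) = 0)) \<and>
    (\<forall>x\<in>A. (\<lambda>l. f (x # l)) \<in> multilinear_maps A M p) \<and>
    (\<forall>x\<in>A. \<forall>y\<in>A. \<forall>l. f ((x + y) # l) = f (x # l) + f (y # l)) \<and>
    (\<forall>a. \<forall>x\<in>A. \<forall>l. f ((a *\<^sub>C x) # l) = a *\<^sub>C f (x # l))" (is "?L \<longleftrightarrow> ?R")
  if sub: "complex_vector.subspace A"
proof
  assume f: ?L
  have in_M: "f xs \<in> M" if "length xs = Suc p" "set xs \<subseteq> A" for xs
    using f that by (auto simp: multilinear_maps_def)
  have out: "f xs = 0" if "\<not> (length xs = Suc p \<and> set xs \<subseteq> A)" for xs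
    using f that unfolding multilinear_maps_def mem_Collect_eq by blast
  have slot_add: "f (xs @ (x + y) # ys) = f (xs @ x # ys) + f (xs @ y # ys)"
    if "length xs + Suc (length ys) = Suc p" "set xs \<subseteq> A" "set ys \<subseteq> A" "x \<in> A" "y \<in> A" for xs ys x y
    using f that unfolding multilinear_maps_def mem_Collect_eq by blast
  have slot_scale: "f (xs @ (a *\<^sub>C x) # ys) = a *\<^sub>C f (xs @ x # ys)"
    if "length xs + Suc (length ys) = Suc p" "set xs \<subseteq> A" "set ys \<subseteq> A" "x \<in> A" for xs ys x a
    using f that unfolding multilinear_maps_def mem_Collect_eq by blast
  have "(\<lambda>l. f (x # l)) \<in> multilinear_maps A M p" if "x \<in> A" for x
    using that slot_add[of "x # _"] slot_scale[of "x # _"]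
    by (auto simp: multilinear_maps_def intro!: in_M out)
  moreover have "f ((x + y) # l) = f (x # l) + f (y # l)" if "x \<in> A" "y \<in> A" for x y l
    using slot_add[of "[]" l x y] out[of "x # l"] out[of "y # l"] out[of "(x + y) # l"] that
    by (cases "length l = p \<and> set l \<subseteq> A") auto
  moreover have "f ((a *\<^sub>C x) # l) = a *\<^sub>C f (x # l)" if "x \<in> A" for x a l
    using slot_scale[of "[]" l x a] out[of "x # l"] out[of "(a *\<^sub>C x) # l"] that
    by (cases "length l = p \<and> set l \<subseteq> A") auto
  ultimately show ?R
    using out[of "[]"] by (auto intro!: out)
next
  assume R: ?R
  have tail: "(\<lambda>l. f (x # l)) \<in> multilinear_maps A M p" if "x \<in> A" for x
    using R that by blast
  show ?L
    unfolding multilinear_maps_def mem_Collect_eq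
  proof (intro conjI allI impI)
    fix xs assume "length xs = Suc p \<and> set xs \<subseteq> A"
    then show "f xs \<in> M"
      using tail by (cases xs) (auto simp: multilinear_maps_def)
  next
    fix xs assume *: "\<not> (length xs = Suc p \<and> set xs \<subseteq> A)"
    then show "f xs = 0"
    proof (cases xs)
      case (Cons x l)
      then show ?thesis
        using R * tail[of x] by (cases "x \<in> A") (auto simp: multilinear_maps_def)
    qed (use R in auto)
  next
    fix xs ys assume *: "length xs + Suc (length ys) = Suc p \<and> set xs \<subseteq> A \<and> set ys \<subseteq> A"
    show "\<forall>x\<in>A. \<forall>y\<in>A. f (xs @ (x + y) # ys) = f (xs @ x # ys) + f (xs @ y # ys)"
    proof (cases xs)
      case (Cons x l)
      then show ?thesis using * tail[of x] by (simp add: multilinear_maps_def)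
    qed (use R in auto)
    fix a
    show "\<forall>x\<in>A. f (xs @ (a *\<^sub>C x) # ys) = a *\<^sub>C f (xs @ x # ys)"
    proof (cases xs)
      case (Cons x l)
      then show ?thesis using * tail[of x] by (simp add: multilinear_maps_def)
    qed (use R in auto)
  qed
qed

lemma multilinear_mapsD:
  assumes "f \<in> multilinear_maps A M p"
  shows "length xs = p \<Longrightarrow> set xs \<subseteq> A \<Longrightarrow> f xs \<in> M"
    and "\<not> (length xs = p \<and> set xs \<subseteq> A) \<Longrightarrow> f xs = 0"
  using assms unfolding multilinear_maps_def mem_Collect_eq by blast+

lemma multilinear_maps_Cons:
  assumes "f \<in> multilinear_maps A M (Suc p)" "complex_vector.subspace A" "x \<in> A"
  shows "(\<lambda>l. f (x # l)) \<in> multilinear_maps A M p"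
  using assms by (simp add: multilinear_maps_Suc)

lemma subspace_multilinear_maps:
  assumes "complex_vector.subspace M"
  shows "complex_vector.subspace (multilinear_maps A M p)"
proof (rule complex_vector.subspaceI)
  show "0 \<in> multilinear_maps A M p"
    using complex_vector.subspace_0[OF assms] by (auto simp: multilinear_maps_def)
  fix f g assume "f \<in> multilinear_maps A M p" "g \<in> multilinear_maps A M p"
  then show "f + g \<in> multilinear_maps A M p"
    using complex_vector.subspace_add[OF assms]
    by (auto simp: multilinear_maps_def scaleC_add_right)
next
  fix c f assume "f \<in> multilinear_maps A M p"
  then show "c *\<^sub>C f \<in> multilinear_maps A M p"
    using complex_vector.subspace_scale[OF assms]
    by (auto simp: multilinear_maps_def scaleC_add_right scaleC_fun_def scaleC_scaleC mult.commute)
qed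

lemma subspace_alternating_maps:
  assumes "complex_vector.subspace M"
  shows "complex_vector.subspace (alternating_maps M p)"
  using subspace_multilinear_maps[OF assms, of UNIV p]
  by (auto simp: alternating_maps_def complex_vector.subspace_def scaleC_fun_def)

lemma clinear_iff:
  "clinear T \<longleftrightarrow> (\<forall>x y. T (x + y) = T x + T y) \<and> (\<forall>a x. T (a *\<^sub>C x) = a *\<^sub>C T x)"
  by (auto simp: Vector_Spaces.linear_iff complex_vector.vector_space_axioms)

lemma clinearD:
  assumes "clinear T"
  shows "T (x + y) = T x + T y" "T (a *\<^sub>C x) = a *\<^sub>C T x" "T 0 = 0" "T (x - y) = T x - T y" "T (- x) = - T x"
proof -
  interpret Vector_Spaces.linear scaleC scaleC T by fact
  show "T (x + y) = T x + T y" "T (a *\<^sub>C x) = a *\<^sub>C T x" "T 0 = 0" "T (x - y) = T x - T y" "T (- x) = - T x"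
    by (rule add scale zero diff neg)+
qed

lemma clinear_sum: "clinear T \<Longrightarrow> T (sum f I) = (\<Sum>i\<in>I. T (f i))"
  by (induction I rule: infinite_finite_induct) (auto simp: clinearD)

lemma bdry_add:
  assumes "\<And>x. clinear (\<lambda>m. ra m x)"
  shows "bdry mul ra (\<lambda>l. f l + g l) xs = bdry mul ra f xs + bdry mul ra g xs"
  by (induction xs arbitrary: f g rule: induct_list012) (simp_all add: clinearD[OF assms])

lemma bdry_diff:
  assumes "\<And>x. clinear (\<lambda>m. ra m x)"
  shows "bdry mul ra (\<lambda>l. f l - g l) xs = bdry mul ra f xs - bdry mul ra g xs"
  by (induction xs arbitrary: f g rule: induct_list012) (simp_all add: clinearD[OF assms])

lemma bdry_zero:
  assumes "\<And>x. clinear (\<lambda>m. ra m x)"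
  shows "bdry mul ra (\<lambda>l. 0) xs = 0"
  using bdry_diff[OF assms, where f = "\<lambda>l. 0" and g = "\<lambda>l. 0"] by simp

lemma bdry_sum:
  assumes "\<And>x. clinear (\<lambda>m. ra m x)"
  shows "bdry mul ra (\<lambda>l. \<Sum>i\<in>I. f i l) xs = (\<Sum>i\<in>I. bdry mul ra (f i) xs)"
  by (induction I rule: infinite_finite_induct) (simp_all add: bdry_zero bdry_add assms)

text \<open>
  A change of algebra \<open>t\<close> together with a change of coefficients \<open>T\<close>.  The cases of interest are the
  inclusion of \<open>S(V)\<close> into \<open>S(V)#G\<close>, the action of a group element, and the evaluation of
  function-valued cochains at a point.
\<close>

lemma bdry_transport:
  assumes T: "T 0 = 0" "\<And>m m'. T (m - m') = T m - T m'"
    and t: "\<And>x y. x \<in> A \<Longrightarrow> y \<in> A \<Longrightarrow> mul x y \<in> A"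
      "\<And>x y. x \<in> A \<Longrightarrow> y \<in> A \<Longrightarrow> t (mul x y) = mul' (t x) (t y)"
    and xs: "set xs \<subseteq> A"
    and f: "\<And>l. set l \<subseteq> A \<Longrightarrow> T (f l) = f' (map t l)"
    and ra: "\<And>l x. set l \<subseteq> A \<Longrightarrow> x \<in> A \<Longrightarrow> T (ra (f l) x) = ra' (f' (map t l)) (t x)"
  shows "T (bdry mul ra f xs) = bdry mul' ra' f' (map t xs)"
  using xs f ra
proof (induction xs arbitrary: f f' rule: induct_list012)
  case 1
  then show ?case by (simp add: T)
next
  case (2 x)
  from "2.prems"(3)[of "[]" x] "2.prems"(1) show ?case by simp
next
  case (3 x y zs)
  have "T (bdry mul ra (\<lambda>l. f (x # l)) (y # zs)) = bdry mul' ra' (\<lambda>l. f' (t x # l)) (map t (y # zs))"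
  proof (rule "3.IH"(2))
    show "set (y # zs) \<subseteq> A" using "3.prems"(1) by simp
    show "T (f (x # l)) = f' (t x # map t l)" if "set l \<subseteq> A" for l
      using "3.prems"(2)[of "x # l"] "3.prems"(1) that by simp
    show "T (ra (f (x # l)) z) = ra' (f' (t x # map t l)) (t z)" if "set l \<subseteq> A" "z \<in> A" for l z
      using "3.prems"(3)[of "x # l" z] "3.prems"(1) that by simp
  qed
  moreover have "T (f (mul x y # zs)) = f' (mul' (t x) (t y) # map t zs)"
    using "3.prems"(2)[of "mul x y # zs"] "3.prems"(1) t by simp
  ultimately show ?case by (simp add: T)
qed

lemma bar_d_transport:
  assumes T: "T 0 = 0" "\<And>m m'. T (m - m') = T m - T m'"
    and t: "\<And>x y. x \<in> A \<Longrightarrow> y \<in> A \<Longrightarrow> mul x y \<in> A"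
      "\<And>x y. x \<in> A \<Longrightarrow> y \<in> A \<Longrightarrow> t (mul x y) = mul' (t x) (t y)"
    and xs: "set xs \<subseteq> A" "xs \<noteq> []"
    and f: "\<And>l. set l \<subseteq> A \<Longrightarrow> T (f l) = f' (map t l)"
    and ra: "\<And>l x. set l \<subseteq> A \<Longrightarrow> x \<in> A \<Longrightarrow> T (ra (f l) x) = ra' (f' (map t l)) (t x)"
    and la: "\<And>l x. set l \<subseteq> A \<Longrightarrow> x \<in> A \<Longrightarrow> T (la x (f l)) = la' (t x) (f' (map t l))"
  shows "T (bar_d mul la ra f xs) = bar_d mul' la' ra' f' (map t xs)"
proof -
  obtain x l where "xs = x # l" using xs(2) by (cases xs) auto
  then show ?thesis
    using bdry_transport[of T A mul t mul' xs f f' ra ra', OF T t xs(1) f ra] la[of l x] xs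
    by (simp add: bar_d_def T)
qed

lemma bar_d_add:
  assumes "\<And>x. clinear (la x)" "\<And>x. clinear (\<lambda>m. ra m x)"
  shows "bar_d mul la ra (\<lambda>l. f l + g l) xs = bar_d mul la ra f xs + bar_d mul la ra g xs"
  by (simp add: bar_d_def bdry_add assms clinearD[OF assms(1)])

lemma bar_d_diff:
  assumes "\<And>x. clinear (la x)" "\<And>x. clinear (\<lambda>m. ra m x)"
  shows "bar_d mul la ra (\<lambda>l. f l - g l) xs = bar_d mul la ra f xs - bar_d mul la ra g xs"
  by (simp add: bar_d_def bdry_diff assms clinearD[OF assms(1)])

lemma bdry_scale:
  assumes "\<And>x. clinear (\<lambda>m. ra m x)"
  shows "bdry mul ra (\<lambda>l. c *\<^sub>C f l) xs = c *\<^sub>C bdry mul ra f xs"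
  by (induction xs arbitrary: f rule: induct_list012)
    (simp_all add: clinearD[OF assms] complex_vector.scale_right_diff_distrib)

lemma bar_d_scale:
  assumes "\<And>x. clinear (la x)" "\<And>x. clinear (\<lambda>m. ra m x)"
  shows "bar_d mul la ra (\<lambda>l. c *\<^sub>C f l) xs = c *\<^sub>C bar_d mul la ra f xs"
  by (simp add: bar_d_def bdry_scale assms clinearD[OF assms(1)] complex_vector.scale_right_diff_distrib)

lemma linear_complex_bar:
  fixes M :: "'m::complex_vector set" and A :: "'a::complex_vector set"
  assumes "complex_vector.subspace M" "\<And>x. clinear (la x)" "\<And>x. clinear (\<lambda>m. ra m x)"
  shows "linear_complex (bar_complex A mul M la ra)"
  unfolding linear_complex_def
proof (intro allI conjI ballI)
  fix p
  show "complex_vector.subspace (cochains (bar_complex A mul M la ra) p)"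
    by (simp add: bar_complex_def subspace_multilinear_maps assms)
  fix f g :: "'a list \<Rightarrow> 'm" and c
  show "codiff (bar_complex A mul M la ra) p (f + g) =
      codiff (bar_complex A mul M la ra) p f + codiff (bar_complex A mul M la ra) p g"
    by (rule ext) (simp add: codiff_bar bar_d_add assms plus_fun_def)
  show "codiff (bar_complex A mul M la ra) p (c *\<^sub>C f) = c *\<^sub>C codiff (bar_complex A mul M la ra) p f"
    by (rule ext) (simp add: codiff_bar bar_d_scale assms scaleC_fun_def)
qed

lemma altsum_scale:
  fixes h :: "'v \<Rightarrow> 'v list \<Rightarrow> 'm::complex_vector"
  shows "altsum (\<lambda>x l. c *\<^sub>C h x l) ws = c *\<^sub>C altsum h ws"
  by (rule altsum_additive) (simp_all add: complex_vector.scale_right_diff_distrib)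

lemma linear_complex_koszul:
  fixes M :: "'m::complex_vector set" and la :: "'v::complex_vector sym \<Rightarrow> 'm \<Rightarrow> 'm"
  assumes "complex_vector.subspace M" "\<And>x. clinear (la x)" "\<And>x. clinear (\<lambda>m. ra m x)"
  shows "linear_complex (koszul_complex M la ra)"
  unfolding linear_complex_def
proof (intro allI conjI ballI)
  fix p
  show "complex_vector.subspace (cochains (koszul_complex M la ra) p)"
    by (simp add: koszul_complex_def subspace_alternating_maps assms)
  fix f g :: "'v list \<Rightarrow> 'm" and c
  show "codiff (koszul_complex M la ra) p (f + g) =
      codiff (koszul_complex M la ra) p f + codiff (koszul_complex M la ra) p g"
    by (rule ext) (simp add: codiff_koszul altsum_add[symmetric] clinearD[OF assms(2)] clinearD[OF assms(3)]
      add_diff_add)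
  show "codiff (koszul_complex M la ra) p (c *\<^sub>C f) = c *\<^sub>C codiff (koszul_complex M la ra) p f"
    by (rule ext) (simp add: codiff_koszul scaleC_fun_def clinearD[OF assms(2)] clinearD[OF assms(3)]
      complex_vector.scale_right_diff_distrib[symmetric] altsum_scale)
qed

lemma sym_incl_add: "sym_incl (v + w) = sym_incl v + sym_incl w"
proof (transfer)
  fix v w :: 'a
  show "Poly_Mapping.single {#v + w#} 1 - (Poly_Mapping.single {#v#} 1 + Poly_Mapping.single {#w#} 1)
      \<in> (sym_ideal :: ('a multiset \<Rightarrow>\<^sub>0 complex) set)"
    using sym_ideal.gen_add[of v w] by (simp add: algebra_simps)
qed

lemma sym_incl_scale: "sym_incl (c *\<^sub>C v) = c *\<^sub>C sym_incl v"
  by transfer (simp add: mult_single sym_ideal.gen_scale)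

lemma phi_star_eq:
  "phi_star p f ws = (if length ws = p then antisymmetrize p f (map sym_incl ws) else 0)"
proof -
  have "f (map (\<lambda>k. sym_incl (ws ! \<pi> k)) [0..<p]) = f (map (\<lambda>k. map sym_incl ws ! \<pi> k) [0..<p])"
    if "\<pi> permutes {..<p}" "length ws = p" for \<pi>
    using permutes_in_image[OF that(1)] that(2) by (intro arg_cong[where f = f] map_cong) auto
  then show ?thesis unfolding phi_star_def antisymmetrize_def by (auto intro!: sum.cong)
qed

lemma altsum_map: "altsum h (map t ws) = altsum (\<lambda>x l. h (t x) (map t l)) ws"
  by (induction ws arbitrary: h) simp_all

text \<open>
  A permuted list depends on a given entry of the original list in exactly one place; this is why
  antisymmetrization preserves multilinearity.
\<close>

lemma permuted_slot:
  assumes "\<pi> permutes {..<p}" "length xs + Suc (length ys) = p"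
  obtains us vs where "length us + Suc (length vs) = p"
    "\<And>z. map (\<lambda>k. (xs @ z # ys) ! \<pi> k) [0..<p] = us @ z # vs"
proof -
  have "length xs \<in> \<pi> ` {..<p}"
    using assms by (simp add: permutes_image)
  then obtain i where i: "i < p" "\<pi> i = length xs" by auto
  have ne: "\<pi> k \<noteq> length xs" if "k \<noteq> i" for k
    using permutes_inj[OF assms(1)] that i by (metis injD)
  have split: "[0..<p] = [0..<i] @ i # [Suc i..<p]"
    using i(1) by (metis le_add1 less_imp_le_nat upt_add_eq_append upt_conv_Cons le_add_diff_inverse zero_le)
  have nth: "(xs @ z # ys) ! \<pi> k = (xs @ undefined # ys) ! \<pi> k" if "k \<noteq> i" for z k
    using ne[OF that] by (auto simp: nth_append nth_Cons')
  show ?thesis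
  proof (rule that)
    show "length (map (\<lambda>k. (xs @ undefined # ys) ! \<pi> k) [0..<i]) +
        Suc (length (map (\<lambda>k. (xs @ undefined # ys) ! \<pi> k) [Suc i..<p])) = p"
      using i(1) by simp
    show "map (\<lambda>k. (xs @ z # ys) ! \<pi> k) [0..<p] =
      map (\<lambda>k. (xs @ undefined # ys) ! \<pi> k) [0..<i] @ z # map (\<lambda>k. (xs @ undefined # ys) ! \<pi> k) [Suc i..<p]" for z
      unfolding split using i(2) nth[of _ z] by simp
  qed
qed

lemma phi_star_alternating:
  assumes sub: "complex_vector.subspace M" and f: "f \<in> multilinear_maps UNIV M p"
  shows "phi_star p f \<in> alternating_maps M p"
proof -
  have slot: "f (us @ (x + y) # vs) = f (us @ x # vs) + f (us @ y # vs)"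
      "f (us @ (a *\<^sub>C x) # vs) = a *\<^sub>C f (us @ x # vs)" if "length us + Suc (length vs) = p" for us vs x y a
    using f that unfolding multilinear_maps_def by blast+
  have perm_slot: "f (map (\<lambda>k. (us @ (x + y) # vs) ! \<pi> k) [0..<p]) =
        f (map (\<lambda>k. (us @ x # vs) ! \<pi> k) [0..<p]) + f (map (\<lambda>k. (us @ y # vs) ! \<pi> k) [0..<p])"
      "f (map (\<lambda>k. (us @ (a *\<^sub>C x) # vs) ! \<pi> k) [0..<p]) = a *\<^sub>C f (map (\<lambda>k. (us @ x # vs) ! \<pi> k) [0..<p])"
    if \<pi>_mem: "\<pi> \<in> {\<pi>. \<pi> permutes {..<p}}" and len: "length us + Suc (length vs) = p" for us vs x y a \<pi>
  proof -
    from \<pi>_mem have \<pi>: "\<pi> permutes {..<p}" by simp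
    obtain us' vs' where us': "length us' + Suc (length vs') = p"
      and eq: "\<And>z. map (\<lambda>k. (us @ z # vs) ! \<pi> k) [0..<p] = us' @ z # vs'"
      using permuted_slot[OF \<pi> len] by blast
    show "f (map (\<lambda>k. (us @ (x + y) # vs) ! \<pi> k) [0..<p]) =
        f (map (\<lambda>k. (us @ x # vs) ! \<pi> k) [0..<p]) + f (map (\<lambda>k. (us @ y # vs) ! \<pi> k) [0..<p])"
      "f (map (\<lambda>k. (us @ (a *\<^sub>C x) # vs) ! \<pi> k) [0..<p]) = a *\<^sub>C f (map (\<lambda>k. (us @ x # vs) ! \<pi> k) [0..<p])"
      unfolding eq by (rule slot[OF us'])+
  qed
  have add: "antisymmetrize p f (us @ (x + y) # vs) = antisymmetrize p f (us @ x # vs) + antisymmetrize p f (us @ y # vs)"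
    and scale: "antisymmetrize p f (us @ (a *\<^sub>C x) # vs) = a *\<^sub>C antisymmetrize p f (us @ x # vs)"
    if "length us + Suc (length vs) = p" for us vs x y a
    unfolding antisymmetrize_def
    by (simp_all only: perm_slot[OF _ that] scaleC_add_right sum.distrib complex_vector.scale_sum_right
        scaleC_scaleC mult.commute[of _ a] cong: sum.cong)
  have "phi_star p f ws \<in> M" for ws
    using f complex_vector.subspace_0[OF sub]
    by (auto simp: phi_star_eq antisymmetrize_def multilinear_maps_def
        intro!: complex_vector.subspace_sum[OF sub] complex_vector.subspace_scale[OF sub])
  moreover have "phi_star p f ws = 0" if "\<not> distinct ws" for ws
    using that by (auto simp: phi_star_eq distinct_map intro!: antisymmetrize_not_distinct)
  moreover have "phi_star p f (us @ (x + y) # vs) = phi_star p f (us @ x # vs) + phi_star p f (us @ y # vs)"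
      "phi_star p f (us @ (a *\<^sub>C x) # vs) = a *\<^sub>C phi_star p f (us @ x # vs)"
    if "length us + Suc (length vs) = p" for us vs x y a
    using that add[of "map sym_incl us" "map sym_incl vs"] scale[of "map sym_incl us" "map sym_incl vs"]
    by (simp_all add: phi_star_eq sym_incl_add sym_incl_scale)
  moreover have "phi_star p f ws = 0" if "length ws \<noteq> p" for ws
    using that by (simp add: phi_star_eq)
  ultimately show ?thesis
    by (simp add: alternating_maps_def multilinear_maps_def)
qed

text \<open>
  Antisymmetrization keeps only the two outer terms of the bar differential, and these become the left
  and the right action in the Koszul differential.
\<close>

lemma codiff_phi_star:
  assumes la: "\<And>x. clinear (la x)" and ra: "\<And>x. clinear (\<lambda>m. ra m x)"
  shows "codiff (koszul_complex M la ra) p (phi_star p f) =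
    phi_star (Suc p) (codiff (bar_complex UNIV (*) M la ra) p f)"
proof
  fix ws
  show "codiff (koszul_complex M la ra) p (phi_star p f) ws =
    phi_star (Suc p) (codiff (bar_complex UNIV (*) M la ra) p f) ws"
  proof (cases "length ws = Suc p")
    case True
    let ?W = "map sym_incl ws"
    have W: "length ?W = Suc p" using True by simp
    have "antisymmetrize (Suc p) (codiff (bar_complex UNIV (*) M la ra) p f) ?W =
        antisymmetrize (Suc p) (\<lambda>l. la (hd l) (f (tl l)) - bdry (*) ra f l) ?W"
      by (rule antisymmetrize_cong) (simp add: codiff_bar bar_d_def)
    also have "\<dots> = antisymmetrize (Suc p) (\<lambda>l. la (hd l) (f (tl l))) ?W -
        altsum (\<lambda>w l. ra (antisymmetrize p f l) w) ?W"
      unfolding antisymmetrize_diff by (subst antisymmetrize_bdry) (simp_all add: mult.commute ra True)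
    also have "antisymmetrize (Suc p) (\<lambda>l. la (hd l) (f (tl l))) ?W =
        altsum (\<lambda>x l. la x (antisymmetrize p f l)) ?W"
      unfolding antisymmetrize_Suc[OF W] list.sel antisymmetrize_linear[OF la] ..
    also have "altsum (\<lambda>x l. la x (antisymmetrize p f l)) ?W - altsum (\<lambda>w l. ra (antisymmetrize p f l) w) ?W
       = altsum (\<lambda>w l. la (sym_incl w) (phi_star p f l) - ra (phi_star p f l) (sym_incl w)) ws"
      unfolding altsum_diff[symmetric] altsum_map
      by (rule altsum_cong) (simp add: phi_star_eq True)
    finally show ?thesis
      by (simp add: codiff_koszul phi_star_eq[of "Suc p"] True)
  qed (simp add: codiff_koszul phi_star_eq)
qed

lemma phi_star_add: "phi_star p (f + g) = phi_star p f + phi_star p g"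
  by (rule ext) (simp add: phi_star_eq plus_fun_def antisymmetrize_add)

lemma phi_star_diff: "phi_star p (f - g) = phi_star p f - phi_star p g"
  by (rule ext) (simp add: phi_star_eq fun_diff_def antisymmetrize_diff)

lemma phi_star_scale: "phi_star p (c *\<^sub>C f) = c *\<^sub>C phi_star p f"
  by (rule ext) (simp add: phi_star_eq scaleC_fun_def antisymmetrize_scaleC)

lemma phi_star_0: "phi_star p 0 = 0"
  by (rule ext) (simp add: phi_star_eq antisymmetrize_def)

lemma phi_star_coboundaries:
  assumes M: "complex_vector.subspace M" and la: "\<And>x. clinear (la x)" and ra: "\<And>x. clinear (\<lambda>m. ra m x)"
    and x: "x \<in> coboundaries (bar_complex UNIV (*) M la ra) p"
  shows "phi_star p x \<in> coboundaries (koszul_complex M la ra) p"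
proof -
  have coch: "cochains (bar_complex UNIV (*) M la ra) q = multilinear_maps UNIV M q"
     "cochains (koszul_complex M la ra) q = alternating_maps M q" for q
    by (simp_all add: bar_complex_def koszul_complex_def)
  show ?thesis
    using x phi_star_alternating[OF M]
    by (cases p) (auto simp: coboundaries_def phi_star_0 coch codiff_phi_star[OF la ra, symmetric] intro!: imageI)
qed

lemma coh_hom_phi_star:
  assumes M: "complex_vector.subspace M" and la: "\<And>x. clinear (la x)" and ra: "\<And>x. clinear (\<lambda>m. ra m x)"
  shows "coh_hom (bar_complex UNIV (*) M la ra) (koszul_complex M la ra) p (phi_star p)"
  using phi_star_alternating[OF M] phi_star_coboundaries[OF M la ra]
  by (auto simp: coh_hom_def cocycles_def codiff_phi_star[OF la ra] phi_star_0 phi_star_add phi_star_scale)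
    (simp add: bar_complex_def koszul_complex_def)

section \<open>Coordinates and alternating maps\<close>

definition ordered_basis :: "'v::complex_vector list \<Rightarrow> bool" where
  "ordered_basis bs \<longleftrightarrow> distinct bs \<and> \<not> complex_vector.dependent (set bs) \<and> complex_vector.span (set bs) = UNIV"

lemma coord_nth:
  assumes "ordered_basis bs" "i < length bs" "j < length bs"
  shows "coord bs i (bs ! j) = (if i = j then 1 else 0)"
  using assms unfolding coord_def ordered_basis_def
  by (auto simp: complex_vector.representation_basis nth_eq_iff_index_eq)

lemma coord_linear:
  assumes "ordered_basis bs"
  shows "coord bs i (v + w) = coord bs i v + coord bs i w" "coord bs i (c *\<^sub>C v) = c * coord bs i v"
  using assms unfolding coord_def ordered_basis_def
  by (simp_all add: complex_vector.representation_add complex_vector.representation_scale)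

lemma linear_coord: "ordered_basis bs \<Longrightarrow> Vector_Spaces.linear scaleC (*) (coord bs i)"
  unfolding Vector_Spaces.linear_iff
  by (auto simp: coord_linear complex_vector.vector_space_axioms vector_space_def algebra_simps)

lemma sum_coord:
  assumes "ordered_basis bs"
  shows "(\<Sum>j<length bs. coord bs j v *\<^sub>C bs ! j) = v"
proof -
  have bij: "bij_betw ((!) bs) {..<length bs} (set bs)"
    using assms by (auto simp: ordered_basis_def intro!: bij_betw_nth)
  have "(\<Sum>j<length bs. coord bs j v *\<^sub>C bs ! j) =
      (\<Sum>b\<in>set bs. complex_vector.representation (set bs) v b *\<^sub>C b)"
    unfolding coord_def by (rule sum.reindex_bij_betw[OF bij])
  also have "\<dots> = v"
    using assms by (intro complex_vector.sum_representation_eq) (auto simp: ordered_basis_def)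
  finally show ?thesis .
qed

lemma alternating_maps_Cons:
  assumes "\<alpha> \<in> alternating_maps M (Suc p)"
  shows "(\<lambda>l. \<alpha> (x # l)) \<in> alternating_maps M p"
  using assms by (auto simp: alternating_maps_def multilinear_maps_Suc)

lemma alternating_maps_head:
  assumes "\<alpha> \<in> alternating_maps M (Suc p)"
  shows "\<alpha> ((x + y) # l) = \<alpha> (x # l) + \<alpha> (y # l)" "\<alpha> ((a *\<^sub>C x) # l) = a *\<^sub>C \<alpha> (x # l)"
  using assms by (auto simp: alternating_maps_def multilinear_maps_Suc)

lemma alternating_maps_swap:
  assumes "\<alpha> \<in> alternating_maps M (Suc (Suc p))"
  shows "\<alpha> (x # y # l) = - \<alpha> (y # x # l)"
proof -
  have "\<alpha> ((x + y) # (x + y) # l) = \<alpha> (x # x # l) + \<alpha> (x # y # l) + (\<alpha> (y # x # l) + \<alpha> (y # y # l))"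
    using alternating_maps_head[OF assms] alternating_maps_head[OF alternating_maps_Cons[OF assms]] by simp
  moreover have "\<alpha> (z # z # l) = 0" for z
    using assms by (simp add: alternating_maps_def)
  ultimately show ?thesis by (simp add: eq_neg_iff_add_eq_0)
qed

text \<open>
  Terms that contain \<open>v\<close> twice vanish, and a single \<open>v\<close> is moved to the front: the expansion of an
  alternating map along one coordinate \<open>c\<close>.
\<close>

lemma alternating_maps_expand:
  fixes ws :: "'w list" and Q :: "'w \<Rightarrow> 'v::complex_vector"
  assumes "\<alpha> \<in> alternating_maps M p" "length ws = p"
  shows "\<alpha> (map (\<lambda>w. Q w + c w *\<^sub>C v) ws) =
    \<alpha> (map Q ws) + altsum (\<lambda>w l. c w *\<^sub>C \<alpha> (v # map Q l)) ws"
  using assms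
proof (induction ws arbitrary: \<alpha> p)
  case (Cons w ws)
  then obtain q where p: "p = Suc q" and len: "length ws = q" by auto
  let ?R = "\<lambda>w. Q w + c w *\<^sub>C v"
  have \<alpha>: "\<alpha> \<in> alternating_maps M (Suc q)" using Cons.prems p by simp
  have "\<alpha> (v # map ?R ws) = \<alpha> (v # map Q ws) + altsum (\<lambda>w l. c w *\<^sub>C \<alpha> (v # v # map Q l)) ws"
    by (rule Cons.IH[OF alternating_maps_Cons[OF \<alpha>] len])
  also have "(\<lambda>w l. c w *\<^sub>C \<alpha> (v # v # map Q l)) = (\<lambda>w l. 0)"
    using \<alpha> by (simp add: alternating_maps_def fun_eq_iff)
  finally have 1: "\<alpha> (v # map ?R ws) = \<alpha> (v # map Q ws)" by (simp add: altsum_zero)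
  have "\<alpha> (Q w # map ?R ws) = \<alpha> (Q w # map Q ws) + altsum (\<lambda>x l. c x *\<^sub>C \<alpha> (Q w # v # map Q l)) ws"
    by (rule Cons.IH[OF alternating_maps_Cons[OF \<alpha>] len])
  also have "altsum (\<lambda>x l. c x *\<^sub>C \<alpha> (Q w # v # map Q l)) ws = altsum (\<lambda>x l. - (c x *\<^sub>C \<alpha> (v # Q w # map Q l))) ws"
  proof (rule altsum_cong)
    fix x and l :: "'w list" assume "Suc (length l) = length ws"
    then have "\<alpha> \<in> alternating_maps M (Suc (Suc (length l)))" using \<alpha> len by simp
    from alternating_maps_swap[OF this, of "Q w" v "map Q l"]
    show "c x *\<^sub>C \<alpha> (Q w # v # map Q l) = - (c x *\<^sub>C \<alpha> (v # Q w # map Q l))" by simp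
  qed
  also have "\<dots> = - altsum (\<lambda>x l. c x *\<^sub>C \<alpha> (v # Q w # map Q l)) ws"
    by (rule altsum_additive) simp_all
  finally have 2: "\<alpha> (Q w # map ?R ws) = \<alpha> (Q w # map Q ws) - altsum (\<lambda>x l. c x *\<^sub>C \<alpha> (v # Q w # map Q l)) ws"
    by simp
  show ?case
    by (simp add: alternating_maps_head[OF \<alpha>] 1 2)
qed simp

section \<open>The cochain map of a system of twisted difference operators\<close>

lemma sum_fun: "sum F J = (\<lambda>l. \<Sum>j\<in>J. F j l)"
  by (induction J rule: infinite_finite_induct) (auto simp: fun_eq_iff)

text \<open>
  A commutative ring acts on the coefficients.  The maps \<open>A\<^sub>j\<close> interpolate between the left action
  \<open>A\<^sub>0\<close> of \<open>S(V)\<close> and its right action \<open>A\<^sub>n\<close> by changing one variable at a time, and \<open>E\<^sub>j\<close> is the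
  difference quotient of the step from \<open>A\<^sub>j\<close> to \<open>A\<^bsub>j+1\<^esub>\<close>, with denominator \<open>u\<^sub>j\<close>.  There are two
  instances: the quantum derivatives, acting on a component \<open>S(V)g\<close> of \<open>S(V)#G\<close>, and formal
  difference quotients, acting on coinduced bimodules.
\<close>

locale twisted_differences =
  fixes bs :: "'v::complex_vector list"
    and act :: "'r::comm_ring_1 \<Rightarrow> 'n::complex_vector \<Rightarrow> 'n"
    and A E :: "nat \<Rightarrow> 'v sym \<Rightarrow> 'r"
    and u :: "nat \<Rightarrow> 'r"
  assumes basis: "ordered_basis bs"
    and act_add_left: "act (r + s) x = act r x + act s x"
    and act_mult: "act (r * s) x = act r (act s x)"
    and act_linear: "clinear (act r)"
    and leibniz: "j < length bs \<Longrightarrow> E j (f * h) = A j f * E j h + E j f * A (Suc j) h"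
    and telescope: "j < length bs \<Longrightarrow> A j f - A (Suc j) f = E j f * u j"
    and E_add: "j < length bs \<Longrightarrow> E j (f + h) = E j f + E j h"
    and E_scale: "j < length bs \<Longrightarrow> act (E j (c *\<^sub>C f)) x = c *\<^sub>C act (E j f) x"
    and E_incl: "j < length bs \<Longrightarrow> act (E j (sym_incl v)) x = coord bs j v *\<^sub>C x"
begin

abbreviation "n \<equiv> length bs"

lemmas act_simps = clinearD[OF act_linear]

lemma act_diff_left: "act (r - s) x = act r x - act s x"
  using act_add_left[of "r - s" s x] by simp

lemma act_sum_left: "act (sum r I) x = (\<Sum>i\<in>I. act (r i) x)"
proof -
  have "act 0 x = 0" using act_add_left[of 0 0 x] by simp
  then show ?thesis
    by (induction I rule: infinite_finite_induct) (simp_all add: act_add_left)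
qed

lemma act_commute: "act r (act s x) = act s (act r x)"
  by (simp add: act_mult[symmetric] mult.commute)

text \<open>The map \<open>\<Upsilon>\<close>, with the sum over \<open>j\<^sub>1 < \<dots> < j\<^sub>p\<close> taken recursively; \<open>m\<close> is a lower bound for \<open>j\<^sub>1\<close>.\<close>

fun Ups :: "nat \<Rightarrow> ('v list \<Rightarrow> 'n) \<Rightarrow> 'v sym list \<Rightarrow> 'n" where
  "Ups m \<alpha> [] = \<alpha> []"
| "Ups m \<alpha> (f # fs) = (\<Sum>j=m..<n. act (E j f) (Ups (Suc j) (\<lambda>l. \<alpha> (bs ! j # l)) fs))"

lemma Ups_act: "Ups m (\<lambda>l. act r (\<alpha> l)) fs = act r (Ups m \<alpha> fs)"
  by (induction fs arbitrary: m \<alpha>) (simp_all add: clinear_sum[OF act_linear] act_commute[of r])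

lemma Ups_diff: "Ups m (\<lambda>l. \<alpha> l - \<beta> l) fs = Ups m \<alpha> fs - Ups m \<beta> fs"
  by (induction fs arbitrary: m \<alpha> \<beta>) (simp_all add: act_simps sum_subtractf)

lemma Ups_add: "Ups m (\<lambda>l. \<alpha> l + \<beta> l) fs = Ups m \<alpha> fs + Ups m \<beta> fs"
  by (induction fs arbitrary: m \<alpha> \<beta>) (simp_all add: act_simps sum.distrib)

lemma Ups_scale: "Ups m (\<lambda>l. c *\<^sub>C \<alpha> l) fs = c *\<^sub>C Ups m \<alpha> fs"
  by (induction fs arbitrary: m \<alpha>) (simp_all add: act_simps complex_vector.scale_sum_right)

lemma Ups_zero: "Ups m (\<lambda>l. 0) fs = 0"
  using Ups_diff[of m "\<lambda>l. 0" "\<lambda>l. 0" fs] by simp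

lemma Ups_cong:
  "(\<And>l. length l = length fs \<Longrightarrow> \<alpha> l = \<beta> l) \<Longrightarrow> Ups m \<alpha> fs = Ups m \<beta> fs"
proof (induction fs arbitrary: m \<alpha> \<beta>)
  case (Cons f fs)
  have "Ups (Suc j) (\<lambda>l. \<alpha> (bs ! j # l)) fs = Ups (Suc j) (\<lambda>l. \<beta> (bs ! j # l)) fs" for j
    by (rule Cons.IH) (simp add: Cons.prems)
  then show ?case by simp
qed simp

lemma telescope_range:
  "m \<le> k \<Longrightarrow> k \<le> n \<Longrightarrow> A m f - A k f = (\<Sum>j=m..<k. E j f * u j)"
proof (induction k rule: dec_induct)
  case (step k)
  then show ?case using telescope[of k f] by (simp add: algebra_simps)
qed simp

text \<open>All steps but the \<open>j\<close>-th one leave \<open>v\<^sub>j\<close> unchanged.\<close>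

lemma koszul_generator:
  assumes "j < n"
  shows "act (A 0 (sym_incl (bs ! j))) x - act (A n (sym_incl (bs ! j))) x = act (u j) x"
proof -
  have "act (A 0 (sym_incl (bs ! j))) x - act (A n (sym_incl (bs ! j))) x =
      (\<Sum>i=0..<n. act (E i (sym_incl (bs ! j))) (act (u i) x))"
    by (simp add: act_diff_left[symmetric] telescope_range act_sum_left act_mult)
  also have "\<dots> = (\<Sum>i=0..<n. if i = j then act (u j) x else 0)"
    by (rule sum.cong) (use assms in \<open>auto simp: E_incl coord_nth basis scaleC_one\<close>)
  finally show ?thesis using assms by simp
qed

abbreviation kd :: "('v list \<Rightarrow> 'n) \<Rightarrow> 'v list \<Rightarrow> 'n" where
  "kd \<alpha> \<equiv> altsum (\<lambda>w l. act (A 0 (sym_incl w)) (\<alpha> l) - act (A n (sym_incl w)) (\<alpha> l))"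

text \<open>
  For \<open>m = 0\<close> this says that \<open>\<Upsilon>\<close> is a cochain map; with \<open>A\<^sub>m\<close> in place of the left action it can be
  proved by induction on the number of arguments.  The Leibniz rule splits the term that contains the
  product \<open>f * h\<close> in two.  One half cancels against the rest of the differential, by the induction
  hypothesis; the other one leaves \<open>A\<^sub>m f - A\<^sub>j f\<close>, which telescopes into the summands of the Koszul
  differential whose removed index is smaller than \<open>j\<close>.
\<close>

lemma Ups_chain:
  assumes "m \<le> n"
  shows "act (A m f) (Ups m \<alpha> fs) - bdry (*) (\<lambda>x f. act (A n f) x) (Ups m \<alpha>) (f # fs) =
    Ups m (kd \<alpha>) (f # fs)"
  using assms
proof (induction fs arbitrary: f m \<alpha>)
  case Nil
  have "act (A m f) (\<alpha> []) - act (A n f) (\<alpha> []) = (\<Sum>j=m..<n. act (E j f) (act (u j) (\<alpha> [])))"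
    using Nil by (simp add: act_diff_left[symmetric] telescope_range act_sum_left act_mult)
  also have "\<dots> = Ups m (kd \<alpha>) [f]"
    by (auto simp: koszul_generator intro!: sum.cong)
  finally show ?case by simp
next
  case (Cons h fs)
  let ?ra = "\<lambda>x f. act (A n f) x"
  let ?U = "\<lambda>j. Ups (Suc j) (\<lambda>l. \<alpha> (bs ! j # l))"
  have ra: "clinear (\<lambda>x. act (A n f) x)" for f by (rule act_linear)
  have bdry_act: "bdry (*) ?ra (\<lambda>l. act r (F l)) xs = act r (bdry (*) ?ra F xs)" for r F xs
    by (induction xs arbitrary: F rule: induct_list012) (simp_all add: act_simps act_commute[of r])
  have IH: "bdry (*) ?ra (?U j) (h # fs) =
      act (A (Suc j) h) (?U j fs) - Ups (Suc j) (kd (\<lambda>l. \<alpha> (bs ! j # l))) (h # fs)"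
    if "j \<in> {m..<n}" for j
    using Cons.IH[of "Suc j" h "\<lambda>l. \<alpha> (bs ! j # l)"] that by (simp add: algebra_simps)
  have split: "(\<Sum>j=m..<n. act (E j f) (act (u j) (Ups (Suc j) \<alpha> (h # fs)))) =
      (\<Sum>j=m..<n. act (A m f) (act (E j h) (?U j fs)) - act (A j f) (act (E j h) (?U j fs)))"
  proof -
    have "(\<Sum>i=m..<n. act (A m f) (act (E i h) (?U i fs)) - act (A i f) (act (E i h) (?U i fs))) =
        (\<Sum>i=m..<n. \<Sum>j=m..<i. act (E j f) (act (u j) (act (E i h) (?U i fs))))"
      by (rule sum.cong) (auto simp: act_diff_left[symmetric] telescope_range act_sum_left act_mult)
    also have "\<dots> = (\<Sum>i=m..<n. \<Sum>j | j \<in> {m..<n} \<and> j < i. act (E j f) (act (u j) (act (E i h) (?U i fs))))"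
      by (intro sum.cong) auto
    also have "\<dots> = (\<Sum>j=m..<n. \<Sum>i | i \<in> {m..<n} \<and> j < i. act (E j f) (act (u j) (act (E i h) (?U i fs))))"
      by (rule sum.swap_restrict) auto
    also have "\<dots> = (\<Sum>j=m..<n. \<Sum>i=Suc j..<n. act (E j f) (act (u j) (act (E i h) (?U i fs))))"
      by (intro sum.cong) auto
    finally show ?thesis
      by (simp add: clinear_sum[OF act_linear])
  qed
  have "act (A m f) (Ups m \<alpha> (h # fs)) - bdry (*) ?ra (Ups m \<alpha>) (f # h # fs) =
     (\<Sum>j=m..<n. act (A m f) (act (E j h) (?U j fs))
        - act (E j (f * h)) (?U j fs)
        + act (E j f) (bdry (*) ?ra (?U j) (h # fs)))"
    by (simp add: clinear_sum[OF act_linear] bdry_sum[OF ra] bdry_act sum.distrib sum_subtractf)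
  also have "\<dots> = (\<Sum>j=m..<n. (act (A m f) (act (E j h) (?U j fs)) - act (A j f) (act (E j h) (?U j fs)))
        - act (E j f) (Ups (Suc j) (kd (\<lambda>l. \<alpha> (bs ! j # l))) (h # fs)))"
    by (rule sum.cong) (auto simp: IH leibniz act_add_left act_mult act_simps simp del: Ups.simps)
  also have "\<dots> = (\<Sum>j=m..<n. act (E j f) (act (u j) (Ups (Suc j) \<alpha> (h # fs)))
        - act (E j f) (Ups (Suc j) (kd (\<lambda>l. \<alpha> (bs ! j # l))) (h # fs)))"
    using split by (simp add: sum_subtractf del: Ups.simps)
  also have "\<dots> = Ups m (kd \<alpha>) (f # h # fs)"
  proof -
    have "Ups (Suc j) (\<lambda>l. kd \<alpha> (bs ! j # l)) (h # fs) =
        act (u j) (Ups (Suc j) \<alpha> (h # fs)) - Ups (Suc j) (kd (\<lambda>l. \<alpha> (bs ! j # l))) (h # fs)"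
      if "j \<in> {m..<n}" for j
      using that by (simp add: koszul_generator Ups_diff Ups_act del: Ups.simps)
    then show ?thesis
      unfolding Ups.simps(2)[of m "kd \<alpha>"] by (intro sum.cong) (simp_all add: act_simps del: Ups.simps)
  qed
  finally show ?case .
qed

lemma Ups_mem:
  assumes "complex_vector.subspace M" "\<And>r x. x \<in> M \<Longrightarrow> act r x \<in> M" "\<And>l. \<alpha> l \<in> M"
  shows "Ups m \<alpha> fs \<in> M"
  using assms(3) by (induction fs arbitrary: m \<alpha>)
    (auto intro!: complex_vector.subspace_sum[OF assms(1)] assms(2))

lemma Ups_multilinear:
  assumes M: "complex_vector.subspace M" "\<And>r x. x \<in> M \<Longrightarrow> act r x \<in> M"
    and \<alpha>: "\<alpha> \<in> multilinear_maps UNIV M p"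
  shows "Ups m \<alpha> \<in> multilinear_maps UNIV M p"
  using \<alpha>
proof (induction p arbitrary: m \<alpha>)
  case 0
  have "Ups m \<alpha> fs = 0" if "fs \<noteq> []" for fs
  proof -
    have "\<alpha> l = 0" if "length l = length fs" for l
      using that \<open>fs \<noteq> []\<close> 0 by (cases l) (auto simp: multilinear_maps_0)
    then have "Ups m \<alpha> fs = Ups m (\<lambda>l. 0) fs" by (rule Ups_cong)
    then show ?thesis by (simp add: Ups_zero)
  qed
  then show ?case using 0 by (auto simp: multilinear_maps_0)
next
  case (Suc p)
  have tail: "Ups (Suc j) (\<lambda>l. \<alpha> (bs ! j # l)) \<in> multilinear_maps UNIV M p" for j
    by (rule Suc.IH) (rule multilinear_maps_Cons[OF Suc.prems], auto)
  have act_ml: "(\<lambda>l. act r (F l)) \<in> multilinear_maps UNIV M p"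
    if "F \<in> multilinear_maps UNIV M p" for r F
    using that M(2) by (auto simp: multilinear_maps_def act_simps)
  have sum_ml: "(\<lambda>l. \<Sum>j\<in>J. F j l) \<in> multilinear_maps UNIV M p"
    if "\<And>j. F j \<in> multilinear_maps UNIV M p" for F and J :: "nat set"
    using complex_vector.subspace_sum[OF subspace_multilinear_maps[OF M(1), of UNIV p], of J F] that
    by (simp add: sum_fun)
  show ?case
    using Suc.prems by (auto simp: multilinear_maps_Suc E_add E_scale act_add_left sum.distrib
        complex_vector.scale_sum_right intro!: sum_ml act_ml tail)
qed

definition tail_proj :: "nat \<Rightarrow> 'v \<Rightarrow> 'v" where
  "tail_proj m w = (\<Sum>j=m..<n. coord bs j w *\<^sub>C bs ! j)"

text \<open>
  Let \<open>P\<^sub>j\<close> be \<open>tail_proj j\<close>, which forgets the coordinates below \<open>j\<close>.  By the expansion along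
  coordinate \<open>j\<close>, the summand that belongs to \<open>j\<^sub>1 = j\<close> is the difference of \<open>\<alpha>\<close> at the \<open>P\<^sub>j\<close>-images and
  at the \<open>P\<^bsub>j+1\<^esub>\<close>-images of the vectors, so the sum telescopes.
\<close>

lemma antisymmetrize_Ups:
  assumes "\<alpha> \<in> alternating_maps M p" "length ws = p" "m \<le> n"
  shows "antisymmetrize p (Ups m \<alpha>) (map sym_incl ws) = \<alpha> (map (tail_proj m) ws)"
  using assms
proof (induction p arbitrary: \<alpha> ws m)
  case 0
  then show ?case by (simp add: antisymmetrize_0)
next
  case (Suc p)
  have len: "length (map sym_incl ws) = Suc p" using Suc.prems by simp
  have "antisymmetrize (Suc p) (Ups m \<alpha>) (map sym_incl ws) =
      altsum (\<lambda>w l. antisymmetrize p (\<lambda>l'. Ups m \<alpha> (sym_incl w # l')) (map sym_incl l)) ws"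
    unfolding antisymmetrize_Suc[OF len] altsum_map ..
  also have "\<dots> = altsum (\<lambda>w l. \<Sum>j=m..<n. coord bs j w *\<^sub>C \<alpha> (bs ! j # map (tail_proj (Suc j)) l)) ws"
  proof (rule altsum_cong)
    fix w and l :: "'v list" assume "Suc (length l) = length ws"
    then have l: "length l = p" using Suc.prems by simp
    have "antisymmetrize p (\<lambda>l'. Ups m \<alpha> (sym_incl w # l')) (map sym_incl l) =
        antisymmetrize p (\<lambda>l'. \<Sum>j=m..<n. coord bs j w *\<^sub>C Ups (Suc j) (\<lambda>l. \<alpha> (bs ! j # l)) l') (map sym_incl l)"
      by (rule antisymmetrize_cong) (auto simp: E_incl intro!: sum.cong)
    also have "\<dots> = (\<Sum>j=m..<n. coord bs j w *\<^sub>C antisymmetrize p (Ups (Suc j) (\<lambda>l. \<alpha> (bs ! j # l))) (map sym_incl l))"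
      unfolding antisymmetrize_def complex_vector.scale_sum_right
      by (subst sum.swap) (simp add: scaleC_scaleC mult.commute)
    also have "\<dots> = (\<Sum>j=m..<n. coord bs j w *\<^sub>C \<alpha> (bs ! j # map (tail_proj (Suc j)) l))"
      by (rule sum.cong) (use l in \<open>auto simp: Suc.IH[OF alternating_maps_Cons[OF Suc.prems(1)]]\<close>)
    finally show "antisymmetrize p (\<lambda>l'. Ups m \<alpha> (sym_incl w # l')) (map sym_incl l) = \<dots>" .
  qed
  also have "\<dots> = (\<Sum>j=m..<n. altsum (\<lambda>w l. coord bs j w *\<^sub>C \<alpha> (bs ! j # map (tail_proj (Suc j)) l)) ws)"
    by (rule altsum_sum)
  also have "\<dots> = (\<Sum>j=m..<n. \<alpha> (map (tail_proj j) ws) - \<alpha> (map (tail_proj (Suc j)) ws))"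
  proof (rule sum.cong[OF refl])
    fix j assume j: "j \<in> {m..<n}"
    have "tail_proj j = (\<lambda>w. tail_proj (Suc j) w + coord bs j w *\<^sub>C bs ! j)"
      using j by (auto simp: tail_proj_def fun_eq_iff sum.atLeast_Suc_lessThan add.commute)
    then show "altsum (\<lambda>w l. coord bs j w *\<^sub>C \<alpha> (bs ! j # map (tail_proj (Suc j)) l)) ws =
        \<alpha> (map (tail_proj j) ws) - \<alpha> (map (tail_proj (Suc j)) ws)"
      using alternating_maps_expand[OF Suc.prems(1,2), of "tail_proj (Suc j)" "coord bs j" "bs ! j"] by simp
  qed
  also have "\<dots> = \<alpha> (map (tail_proj m) ws) - \<alpha> (map (tail_proj n) ws)"
    using sum_Suc_diff'[OF Suc.prems(3), of "\<lambda>j. - \<alpha> (map (tail_proj j) ws)"] by simp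
  also have "\<alpha> (map (tail_proj n) ws) = 0"
  proof -
    obtain w l where "ws = w # l" using Suc.prems by (cases ws) auto
    then show ?thesis
      using alternating_maps_head(2)[OF Suc.prems(1), of 0 0 "map (tail_proj n) l"] by (simp add: tail_proj_def)
  qed
  finally show ?case by simp
qed

lemma phi_star_Ups:
  assumes "\<alpha> \<in> alternating_maps M p"
  shows "phi_star p (Ups 0 \<alpha>) = \<alpha>"
proof
  fix ws
  have "tail_proj 0 = (\<lambda>w. w)"
    using sum_coord[OF basis] by (simp add: tail_proj_def fun_eq_iff lessThan_atLeast0)
  then show "phi_star p (Ups 0 \<alpha>) ws = \<alpha> ws"
    using assms antisymmetrize_Ups[OF assms, of ws 0]
    by (auto simp: phi_star_eq alternating_maps_def multilinear_maps_def)
qed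

end

section \<open>Homomorphisms out of the symmetric algebra\<close>

definition ring_map :: "('a::comm_ring_1 \<Rightarrow> 'b::comm_ring_1) \<Rightarrow> bool" where
  "ring_map h \<longleftrightarrow> h 1 = 1 \<and> (\<forall>x y. h (x + y) = h x + h y) \<and> (\<forall>x y. h (x * y) = h x * h y)"

lemma ring_mapD:
  assumes "ring_map h"
  shows "h 1 = 1" "h (x + y) = h x + h y" "h (x * y) = h x * h y" "h 0 = 0" "h (x - y) = h x - h y"
proof -
  show 1: "h 1 = 1" "h (x * y) = h x * h y" and add: "h (x + y) = h x + h y" for x y
    using assms by (auto simp: ring_map_def)
  show "h 0 = 0" using add[of 0 0] by simp
  show "h (x - y) = h x - h y" using add[of "x - y" y] by simp
qed

lemma ring_map_sum: "ring_map h \<Longrightarrow> h (sum f I) = (\<Sum>i\<in>I. h (f i))"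
  by (induction I rule: infinite_finite_induct) (auto simp: ring_mapD)

lemma poly_single_induct [case_names single add]:
  fixes p :: "'x \<Rightarrow>\<^sub>0 'a::comm_monoid_add"
  assumes "\<And>m c. P (Poly_Mapping.single m c)" and "\<And>p q. P p \<Longrightarrow> P q \<Longrightarrow> P (p + q)"
  shows "P p"
proof -
  have "P (\<Sum>m\<in>M. Poly_Mapping.single m (c m))" if "finite M" for M and c :: "'x \<Rightarrow> 'a"
    using that
  proof (induction M)
    case empty
    show ?case using assms(1)[of _ 0] by simp
  next
    case (insert m M)
    then show ?case by (simp add: assms)
  qed
  moreover have "p = (\<Sum>m\<in>Poly_Mapping.keys p. Poly_Mapping.single m (Poly_Mapping.lookup p m))"
    by (rule poly_mapping_eqI)
      (auto simp: lookup_sum lookup_single when_def sum.delta in_keys_iff)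
  ultimately show ?thesis
    by (metis finite_keys)
qed

definition poly_eval :: "('a::comm_ring_1 \<Rightarrow> 'r::comm_ring_1) \<Rightarrow> ('x \<Rightarrow> 'r) \<Rightarrow> ('x multiset \<Rightarrow>\<^sub>0 'a) \<Rightarrow> 'r" where
  "poly_eval c \<phi> p = (\<Sum>m\<in>Poly_Mapping.keys p. c (Poly_Mapping.lookup p m) * (\<Prod>v\<in>#m. \<phi> v))"

lemma poly_eval_single: "ring_map c \<Longrightarrow> poly_eval c \<phi> (Poly_Mapping.single m a) = c a * (\<Prod>v\<in>#m. \<phi> v)"
  by (simp add: poly_eval_def ring_mapD)

lemma poly_eval_add: "ring_map c \<Longrightarrow> poly_eval c \<phi> (p + q) = poly_eval c \<phi> p + poly_eval c \<phi> q"
  unfolding poly_eval_def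
  by (rule setsum_keys_plus_distrib) (simp_all add: ring_mapD distrib_right)

lemma ring_map_poly_eval:
  assumes c: "ring_map c"
  shows "ring_map (poly_eval c \<phi>)"
proof -
  have "poly_eval c \<phi> (p * q) = poly_eval c \<phi> p * poly_eval c \<phi> q" for p q
  proof (induction p rule: poly_single_induct)
    case (single m a)
    show ?case
      by (induction q rule: poly_single_induct)
        (simp_all add: mult_single poly_eval_single c poly_eval_add distrib_left distrib_right ring_mapD[OF c] ac_simps)
  qed (simp add: distrib_right poly_eval_add c)
  moreover have "poly_eval c \<phi> 1 = 1"
    using poly_eval_single[OF c, of \<phi> "{#}" 1] ring_mapD[OF c] by simp
  ultimately show ?thesis
    by (simp add: ring_map_def poly_eval_add[OF c])
qed

definition sym_eval :: "(complex \<Rightarrow> 'r::comm_ring_1) \<Rightarrow> ('v::complex_vector \<Rightarrow> 'r) \<Rightarrow> 'v sym \<Rightarrow> 'r" where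
  "sym_eval c \<phi> f = poly_eval c \<phi> (sym_rep f)"

lemma sym_of_ops:
  "sym_of (p + q) = sym_of p + sym_of q" "sym_of (p * q) = sym_of p * sym_of q" "sym_of 1 = 1" "sym_of 0 = 0"
  "sym_of (Poly_Mapping.single {#} z * p) = z *\<^sub>C sym_of p" "sym_of (Poly_Mapping.single {#v#} 1) = sym_incl v"
  by (simp_all add: plus_sym.abs_eq times_sym.abs_eq one_sym_def zero_sym_def scaleC_sym.abs_eq sym_incl_def)

lemma sym_of_rep: "sym_of (sym_rep f) = f"
  by (rule Quotient3_abs_rep[OF Quotient3_sym])

lemma sym_of_const: "sym_of (Poly_Mapping.single {#} z) = z *\<^sub>C 1"
  using sym_of_ops(5)[of z 1] by (simp add: sym_of_ops(3))

lemma sym_scale_eq: "z *\<^sub>C f = (z *\<^sub>C 1) * (f :: 'v::complex_vector sym)"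
  by transfer (simp add: sym_ideal.zero)

lemma sym_scale_mult: "(z *\<^sub>C f) * g = z *\<^sub>C (f * g :: 'v::complex_vector sym)" "f * (z *\<^sub>C g) = z *\<^sub>C (f * g)"
  by (subst (1 2) sym_scale_eq, simp add: ac_simps)+

lemma ring_map_const: "ring_map (\<lambda>z. z *\<^sub>C (1 :: 'v::complex_vector sym))"
  by (simp add: ring_map_def scaleC_one scaleC_add_left sym_scale_mult scaleC_scaleC)

lemma sym_induct [case_names const incl add mult]:
  fixes f :: "'v::complex_vector sym"
  assumes "\<And>z. P (z *\<^sub>C 1)" "\<And>v. P (sym_incl v)" "\<And>f h. P f \<Longrightarrow> P h \<Longrightarrow> P (f + h)"
    "\<And>f h. P f \<Longrightarrow> P h \<Longrightarrow> P (f * h)"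
  shows "P f"
proof -
  have "P (sym_of (Poly_Mapping.single m c))" for m c
  proof (induction m)
    case empty
    show ?case using assms(1) by (simp add: sym_of_const)
  next
    case (add v m)
    have "Poly_Mapping.single (add_mset v m) c = Poly_Mapping.single {#v#} 1 * Poly_Mapping.single m c"
      by (simp add: mult_single)
    then show ?case using assms(2,4) add by (simp add: sym_of_ops)
  qed
  then have "P (sym_of p)" for p
    by (induction p rule: free_induct) (simp_all add: sym_of_ops assms)
  then show ?thesis by (metis sym_of_rep)
qed

lemma ring_map_sym_eqI:
  fixes h h' :: "'v::complex_vector sym \<Rightarrow> 'r::comm_ring_1"
  assumes "ring_map h" "ring_map h'" "\<And>z. h (z *\<^sub>C 1) = h' (z *\<^sub>C 1)" "\<And>v. h (sym_incl v) = h' (sym_incl v)"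
  shows "h f = h' f"
  by (induction f rule: sym_induct) (simp_all add: assms ring_mapD[OF assms(1)] ring_mapD[OF assms(2)])

context
  fixes c :: "complex \<Rightarrow> 'r::comm_ring_1" and \<phi> :: "'v::complex_vector \<Rightarrow> 'r"
  assumes c: "ring_map c" and add: "\<And>v w. \<phi> (v + w) = \<phi> v + \<phi> w" and scale: "\<And>a v. \<phi> (a *\<^sub>C v) = c a * \<phi> v"
begin

lemma poly_eval_sym_ideal: "p \<in> sym_ideal \<Longrightarrow> poly_eval c \<phi> p = 0"
proof (induction rule: sym_ideal.induct)
qed (simp_all add: ring_mapD[OF ring_map_poly_eval[OF c]] poly_eval_single c add scale ring_mapD[OF c])

lemma sym_eval_sym_of: "sym_eval c \<phi> (sym_of p) = poly_eval c \<phi> p"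
  using poly_eval_sym_ideal[OF sym_rep_sym_of[of p]]
  by (simp add: sym_eval_def ring_mapD[OF ring_map_poly_eval[OF c]])

lemma ring_map_sym_eval: "ring_map (sym_eval c \<phi>)"
proof -
  have "sym_eval c \<phi> (f + h) = sym_eval c \<phi> f + sym_eval c \<phi> h"
    "sym_eval c \<phi> (f * h) = sym_eval c \<phi> f * sym_eval c \<phi> h" for f h
  proof -
    obtain p q where "f = sym_of p" "h = sym_of q" using sym_of_rep by metis
    then show "sym_eval c \<phi> (f + h) = sym_eval c \<phi> f + sym_eval c \<phi> h"
      "sym_eval c \<phi> (f * h) = sym_eval c \<phi> f * sym_eval c \<phi> h"
      by (simp_all flip: sym_of_ops add: sym_eval_sym_of ring_mapD[OF ring_map_poly_eval[OF c]])
  qed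
  moreover have "sym_eval c \<phi> 1 = 1"
    by (simp flip: sym_of_ops add: sym_eval_sym_of ring_mapD[OF ring_map_poly_eval[OF c]])
  ultimately show ?thesis by (simp add: ring_map_def)
qed

lemma sym_eval_incl: "sym_eval c \<phi> (sym_incl v) = \<phi> v"
  by (simp flip: sym_of_ops add: sym_eval_sym_of poly_eval_single c ring_mapD[OF c])

lemma sym_eval_const: "sym_eval c \<phi> (z *\<^sub>C 1) = c z"
  by (simp flip: sym_of_const add: sym_eval_sym_of poly_eval_single c)

end

lemma ring_map_sym_map:
  assumes "clinear T"
  shows "ring_map (sym_map T)"
proof -
  have "sym_map T (f + h) = sym_map T f + sym_map T h" "sym_map T (f * h) = sym_map T f * sym_map T h" for f h
  proof -
    obtain p q where "f = sym_of p" "h = sym_of q" using sym_of_rep by metis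
    then show "sym_map T (f + h) = sym_map T f + sym_map T h" "sym_map T (f * h) = sym_map T f * sym_map T h"
      by (simp_all flip: sym_of_ops add: sym_map_sym_of[OF assms] free_map_add free_map_mult)
  qed
  moreover have "sym_map T 1 = 1"
  proof -
    have "free_map T 1 = 1" by (simp flip: single_one add: free_map_single)
    then show ?thesis by (simp flip: sym_of_ops add: sym_map_sym_of[OF assms])
  qed
  ultimately show ?thesis by (simp add: ring_map_def)
qed

lemma sym_map_incl: "clinear T \<Longrightarrow> sym_map T (sym_incl v) = sym_incl (T v)"
  by (simp flip: sym_of_ops add: sym_map_sym_of free_map_single)

lemma sym_map_scale:
  assumes "clinear T"
  shows "sym_map T (z *\<^sub>C f) = z *\<^sub>C sym_map T f"
proof -
  obtain p where "f = sym_of p" using sym_of_rep by metis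
  then show ?thesis
    by (simp flip: sym_of_ops add: sym_map_sym_of[OF assms] free_map_mult free_map_single)
qed

lemma sym_map_const: "clinear T \<Longrightarrow> sym_map T (z *\<^sub>C 1) = z *\<^sub>C 1"
  by (simp add: sym_map_scale ring_mapD[OF ring_map_sym_map])

lemma clinear_sym_map: "clinear T \<Longrightarrow> clinear (sym_map T)"
  by (simp add: clinear_iff[of "sym_map T"] sym_map_scale ring_mapD[OF ring_map_sym_map])

lemma sym_map_compose:
  assumes "clinear T" "clinear U" "clinear V" "\<And>v. T (U v) = V v"
  shows "sym_map T (sym_map U f) = sym_map V f"
  by (rule ring_map_sym_eqI[of "\<lambda>f. sym_map T (sym_map U f)"])
    (simp_all add: ring_map_def ring_mapD[OF ring_map_sym_map] assms(1-3) sym_map_const sym_map_incl assms(4))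

lemma sym_map_ident: "(\<And>v. T v = v) \<Longrightarrow> sym_map T f = f"
  by (rule ring_map_sym_eqI[of "sym_map T" "\<lambda>f. f"])
    (simp_all add: ring_map_sym_map sym_map_const sym_map_incl clinear_iff ring_map_def[of "\<lambda>f. f"])

section \<open>Division by a difference\<close>

text \<open>
  The \<open>f\<close> for which \<open>a f - a' f\<close> is divisible by \<open>u\<close> form a subalgebra that contains \<open>V\<close>.  The quotient
  is unique since \<open>u\<close> is not a zero divisor, and its rules follow by cancelling \<open>u\<close>.
\<close>

lemma difference_quotient:
  fixes a a' :: "'v::complex_vector sym \<Rightarrow> 'r::comm_ring_1" and u :: 'r
  assumes a: "ring_map a" and a': "ring_map a'" and const: "\<And>z. a (z *\<^sub>C 1) = a' (z *\<^sub>C 1)"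
    and incl: "\<And>v. a (sym_incl v) - a' (sym_incl v) = l v * u"
    and regular: "\<And>x. x * u = 0 \<Longrightarrow> x = 0"
  defines "d \<equiv> \<lambda>f. THE q. q * u = a f - a' f"
  shows "a f - a' f = d f * u" "d (f * h) = a f * d h + d f * a' h" "d (f + h) = d f + d h"
    "d (z *\<^sub>C f) = a (z *\<^sub>C 1) * d f" "d (sym_incl v) = l v"
proof -
  have uniq: "q = q'" if "q * u = x" "q' * u = x" for q q' x
    using regular[of "q - q'"] that by (simp add: algebra_simps)
  have ex: "\<exists>q. q * u = a f - a' f" for f
  proof (induction f rule: sym_induct)
    case (const z)
    show ?case by (rule exI[of _ 0]) (simp add: assms(3))
  next
    case (incl v)
    show ?case by (rule exI[of _ "l v"]) (simp add: assms(4))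
  next
    case (add f h)
    then obtain q r where "q * u = a f - a' f" "r * u = a h - a' h" by blast
    then show ?case
      by (intro exI[of _ "q + r"]) (simp add: ring_mapD[OF a] ring_mapD[OF a'] algebra_simps)
  next
    case (mult f h)
    then obtain q r where qr: "q * u = a f - a' f" "r * u = a h - a' h" by blast
    have "(a f * r + q * a' h) * u = a f * (r * u) + (q * u) * a' h" by (simp add: algebra_simps)
    also have "\<dots> = a (f * h) - a' (f * h)"
      unfolding qr by (simp add: ring_mapD[OF a] ring_mapD[OF a'] algebra_simps)
    finally show ?case by blast
  qed
  show eq: "a f - a' f = d f * u" for f
  proof -
    have "\<exists>!q. q * u = a f - a' f" using ex[of f] uniq by blast
    from theI'[OF this] show ?thesis by (simp add: d_def)
  qed
  show "d (f + h) = d f + d h"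
    by (rule uniq[OF eq[symmetric]])
      (simp add: distrib_right eq[symmetric] ring_mapD[OF a] ring_mapD[OF a'])
  show mult: "d (f * h) = a f * d h + d f * a' h" for f h
  proof (rule uniq[OF eq[symmetric]])
    have "(a f * d h + d f * a' h) * u = a f * (d h * u) + (d f * u) * a' h" by (simp add: algebra_simps)
    also have "\<dots> = a (f * h) - a' (f * h)"
      unfolding eq[symmetric] by (simp add: ring_mapD[OF a] ring_mapD[OF a'] algebra_simps)
    finally show "(a f * d h + d f * a' h) * u = a (f * h) - a' (f * h)" .
  qed
  have "d (z *\<^sub>C 1) = 0"
    by (rule uniq[OF eq[symmetric]]) (simp add: const)
  then show "d (z *\<^sub>C f) = a (z *\<^sub>C 1) * d f"
    using mult[of "z *\<^sub>C 1" f] by (simp flip: sym_scale_eq)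
  show "d (sym_incl v) = l v"
    by (rule uniq[OF eq[symmetric]]) (simp add: incl)
qed

lemma lookup_single_mult:
  fixes F :: "'x multiset \<Rightarrow>\<^sub>0 'r::comm_ring_1"
  shows "Poly_Mapping.lookup (Poly_Mapping.single k c * F) (k + m) = c * Poly_Mapping.lookup F m"
  by (induction F rule: poly_single_induct)
    (simp_all add: mult_single lookup_single when_def distrib_left lookup_add)

text \<open>
  If the product vanishes, then each coefficient of \<open>F\<close> is \<open>y\<close> times the next one in direction \<open>j\<close>, hence
  \<open>y\<^sup>k\<close> times a coefficient beyond the degree of \<open>F\<close>.
\<close>

lemma monic_linear_regular:
  fixes F :: "'x multiset \<Rightarrow>\<^sub>0 'r::comm_ring_1"
  assumes "F * (Poly_Mapping.single {#j#} 1 - Poly_Mapping.single {#} y) = 0"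
  shows "F = 0"
proof -
  have step: "Poly_Mapping.lookup F m = y * Poly_Mapping.lookup F (add_mset j m)" for m
  proof -
    have "0 = Poly_Mapping.lookup (Poly_Mapping.single {#j#} 1 * F - Poly_Mapping.single {#} y * F) (add_mset j m)"
      using assms by (simp add: algebra_simps)
    then show ?thesis
      using lookup_single_mult[of "{#j#}" 1 F m] lookup_single_mult[of "{#}" y F "add_mset j m"]
      by (simp add: lookup_minus)
  qed
  have iter: "Poly_Mapping.lookup F m = y ^ k * Poly_Mapping.lookup F (m + replicate_mset k j)" for m k
  proof (induction k)
    case (Suc k)
    then show ?case using step[of "m + replicate_mset k j"] by (simp add: ac_simps)
  qed simp
  have "Poly_Mapping.lookup F m = 0" for m
  proof -
    let ?B = "Max (insert 0 (size ` Poly_Mapping.keys F))"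
    have "m + replicate_mset (Suc ?B) j \<notin> Poly_Mapping.keys F"
    proof
      assume "m + replicate_mset (Suc ?B) j \<in> Poly_Mapping.keys F"
      then have "size (m + replicate_mset (Suc ?B) j) \<le> ?B" by (intro Max_ge insertI2 imageI) auto
      then show False by simp
    qed
    then show ?thesis using iter[of m "Suc ?B"] by (simp add: in_keys_iff)
  qed
  then show ?thesis by (intro poly_mapping_eqI) simp
qed

section \<open>Quantum partial derivatives\<close>

text \<open>
  The product \<open>s\<^sub>1 \<dots> s\<^sub>j\<close> of the first \<open>j\<close> diagonal reflections; for \<open>j\<close> the length of the basis it is
  the action of the diagonal map itself.
\<close>

definition partial_action :: "'v::complex_vector list \<Rightarrow> (nat \<Rightarrow> complex) \<Rightarrow> nat \<Rightarrow> 'v sym \<Rightarrow> 'v sym" where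
  "partial_action bs eps j = foldr (\<lambda>i. sym_map (diag_refl bs eps i)) [0..<j]"

context
  fixes bs :: "'v::complex_vector list"
  assumes basis: "ordered_basis bs"
begin

lemma incl_coord: "sym_incl v = (\<Sum>i<length bs. coord bs i v *\<^sub>C sym_incl (bs ! i))"
proof -
  have "sym_incl (\<Sum>i\<in>I. coord bs i v *\<^sub>C bs ! i) = (\<Sum>i\<in>I. coord bs i v *\<^sub>C sym_incl (bs ! i))" for I
  proof (induction I rule: infinite_finite_induct)
  qed (use sym_incl_scale[of 0 0] in \<open>simp_all add: sym_incl_add sym_incl_scale\<close>)
  from this[of "{..<length bs}"] show ?thesis unfolding sum_coord[OF basis] .
qed

text \<open>
  Coordinates map \<open>S(V)\<close> to a polynomial ring, in which a variable is not a zero divisor; substituting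
  the basis vectors for the variables inverts this map.
\<close>

lemma basis_vector_regular:
  assumes "j < length bs" "x * sym_incl (bs ! j) = 0"
  shows "x = 0"
proof -
  let ?c = "Poly_Mapping.single {#} :: complex \<Rightarrow> nat multiset \<Rightarrow>\<^sub>0 complex"
  let ?\<phi> = "\<lambda>v. \<Sum>i<length bs. Poly_Mapping.single {#i#} (coord bs i v)"
  have c: "ring_map ?c"
    by (simp add: ring_map_def single_add mult_single)
  have \<phi>: "?\<phi> (v + w) = ?\<phi> v + ?\<phi> w" "?\<phi> (a *\<^sub>C v) = ?c a * ?\<phi> v" for v w a
    by (simp_all add: coord_linear[OF basis] single_add sum.distrib mult_single sum_distrib_left)
  let ?to = "sym_eval ?c ?\<phi>"
  let ?from = "poly_eval (\<lambda>z. z *\<^sub>C (1 :: 'v sym)) (\<lambda>i. sym_incl (bs ! i))"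
  have to: "ring_map ?to" by (rule ring_map_sym_eval[OF c \<phi>])
  have ev: "ring_map ?from" by (rule ring_map_poly_eval[OF ring_map_const])
  have inv: "?from (?to f) = f" for f
  proof (rule ring_map_sym_eqI[of "\<lambda>f. ?from (?to f)" "\<lambda>f. f"])
    show "ring_map (\<lambda>f. ?from (?to f))"
      using to ev by (simp add: ring_map_def)
    show "?from (?to (sym_incl v)) = sym_incl v" for v
      unfolding sym_eval_incl[OF c \<phi>] incl_coord[of v, symmetric]
      by (simp add: ring_map_sum[OF ev] poly_eval_single[OF ring_map_const] sym_scale_mult flip: incl_coord)
  qed (simp_all add: ring_map_def sym_eval_const[OF c \<phi>] poly_eval_single[OF ring_map_const])
  have "?\<phi> (bs ! j) = Poly_Mapping.single {#j#} 1"
  proof -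
    have "?\<phi> (bs ! j) = (\<Sum>i<length bs. if i = j then Poly_Mapping.single {#j#} 1 else 0)"
      by (rule sum.cong) (use assms(1) in \<open>auto simp: coord_nth[OF basis]\<close>)
    then show ?thesis using assms(1) by simp
  qed
  then have "?to x * Poly_Mapping.single {#j#} 1 = 0"
    using assms(2) ring_mapD(3)[OF to, of x "sym_incl (bs ! j)"] ring_mapD(4)[OF to]
    by (simp add: sym_eval_incl[OF c \<phi>])
  then have "?to x = 0"
    using monic_linear_regular[of "?to x" j 0] by simp
  then show ?thesis using inv[of x] by (simp add: ring_mapD[OF ev])
qed

lemma diag_refl_nth: "k < length bs \<Longrightarrow> diag_refl bs eps i (bs ! k) = (if k = i then eps i *\<^sub>C (bs ! k) else bs ! k)"
proof -
  assume k: "k < length bs"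
  have "diag_refl bs eps i (bs ! k) =
      (\<Sum>j<length bs. if j = k then (if j = i then eps i *\<^sub>C (bs ! j) else bs ! j) else 0)"
    unfolding diag_refl_def by (rule sum.cong) (use k in \<open>auto simp: coord_nth[OF basis] scaleC_one\<close>)
  then show ?thesis using k by simp
qed

lemma clinear_diag_refl: "clinear (diag_refl bs eps i)"
  by (simp add: clinear_iff diag_refl_def coord_linear[OF basis] scaleC_add_left sum.distrib
      complex_vector.scale_sum_right scaleC_scaleC)

lemma diag_refl_diff: "i < length bs \<Longrightarrow> v - diag_refl bs eps i v = coord bs i v *\<^sub>C (1 - eps i) *\<^sub>C bs ! i"
proof -
  assume i: "i < length bs"
  have "v - diag_refl bs eps i v = (\<Sum>j<length bs. if j = i then coord bs i v *\<^sub>C (1 - eps i) *\<^sub>C bs ! i else 0)"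
    unfolding diag_refl_def
    by (subst (1) sum_coord[OF basis, of v, symmetric], subst sum_subtractf[symmetric], rule sum.cong)
      (auto simp: complex_vector.scale_left_diff_distrib complex_vector.scale_right_diff_distrib scaleC_one)
  then show ?thesis using i by simp
qed

lemma diag_refl_trivial: "i < length bs \<Longrightarrow> eps i = 1 \<Longrightarrow> diag_refl bs eps i v = v"
  using diag_refl_diff[of i v eps] by simp

lemma sym_incl_diff: "sym_incl (v - w) = sym_incl v - sym_incl w"
  using sym_incl_add[of "v - w" w] by simp

lemma sym_deriv_rules:
  fixes f h :: "'v sym"
  assumes "Vector_Spaces.linear scaleC (*) l"
  shows "sym_deriv l (f + h) = sym_deriv l f + sym_deriv l h"
    "sym_deriv l (f * h) = f * sym_deriv l h + sym_deriv l f * h"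
    "sym_deriv l (z *\<^sub>C f) = z *\<^sub>C sym_deriv l f"
    "sym_deriv l (sym_incl v) = l v *\<^sub>C 1"
proof -
  obtain p q where "f = sym_of p" "h = sym_of q" using sym_of_rep by metis
  moreover have "free_deriv l (Poly_Mapping.single {#} z) = 0" by (simp add: free_deriv_single)
  ultimately show "sym_deriv l (f + h) = sym_deriv l f + sym_deriv l h"
    "sym_deriv l (f * h) = f * sym_deriv l h + sym_deriv l f * h"
    "sym_deriv l (z *\<^sub>C f) = z *\<^sub>C sym_deriv l f"
    by (simp_all flip: sym_of_ops add: sym_deriv_sym_of[OF assms] free_deriv_add free_deriv_mult add.commute)
  show "sym_deriv l (sym_incl v) = l v *\<^sub>C 1"
    by (simp flip: sym_of_ops(6) add: sym_deriv_sym_of[OF assms] free_deriv_single sym_of_const)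
qed

text \<open>
  If \<open>\<epsilon>\<^sub>j = 1\<close> then both sides of the first rule vanish and the other rules are those of a derivation;
  otherwise all of them are rules for difference quotients.
\<close>

lemma quantum_deriv_rules:
  fixes eps :: "nat \<Rightarrow> complex"
  assumes j: "j < length bs"
  defines "s \<equiv> sym_map (diag_refl bs eps j)"
  shows "f - s f = quantum_deriv bs eps j f * ((1 - eps j) *\<^sub>C sym_incl (bs ! j))"
    "quantum_deriv bs eps j (f * h) = f * quantum_deriv bs eps j h + quantum_deriv bs eps j f * s h"
    "quantum_deriv bs eps j (f + h) = quantum_deriv bs eps j f + quantum_deriv bs eps j h"
    "quantum_deriv bs eps j (z *\<^sub>C f) = z *\<^sub>C quantum_deriv bs eps j f"
    "quantum_deriv bs eps j (sym_incl v) = coord bs j v *\<^sub>C 1"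
proof -
  have s: "ring_map s" unfolding s_def by (rule ring_map_sym_map[OF clinear_diag_refl])
  have "f - s f = quantum_deriv bs eps j f * ((1 - eps j) *\<^sub>C sym_incl (bs ! j)) \<and>
    quantum_deriv bs eps j (f * h) = f * quantum_deriv bs eps j h + quantum_deriv bs eps j f * s h \<and>
    quantum_deriv bs eps j (f + h) = quantum_deriv bs eps j f + quantum_deriv bs eps j h \<and>
    quantum_deriv bs eps j (z *\<^sub>C f) = z *\<^sub>C quantum_deriv bs eps j f \<and>
    quantum_deriv bs eps j (sym_incl v) = coord bs j v *\<^sub>C 1"
  proof (cases "eps j = 1")
    case True
    have "s f = f" for f
      unfolding s_def by (rule sym_map_ident) (rule diag_refl_trivial[where eps = eps, OF j True])
    then show ?thesis
      using True sym_deriv_rules[OF linear_coord[OF basis]] by (simp add: quantum_deriv_def)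
  next
    case False
    let ?u = "sym_incl (bs ! j) - s (sym_incl (bs ! j))"
    have u: "?u = (1 - eps j) *\<^sub>C sym_incl (bs ! j)"
      using diag_refl_nth[OF j, of eps j]
      by (simp add: s_def sym_map_incl[OF clinear_diag_refl] sym_incl_scale
          complex_vector.scale_left_diff_distrib scaleC_one)
    have qd: "quantum_deriv bs eps j f = (THE q. q * ?u = f - s f)" for f
      using False by (simp add: quantum_deriv_def s_def)
    have incl: "sym_incl v - s (sym_incl v) = (coord bs j v *\<^sub>C 1) * ?u" for v
      using arg_cong[OF diag_refl_diff[OF j, of v eps], of sym_incl]
      unfolding u by (simp add: s_def sym_map_incl[OF clinear_diag_refl] sym_incl_diff sym_incl_scale sym_scale_mult)
    have regular: "x = 0" if "x * ?u = 0" for x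
    proof -
      have "(1 - eps j) *\<^sub>C (x * sym_incl (bs ! j)) = 0"
        using that by (simp add: u sym_scale_mult)
      then have "x * sym_incl (bs ! j) = 0" using False by simp
      then show ?thesis by (rule basis_vector_regular[OF j])
    qed
    have id: "ring_map (\<lambda>f :: 'v sym. f)" by (simp add: ring_map_def)
    have const: "z *\<^sub>C 1 = s (z *\<^sub>C 1)" for z
      by (simp add: s_def sym_map_const[OF clinear_diag_refl])
    note dq = difference_quotient[OF id s const incl regular]
    show ?thesis
      using dq(1)[of f] dq(2)[of f h] dq(3)[of f h] dq(4)[of z f] dq(5)[of v]
      by (simp add: qd flip: u sym_scale_eq)
  qed
  then show "f - s f = quantum_deriv bs eps j f * ((1 - eps j) *\<^sub>C sym_incl (bs ! j))"
    "quantum_deriv bs eps j (f * h) = f * quantum_deriv bs eps j h + quantum_deriv bs eps j f * s h"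
    "quantum_deriv bs eps j (f + h) = quantum_deriv bs eps j f + quantum_deriv bs eps j h"
    "quantum_deriv bs eps j (z *\<^sub>C f) = z *\<^sub>C quantum_deriv bs eps j f"
    "quantum_deriv bs eps j (sym_incl v) = coord bs j v *\<^sub>C 1" by blast+
qed

lemma ring_map_partial_action: "ring_map (partial_action bs eps j)"
proof -
  have "ring_map (foldr (\<lambda>i. sym_map (diag_refl bs eps i)) is)" for "is"
    by (induction "is") (auto simp: ring_map_def ring_mapD[OF ring_map_sym_map[OF clinear_diag_refl]])
  then show ?thesis by (simp add: partial_action_def)
qed

lemma partial_action_scale: "partial_action bs eps j (z *\<^sub>C f) = z *\<^sub>C partial_action bs eps j f"
proof -
  have "foldr (\<lambda>i. sym_map (diag_refl bs eps i)) is (z *\<^sub>C f) = z *\<^sub>C foldr (\<lambda>i. sym_map (diag_refl bs eps i)) is f" for "is"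
    by (induction "is") (auto simp: sym_map_scale[OF clinear_diag_refl])
  then show ?thesis by (simp add: partial_action_def)
qed

lemma partial_action_Suc: "partial_action bs eps (Suc j) f = partial_action bs eps j (sym_map (diag_refl bs eps j) f)"
  by (simp add: partial_action_def)

lemma partial_action_nth:
  "k < length bs \<Longrightarrow> partial_action bs eps j (sym_incl (bs ! k)) = (if k < j then eps k else 1) *\<^sub>C sym_incl (bs ! k)"
proof (induction j)
  case 0
  then show ?case by (simp add: partial_action_def scaleC_one)
next
  case (Suc j)
  then show ?case
    by (auto simp: partial_action_Suc sym_map_incl[OF clinear_diag_refl] diag_refl_nth sym_incl_scale
        partial_action_scale scaleC_one)
qed

lemma partial_action_length:
  assumes "clinear T" "\<And>i. i < length bs \<Longrightarrow> T (bs ! i) = eps i *\<^sub>C bs ! i"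
  shows "partial_action bs eps (length bs) f = sym_map T f"
proof (rule ring_map_sym_eqI[OF ring_map_partial_action ring_map_sym_map[OF assms(1)]])
  show "partial_action bs eps (length bs) (z *\<^sub>C 1) = sym_map T (z *\<^sub>C 1)" for z
    by (simp add: partial_action_scale sym_map_const[OF assms(1)] ring_mapD[OF ring_map_partial_action])
  show "partial_action bs eps (length bs) (sym_incl v) = sym_map T (sym_incl v)" for v
    by (subst (1 2) incl_coord[of v])
      (simp add: ring_map_sum ring_map_partial_action ring_map_sym_map[OF assms(1)] partial_action_scale
        sym_map_scale[OF assms(1)] sym_map_incl[OF assms(1)] partial_action_nth assms(2) sym_incl_scale)
qed

lemma quantum_differences:
  "twisted_differences bs (*) (partial_action bs eps)
    (\<lambda>j f. partial_action bs eps j (quantum_deriv bs eps j f)) (\<lambda>j. (1 - eps j) *\<^sub>C sym_incl (bs ! j))"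
proof (unfold_locales)
  note pa = ring_mapD[OF ring_map_partial_action]
  fix j assume j: "j < length bs"
  note qd = quantum_deriv_rules[OF j]
  fix f h x :: "'v sym" and z v
  show "partial_action bs eps j (quantum_deriv bs eps j (f * h)) =
      partial_action bs eps j f * partial_action bs eps j (quantum_deriv bs eps j h) +
      partial_action bs eps j (quantum_deriv bs eps j f) * partial_action bs eps (Suc j) h"
    by (simp add: qd pa partial_action_Suc)
  have "partial_action bs eps j f - partial_action bs eps (Suc j) f =
      partial_action bs eps j (f - sym_map (diag_refl bs eps j) f)"
    by (simp add: partial_action_Suc pa)
  also have "\<dots> = partial_action bs eps j (quantum_deriv bs eps j f) * ((1 - eps j) *\<^sub>C sym_incl (bs ! j))"
    unfolding qd(1)[where f = f] by (simp add: pa partial_action_scale partial_action_nth j scaleC_one)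
  finally show "partial_action bs eps j f - partial_action bs eps (Suc j) f =
      partial_action bs eps j (quantum_deriv bs eps j f) * ((1 - eps j) *\<^sub>C sym_incl (bs ! j))" .
  show "partial_action bs eps j (quantum_deriv bs eps j (f + h)) =
      partial_action bs eps j (quantum_deriv bs eps j f) + partial_action bs eps j (quantum_deriv bs eps j h)"
    by (simp add: qd pa)
  show "partial_action bs eps j (quantum_deriv bs eps j (z *\<^sub>C f)) * x =
      z *\<^sub>C (partial_action bs eps j (quantum_deriv bs eps j f) * x)"
    by (simp add: qd partial_action_scale sym_scale_mult)
  show "partial_action bs eps j (quantum_deriv bs eps j (sym_incl v)) * x = coord bs j v *\<^sub>C x"
    by (simp add: qd partial_action_scale pa sym_scale_mult)
qed (simp_all add: basis distrib_right distrib_left mult.assoc clinear_iff sym_scale_mult)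

end

section \<open>Difference operators on coinduced bimodules\<close>

definition basis_monomial :: "'v::complex_vector list \<Rightarrow> nat multiset \<Rightarrow> 'v sym" where
  "basis_monomial bs m = (\<Prod>i\<in>#m. sym_incl (bs ! i))"

text \<open>
  Polynomials with coefficients in \<open>S(V)\<close> act on functions \<open>n\<close> on \<open>S(V)\<close>: a variable multiplies the
  argument of \<open>n\<close> by a basis vector and a constant multiplies the value.  On a coinduced bimodule the
  variables thus generate the left action and the constants the right action.
\<close>

definition poly_act :: "'v::complex_vector list \<Rightarrow> (nat multiset \<Rightarrow>\<^sub>0 'v sym) \<Rightarrow>
    ('v sym \<Rightarrow> 'i \<Rightarrow> 'v sym) \<Rightarrow> 'v sym \<Rightarrow> 'i \<Rightarrow> 'v sym" where
  "poly_act bs p n = (\<lambda>a l. \<Sum>m\<in>Poly_Mapping.keys p. Poly_Mapping.lookup p m * n (a * basis_monomial bs m) l)"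

lemma poly_act_single: "poly_act bs (Poly_Mapping.single m r) n a l = r * n (a * basis_monomial bs m) l"
  by (simp add: poly_act_def)

lemma poly_act_add: "poly_act bs (p + q) n = poly_act bs p n + poly_act bs q n"
  unfolding poly_act_def plus_fun_def
  by (intro ext setsum_keys_plus_distrib) (simp_all add: distrib_right)

lemma poly_act_mult: "poly_act bs (p * q) n = poly_act bs p (poly_act bs q n)"
proof (induction p rule: poly_single_induct)
  case (single m r)
  show ?case
  proof (induction q rule: poly_single_induct)
    case (single k s)
    show ?case
      by (simp add: fun_eq_iff mult_single poly_act_single basis_monomial_def ac_simps)
  next
    case (add p q)
    then show ?case
      by (simp add: distrib_left poly_act_add) (simp add: fun_eq_iff poly_act_single distrib_left)
  qed
next
  case (add p q)
  then show ?case by (simp add: distrib_right poly_act_add)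
qed

lemma clinear_poly_act: "clinear (poly_act bs p)"
  by (simp add: clinear_iff fun_eq_iff poly_act_def distrib_left sum.distrib scaleC_fun_def
      sym_scale_mult complex_vector.scale_sum_right)

lemma poly_act_mem:
  assumes N: "complex_vector.subspace N" "\<And>r w. w \<in> N \<Longrightarrow> (\<lambda>l. r * w l) \<in> N"
    and n: "clinear n" "\<And>a. n a \<in> N"
  shows "clinear (poly_act bs p n)" "poly_act bs p n a \<in> N"
proof -
  show "clinear (poly_act bs p n)"
    using n(1) by (simp add: clinear_iff poly_act_def distrib_right distrib_left sum.distrib
        sym_scale_mult complex_vector.scale_sum_right fun_eq_iff scaleC_fun_def)
  show "poly_act bs p n a \<in> N"
    using complex_vector.subspace_sum[OF N(1), of "Poly_Mapping.keys p"
        "\<lambda>m l. Poly_Mapping.lookup p m * n (a * basis_monomial bs m) l"] N(2)[OF n(2)]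
    by (simp add: poly_act_def sum_fun)
qed

context
  fixes bs :: "'v::complex_vector list" and T :: "'v \<Rightarrow> 'v"
  assumes basis: "ordered_basis bs" and T: "clinear T"
begin

abbreviation (input) "poly_const r \<equiv> Poly_Mapping.single {#} (r :: 'v sym) :: nat multiset \<Rightarrow>\<^sub>0 'v sym"

definition mixed_variable :: "nat \<Rightarrow> 'v \<Rightarrow> nat multiset \<Rightarrow>\<^sub>0 'v sym" where
  "mixed_variable j v = (\<Sum>i<length bs. poly_const (coord bs i v *\<^sub>C 1) *
      (if i < j then poly_const (sym_incl (T (bs ! i))) else Poly_Mapping.single {#i#} 1))"

text \<open>The algebra map by which the first \<open>j\<close> variables act from the right and the others from the left.\<close>

definition mixed_hom :: "nat \<Rightarrow> 'v sym \<Rightarrow> nat multiset \<Rightarrow>\<^sub>0 'v sym" where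
  "mixed_hom j = sym_eval (\<lambda>z. poly_const (z *\<^sub>C 1)) (mixed_variable j)"

definition mixed_step :: "nat \<Rightarrow> nat multiset \<Rightarrow>\<^sub>0 'v sym" where
  "mixed_step j = Poly_Mapping.single {#j#} 1 - poly_const (sym_incl (T (bs ! j)))"

definition mixed_quotient :: "nat \<Rightarrow> 'v sym \<Rightarrow> nat multiset \<Rightarrow>\<^sub>0 'v sym" where
  "mixed_quotient j f = (THE q. q * mixed_step j = mixed_hom j f - mixed_hom (Suc j) f)"

lemma ring_map_poly_const: "ring_map poly_const"
  by (simp add: ring_map_def single_add mult_single)

lemma ring_map_poly_const_scalar: "ring_map (\<lambda>z. poly_const (z *\<^sub>C 1))"
  using ring_map_poly_const ring_map_const[where ?'v = 'v] by (simp add: ring_map_def)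

lemma mixed_variable_linear:
  "mixed_variable j (v + w) = mixed_variable j v + mixed_variable j w"
  "mixed_variable j (a *\<^sub>C v) = poly_const (a *\<^sub>C 1) * mixed_variable j v"
proof -
  show "mixed_variable j (v + w) = mixed_variable j v + mixed_variable j w"
    by (simp add: mixed_variable_def coord_linear[OF basis] scaleC_add_left single_add distrib_right sum.distrib)
  have "poly_const ((a * c) *\<^sub>C 1) = poly_const (a *\<^sub>C 1) * poly_const (c *\<^sub>C 1)" for c
    using ring_mapD(3)[OF ring_map_poly_const_scalar, of a c] .
  then show "mixed_variable j (a *\<^sub>C v) = poly_const (a *\<^sub>C 1) * mixed_variable j v"
    by (simp add: mixed_variable_def coord_linear[OF basis] sum_distrib_left mult.assoc)
qed

lemma ring_map_mixed_hom: "ring_map (mixed_hom j)"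
  unfolding mixed_hom_def by (rule ring_map_sym_eval[OF ring_map_poly_const_scalar mixed_variable_linear])

lemma mixed_hom_incl: "mixed_hom j (sym_incl v) = mixed_variable j v"
  unfolding mixed_hom_def by (rule sym_eval_incl[OF ring_map_poly_const_scalar mixed_variable_linear])

lemma mixed_hom_const: "mixed_hom j (z *\<^sub>C 1) = poly_const (z *\<^sub>C 1)"
  unfolding mixed_hom_def by (rule sym_eval_const[OF ring_map_poly_const_scalar mixed_variable_linear])

lemma mixed_variable_step:
  assumes "j < length bs"
  shows "mixed_variable j v - mixed_variable (Suc j) v = poly_const (coord bs j v *\<^sub>C 1) * mixed_step j"
proof -
  have "mixed_variable j v - mixed_variable (Suc j) v =
      (\<Sum>i<length bs. if i = j then poly_const (coord bs j v *\<^sub>C 1) * mixed_step j else 0)"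
    unfolding mixed_variable_def sum_subtractf[symmetric]
    by (rule sum.cong) (auto simp: mixed_step_def right_diff_distrib)
  then show ?thesis using assms by simp
qed

lemma mixed_hom_length: "mixed_hom (length bs) f = poly_const (sym_map T f)"
proof (rule ring_map_sym_eqI[OF ring_map_mixed_hom, where h' = "\<lambda>f. poly_const (sym_map T f)"])
  show "ring_map (\<lambda>f. poly_const (sym_map T f))"
    using ring_map_poly_const ring_map_sym_map[OF T] by (simp add: ring_map_def)
  show "mixed_hom (length bs) (z *\<^sub>C 1) = poly_const (sym_map T (z *\<^sub>C 1))" for z
    by (simp add: mixed_hom_const sym_map_const[OF T])
  show "mixed_hom (length bs) (sym_incl v) = poly_const (sym_map T (sym_incl v))" for v
  proof -
    have "poly_const (sym_map T (sym_incl v)) =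
        (\<Sum>i<length bs. poly_const (sym_map T (coord bs i v *\<^sub>C sym_incl (bs ! i))))"
      by (subst incl_coord[OF basis]) (simp add: ring_map_sum[OF ring_map_sym_map[OF T]] ring_map_sum[OF ring_map_poly_const])
    also have "\<dots> = mixed_variable (length bs) v"
      unfolding mixed_variable_def
      by (rule sum.cong) (auto simp: sym_map_scale[OF T] sym_map_incl[OF T] mult_single sym_scale_mult)
    finally show ?thesis by (simp add: mixed_hom_incl)
  qed
qed

lemma poly_act_mixed_hom_length: "poly_act bs (mixed_hom (length bs) f) n = (\<lambda>a l. sym_map T f * n a l)"
  by (simp add: fun_eq_iff mixed_hom_length poly_act_single basis_monomial_def)

lemma poly_act_mixed_hom_0:
  assumes "clinear n"
  shows "poly_act bs (mixed_hom 0 f) n = (\<lambda>a. n (a * f))"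
  using assms
proof (induction f arbitrary: n rule: sym_induct)
  case (const z)
  have "n (a * (z *\<^sub>C 1)) = z *\<^sub>C n a" for a
    using clinearD(2)[OF const] by (simp add: sym_scale_mult)
  then show ?case
    by (simp add: fun_eq_iff mixed_hom_const poly_act_single basis_monomial_def sym_scale_mult scaleC_fun_def)
next
  case (incl v)
  have sum_left: "poly_act bs (sum p I) n = (\<Sum>i\<in>I. poly_act bs (p i) n)" for p :: "nat \<Rightarrow> _" and I
  proof (induction I rule: infinite_finite_induct)
  qed (auto simp: poly_act_add, auto simp: poly_act_def fun_eq_iff)
  have trm: "poly_act bs (poly_const (c *\<^sub>C 1) * Poly_Mapping.single {#i#} 1) n a = n (a * (c *\<^sub>C sym_incl (bs ! i)))" for c i a
    using clinearD(2)[OF incl, of c "a * sym_incl (bs ! i)"]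
    by (simp add: mult_single fun_eq_iff poly_act_single basis_monomial_def sym_scale_mult scaleC_fun_def)
  show ?case
  proof
    fix a
    have "poly_act bs (mixed_hom 0 (sym_incl v)) n a = (\<Sum>i<length bs. n (a * (coord bs i v *\<^sub>C sym_incl (bs ! i))))"
      by (simp add: mixed_hom_incl mixed_variable_def sum_left sum_fun trm)
    also have "\<dots> = n (a * sym_incl v)"
      by (subst incl_coord[OF basis, of v]) (simp add: clinear_sum[OF incl] sum_distrib_left)
    finally show "poly_act bs (mixed_hom 0 (sym_incl v)) n a = n (a * sym_incl v)" .
  qed
next
  case (add f h)
  then show ?case
    by (simp add: ring_mapD[OF ring_map_mixed_hom] poly_act_add) (simp add: fun_eq_iff distrib_left clinearD[OF add(3)])
next
  case (mult f h)
  have "clinear (\<lambda>a. n (a * h))"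
    using mult.prems by (simp add: clinear_iff distrib_right sym_scale_mult)
  then show ?case
    using mult.IH(1)[of "\<lambda>a. n (a * h)"] mult.IH(2)[OF mult.prems]
    by (simp add: ring_mapD[OF ring_map_mixed_hom] poly_act_mult mult.assoc)
qed

lemma mixed_differences:
  "twisted_differences bs (poly_act bs :: _ \<Rightarrow> ('v sym \<Rightarrow> 'i \<Rightarrow> 'v sym) \<Rightarrow> _) mixed_hom mixed_quotient mixed_step"
proof (unfold_locales)
  fix j assume j: "j < length bs"
  have const: "mixed_hom j (z *\<^sub>C 1) = mixed_hom (Suc j) (z *\<^sub>C 1)" for z
    by (simp add: mixed_hom_const)
  have incl: "mixed_hom j (sym_incl v) - mixed_hom (Suc j) (sym_incl v) = poly_const (coord bs j v *\<^sub>C 1) * mixed_step j" for v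
    by (simp add: mixed_hom_incl mixed_variable_step j)
  have regular: "x = 0" if "x * mixed_step j = 0" for x
    using that unfolding mixed_step_def by (rule monic_linear_regular)
  note dq = difference_quotient[OF ring_map_mixed_hom ring_map_mixed_hom const incl regular, folded mixed_quotient_def]
  fix f h z v and x :: "'v sym \<Rightarrow> 'i \<Rightarrow> 'v sym"
  show "mixed_quotient j (f * h) = mixed_hom j f * mixed_quotient j h + mixed_quotient j f * mixed_hom (Suc j) h"
    by (rule dq(2))
  show "mixed_hom j f - mixed_hom (Suc j) f = mixed_quotient j f * mixed_step j"
    by (rule dq(1))
  show "mixed_quotient j (f + h) = mixed_quotient j f + mixed_quotient j h"
    by (rule dq(3))
  have const_act: "poly_act bs (poly_const (c *\<^sub>C 1)) y = c *\<^sub>C y" for c and y :: "'v sym \<Rightarrow> 'i \<Rightarrow> 'v sym"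
    by (simp add: fun_eq_iff poly_act_single basis_monomial_def sym_scale_mult scaleC_fun_def)
  show "poly_act bs (mixed_quotient j (z *\<^sub>C f)) x = z *\<^sub>C poly_act bs (mixed_quotient j f) x"
    by (simp add: dq(4) mixed_hom_const poly_act_mult const_act)
  show "poly_act bs (mixed_quotient j (sym_incl v)) x = coord bs j v *\<^sub>C x"
    by (simp add: dq(5) const_act)
qed (simp_all add: basis poly_act_add poly_act_mult clinearD[OF clinear_poly_act])

end

section \<open>Antisymmetrization is injective on cohomology\<close>

text \<open>
  Dimension shifting replaces a bimodule \<open>N\<close> by a bimodule of functions \<open>S(V) \<rightarrow> N\<close>.  For all iterates to
  live in one type, so that an induction can range over them, the arguments are collected in a list.
\<close>

type_synonym 'v shifted = "'v sym list \<Rightarrow> 'v sym"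

definition right_mult :: "('v::complex_vector \<Rightarrow> 'v) \<Rightarrow> ('i \<Rightarrow> 'v sym) \<Rightarrow> 'v sym \<Rightarrow> 'i \<Rightarrow> 'v sym" where
  "right_mult T w x = (\<lambda>l. sym_map T x * w l)"

text \<open>
  Dimension shifting never changes the right action, which stays the pointwise multiplication
  \<^const>\<open>right_mult\<close>; the left action \<open>L\<close> is what varies.
\<close>

locale pointwise_bimodule =
  fixes N :: "('v::complex_vector) shifted set" and L :: "'v sym \<Rightarrow> 'v shifted \<Rightarrow> 'v shifted"
  assumes N: "complex_vector.subspace N" and N_mult: "w \<in> N \<Longrightarrow> (\<lambda>l. r * w l) \<in> N"
    and L_mem: "w \<in> N \<Longrightarrow> L x w \<in> N"
    and L_linear: "clinear (L x)"
    and L_add: "w \<in> N \<Longrightarrow> L (x + y) w = L x w + L y w"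
    and L_scale: "w \<in> N \<Longrightarrow> L (c *\<^sub>C x) w = c *\<^sub>C L x w"
    and L_times: "w \<in> N \<Longrightarrow> L (x * y) w = L x (L y w)"
    and L_one: "w \<in> N \<Longrightarrow> L 1 w = w"
    and L_mult: "w \<in> N \<Longrightarrow> L x (\<lambda>l. r * w l) = (\<lambda>l. r * L x w l)"

lemma clinear_right_mult: "clinear (\<lambda>w. right_mult T w x)"
  by (simp add: clinear_iff right_mult_def fun_eq_iff distrib_left scaleC_fun_def sym_scale_mult)

lemma bdry_apply: "bdry mul (\<lambda>n x a. ra (n a) x) G xs a = bdry mul ra (\<lambda>l. G l a) xs"
  by (induction xs arbitrary: G rule: induct_list012) simp_all

lemma multilinear_maps_linear_image:
  assumes "F \<in> multilinear_maps A H p" "clinear \<Theta>" "\<And>n. n \<in> H \<Longrightarrow> \<Theta> n \<in> M"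
  shows "(\<lambda>l. \<Theta> (F l)) \<in> multilinear_maps A M p"
  using assms(1,3) by (auto simp: multilinear_maps_def clinearD[OF assms(2)])

lemma phi_star_linear_image:
  "clinear \<Theta> \<Longrightarrow> phi_star p (\<lambda>l. \<Theta> (F l)) = (\<lambda>ws. \<Theta> (phi_star p F ws))"
  by (auto simp: fun_eq_iff phi_star_eq antisymmetrize_linear clinearD)

context pointwise_bimodule
begin

definition coinduced :: "('v sym \<Rightarrow> 'v shifted) set" where
  "coinduced = {n. clinear n \<and> (\<forall>a. n a \<in> N)}"

text \<open>
  The bimodule \<open>N\<close> embeds into the coinduced one by \<open>n \<mapsto> (a \<mapsto> a n)\<close>.  Each class of the quotient has a
  unique representative that vanishes at \<open>1\<close>, namely \<open>a \<mapsto> n(a) - a n(1)\<close> for the class of \<open>n\<close>.  So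
  \<open>shift\<close> is the quotient, with \<open>a\<close> stored at the front of the list, \<open>to_shift\<close> is the projection, and
  \<open>shift_left\<close> is the induced left action.
\<close>

definition shift :: "'v shifted set" where
  "shift = {w. w [] = 0 \<and> (\<forall>a. (\<lambda>l. w (a # l)) \<in> N) \<and> clinear (\<lambda>a l. w (a # l)) \<and> (\<forall>l. w (1 # l) = 0)}"

definition shift_left :: "'v sym \<Rightarrow> 'v shifted \<Rightarrow> 'v shifted" where
  "shift_left x w = (\<lambda>l. case l of [] \<Rightarrow> 0 | a # l' \<Rightarrow> w ((a * x) # l') - L a (\<lambda>m. w (x # m)) l')"

definition to_shift :: "('v sym \<Rightarrow> 'v shifted) \<Rightarrow> 'v shifted" where
  "to_shift n = (\<lambda>l. case l of [] \<Rightarrow> 0 | a # l' \<Rightarrow> n a l' - L a (n 1) l')"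

lemma subspace_coinduced: "complex_vector.subspace coinduced"
  using N by (auto simp: coinduced_def complex_vector.subspace_def clinear_iff scaleC_add_right scaleC_scaleC
      scaleC_fun_def fun_eq_iff mult.commute)

lemma L_simps: "L x (v + w) = L x v + L x w" "L x (c *\<^sub>C w) = c *\<^sub>C L x w" "L x 0 = 0" "L x (v - w) = L x v - L x w"
  by (rule clinearD[OF L_linear])+

lemma L_fun_simps: "L x (\<lambda>l. v l + w l) = L x v + L x w" "L x (\<lambda>l. c *\<^sub>C w l) = c *\<^sub>C L x w"
  "L x (\<lambda>l. 0) = 0" "L x (\<lambda>l. v l - w l) = L x v - L x w"
  using L_simps(1,4)[of x v w] L_simps(2)[of x c w] L_simps(3)[of x]
  by (simp_all add: plus_fun_def fun_diff_def scaleC_fun_def zero_fun_def)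

lemma shiftD:
  assumes "w \<in> shift"
  shows "w [] = 0" "(\<lambda>l. w (a # l)) \<in> N" "w ((a + b) # l) = w (a # l) + w (b # l)"
    "w ((c *\<^sub>C a) # l) = c *\<^sub>C w (a # l)" "w (1 # l) = 0"
  using assms by (auto simp: shift_def clinear_iff fun_eq_iff scaleC_fun_def)

lemma shift_bimodule: "pointwise_bimodule shift shift_left"
proof (rule pointwise_bimodule.intro)
  show "complex_vector.subspace shift"
    using N unfolding complex_vector.subspace_def
    by (auto simp: shift_def clinear_iff fun_eq_iff scaleC_fun_def scaleC_add_right scaleC_scaleC
        mult.commute zero_fun_def plus_fun_def)
  fix w x y r c assume w: "w \<in> shift"
  note wD = shiftD[OF w]
  show "(\<lambda>l. r * w l) \<in> shift"
    using wD N_mult[OF wD(2), of r] by (simp add: shift_def clinear_iff fun_eq_iff scaleC_fun_def distrib_left sym_scale_mult)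
  have "(\<lambda>l. w ((a * x) # l) - L a (\<lambda>m. w (x # m)) l) \<in> N" for a
    using complex_vector.subspace_diff[OF N wD(2)[of "a * x"] L_mem[OF wD(2)[of x], of a]]
    by (simp add: fun_diff_def)
  then show "shift_left x w \<in> shift"
    by (simp add: shift_def shift_left_def clinear_iff fun_eq_iff scaleC_fun_def distrib_right sym_scale_mult
        wD L_add[OF wD(2)] L_scale[OF wD(2)] L_one[OF wD(2)] complex_vector.scale_right_diff_distrib)
  show "shift_left (x + y) w = shift_left x w + shift_left y w"
    by (auto simp: fun_eq_iff shift_left_def distrib_left wD L_fun_simps split: list.split)
  show "shift_left (c *\<^sub>C x) w = c *\<^sub>C shift_left x w"
    by (auto simp: fun_eq_iff shift_left_def sym_scale_mult scaleC_fun_def wD L_fun_simps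
        complex_vector.scale_right_diff_distrib split: list.split)
  show "shift_left (x * y) w = shift_left x (shift_left y w)"
    by (auto simp: fun_eq_iff shift_left_def L_fun_simps L_times[OF wD(2)] mult.assoc split: list.split)
  show "shift_left 1 w = w"
    by (auto simp: fun_eq_iff shift_left_def wD L_fun_simps split: list.split)
  show "shift_left x (\<lambda>l. r * w l) = (\<lambda>l. r * shift_left x w l)"
    by (auto simp: fun_eq_iff shift_left_def L_mult[OF wD(2)] right_diff_distrib split: list.split)
next
  show "clinear (shift_left x)" for x
    by (auto simp: clinear_iff fun_eq_iff shift_left_def L_fun_simps scaleC_fun_def
        complex_vector.scale_right_diff_distrib split: list.split)
qed

lemma clinear_to_shift: "clinear to_shift"
  by (auto simp: clinear_iff fun_eq_iff to_shift_def L_simps L_fun_simps scaleC_fun_def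
      complex_vector.scale_right_diff_distrib split: list.split)

lemma to_shift_mem:
  assumes "n \<in> coinduced"
  shows "to_shift n \<in> shift"
proof -
  have n: "clinear n" "n a \<in> N" for a using assms by (auto simp: coinduced_def)
  have "(\<lambda>l. n a l - L a (n 1) l) \<in> N" for a
    using complex_vector.subspace_diff[OF N n(2)[of a] L_mem[OF n(2)[of 1], of a]] by (simp add: fun_diff_def)
  then show ?thesis
    by (simp add: shift_def to_shift_def clinear_iff fun_eq_iff clinearD[OF n(1)] L_add[OF n(2)] L_scale[OF n(2)]
      L_one[OF n(2)] scaleC_fun_def complex_vector.scale_right_diff_distrib)
qed

lemma to_shift_left: "n \<in> coinduced \<Longrightarrow> to_shift (\<lambda>a. n (a * x)) = shift_left x (to_shift n)"
  by (auto simp: coinduced_def fun_eq_iff to_shift_def shift_left_def L_simps L_fun_simps L_times split: list.split)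

lemma to_shift_right: "n \<in> coinduced \<Longrightarrow> to_shift (\<lambda>a. right_mult T (n a) x) = right_mult T (to_shift n) x"
  by (auto simp: coinduced_def fun_eq_iff to_shift_def right_mult_def L_mult right_diff_distrib split: list.split)

lemma to_shift_diagonal: "v \<in> N \<Longrightarrow> to_shift (\<lambda>a. L a v) = 0"
  by (auto simp: fun_eq_iff to_shift_def L_one split: list.split)

end

text \<open>
  Induction on the degree, for all bimodules at once.  A cocycle \<open>f\<close> of degree \<open>q + 1\<close> is read as a cochain
  \<open>G\<close> of degree \<open>q\<close> with coinduced values, whose differential is the image of \<open>f\<close> under the embedding of
  \<open>N\<close>.  Its antisymmetrization \<open>\<alpha>\<close> is a Koszul cocycle because that of \<open>f\<close> vanishes, so \<open>\<Upsilon>(\<alpha>)\<close> is a bar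
  cocycle with the same antisymmetrization, and \<open>G' = G - \<Upsilon>(\<alpha>)\<close> still has the differential of \<open>G\<close>.
  The class of \<open>G'\<close> in the quotient is a cocycle to which the induction hypothesis applies.
\<close>

lemma pointwise_cocycle_trivial:
  fixes bs :: "'v::complex_vector list" and N :: "'v shifted set"
  assumes basis: "ordered_basis bs" and T: "clinear T"
    and "pointwise_bimodule N L" "f \<in> multilinear_maps UNIV N p"
    and "codiff (bar_complex UNIV (*) N L (right_mult T)) p f = 0" "phi_star p f = 0"
  shows "f \<in> coboundaries (bar_complex UNIV (*) N L (right_mult T)) p"
  using assms(3-)
proof (induction p arbitrary: N L f)
  case 0
  have "f [] = 0" using fun_cong[OF "0.prems"(4), of "[]"] by (simp add: phi_star_eq antisymmetrize_0 zero_fun_def)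
  then have "f xs = 0" for xs using "0.prems"(2) by (cases xs) (simp_all add: multilinear_maps_0)
  then have "f = 0" by (intro ext) simp
  then show ?case by (simp add: coboundaries_def zero_fun_def)
next
  case (Suc q)
  interpret pointwise_bimodule N L by (rule Suc.prems(1))
  note f = Suc.prems(2)
  let ?laH = "\<lambda>x n a. n (a * x)" and ?raH = "\<lambda>n x a. right_mult T (n a) x"
  let ?act = "poly_act bs :: _ \<Rightarrow> ('v sym \<Rightarrow> 'v shifted) \<Rightarrow> _"
  interpret D: twisted_differences bs ?act "mixed_hom bs T" "mixed_quotient bs T" "mixed_step bs T"
    by (rule mixed_differences[OF basis T])
  have laH: "clinear (?laH x)" for x :: "'v sym"
    by (simp add: clinear_iff fun_eq_iff scaleC_fun_def)
  have raH: "clinear (\<lambda>n. ?raH n x)" for x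
    by (simp add: clinear_iff fun_eq_iff right_mult_def scaleC_fun_def distrib_left sym_scale_mult)
  have f_head: "f ((x + y) # l) = f (x # l) + f (y # l)" "f ((c *\<^sub>C x) # l) = c *\<^sub>C f (x # l)"
    "f [] = 0" "(\<lambda>l. f (x # l)) \<in> multilinear_maps UNIV N q" for x y c l
    using f by (simp_all add: multilinear_maps_Suc)
  have f_mem: "f l \<in> N" for l
    using f complex_vector.subspace_0[OF N] by (cases "length l = Suc q") (auto simp: multilinear_maps_def)
  have f_cocycle: "bar_d (*) L (right_mult T) f xs = 0" if "length xs = Suc (Suc q)" for xs
    using fun_cong[OF Suc.prems(3), of xs] that by (simp add: codiff_bar zero_fun_def)

  \<comment> \<open>the first argument becomes a parameter, of which the values are functions\<close>
  define G where "G = (\<lambda>xs a. f (a # xs))"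
  have G: "G \<in> multilinear_maps UNIV coinduced q"
  proof -
    have "clinear (\<lambda>a. f (a # xs))" for xs
      by (simp add: clinear_iff f_head)
    moreover have "f (a # xs) = 0" if "length xs \<noteq> q" for a xs
      using multilinear_mapsD(2)[OF f, of "a # xs"] that by simp
    ultimately show ?thesis
      using f_head(4) by (auto simp: multilinear_maps_def G_def coinduced_def f_mem fun_eq_iff scaleC_fun_def)
  qed
  have bdryH: "bdry (*) ?raH F xs a = bdry (*) (right_mult T) (\<lambda>l. F l a) xs" for F xs a
    by (rule bdry_apply)
  have dG: "bar_d (*) ?laH ?raH G (x # xs) = (\<lambda>a. L a (f (x # xs)))" if "length xs = q" for x xs
    using f_cocycle[of "_ # x # xs"] that
    by (simp add: fun_eq_iff bar_d_def bdryH) (simp add: G_def algebra_simps)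

  define \<alpha> where "\<alpha> = phi_star q G"
  have \<alpha>: "\<alpha> \<in> alternating_maps coinduced q"
    unfolding \<alpha>_def by (rule phi_star_alternating[OF subspace_coinduced G])
  have \<alpha>_mem: "\<alpha> l \<in> coinduced" for l
    using \<alpha> complex_vector.subspace_0[OF subspace_coinduced]
    by (cases "length l = q") (auto simp: alternating_maps_def multilinear_maps_def)
  have kd_\<alpha>: "altsum (\<lambda>w l. ?laH (sym_incl w) (\<alpha> l) - ?raH (\<alpha> l) (sym_incl w)) ws = 0"
    if ws: "length ws = Suc q" for ws
  proof -
    have "altsum (\<lambda>w l. ?laH (sym_incl w) (\<alpha> l) - ?raH (\<alpha> l) (sym_incl w)) ws =
        codiff (koszul_complex coinduced ?laH ?raH) q \<alpha> ws"
      by (simp add: codiff_koszul ws)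
    also have "\<dots> = antisymmetrize (Suc q) (codiff (bar_complex UNIV (*) coinduced ?laH ?raH) q G) (map sym_incl ws)"
      unfolding \<alpha>_def codiff_phi_star[OF laH raH] by (simp add: phi_star_eq ws)
    also have "\<dots> = antisymmetrize (Suc q) (\<lambda>l a. L a (f l)) (map sym_incl ws)"
    proof (rule antisymmetrize_cong)
      fix l :: "'v sym list" assume "length l = Suc q"
      then show "codiff (bar_complex UNIV (*) coinduced ?laH ?raH) q G l = (\<lambda>a. L a (f l))"
        by (cases l) (simp_all add: codiff_bar dG)
    qed
    also have "\<dots> = (\<lambda>a. L a (antisymmetrize (Suc q) f (map sym_incl ws)))"
      by (rule antisymmetrize_linear[where T = "\<lambda>w a. L a w"]) (simp add: clinear_iff fun_eq_iff L_simps L_fun_simps scaleC_fun_def)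
    also have "antisymmetrize (Suc q) f (map sym_incl ws) = 0"
      using fun_cong[OF Suc.prems(4), of ws] ws by (simp add: phi_star_eq zero_fun_def)
    also have "(\<lambda>a. L a 0) = 0" by (rule ext) (simp only: L_simps zero_fun_apply)
    finally show ?thesis .
  qed

  \<comment> \<open>\<open>\<tau>\<close> is a cocycle with the antisymmetrization of \<open>G\<close>, by the formal difference quotients\<close>
  define \<tau> where "\<tau> = D.Ups 0 \<alpha>"
  have act_mem: "n \<in> coinduced \<Longrightarrow> ?act r n \<in> coinduced" for r n
    using poly_act_mem[OF N N_mult, where n = n and p = r and bs = bs] by (simp add: coinduced_def)
  have \<tau>: "\<tau> \<in> multilinear_maps UNIV coinduced q"
    unfolding \<tau>_def using \<alpha> by (intro D.Ups_multilinear subspace_coinduced act_mem) (auto simp: alternating_maps_def)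
  have \<tau>_mem: "\<tau> l \<in> coinduced" for l
    unfolding \<tau>_def by (rule D.Ups_mem[OF subspace_coinduced act_mem \<alpha>_mem])
  have ra_eq: "(\<lambda>n x. ?act (mixed_hom bs T (length bs) x) n) = ?raH"
    by (simp add: fun_eq_iff poly_act_mixed_hom_length[OF basis T] right_mult_def)
  have la_eq: "?act (mixed_hom bs T 0 x) n = ?laH x n" if "n \<in> coinduced" for x n
    using that by (simp add: poly_act_mixed_hom_0[OF basis T] coinduced_def)
  have d\<tau>: "bar_d (*) ?laH ?raH \<tau> (x # xs) = 0" if "length xs = q" for x xs
  proof -
    have "bar_d (*) ?laH ?raH \<tau> (x # xs) = D.Ups 0 (D.kd \<alpha>) (x # xs)"
      using D.Ups_chain[of 0 x \<alpha> xs] unfolding \<tau>_def[symmetric] ra_eq la_eq[OF \<tau>_mem]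
      by (simp add: bar_d_def)
    also have "\<dots> = D.Ups 0 (\<lambda>l. 0) (x # xs)"
    proof (rule D.Ups_cong)
      fix l :: "'v list" assume l: "length l = length (x # xs)"
      have "D.kd \<alpha> l = altsum (\<lambda>w l. ?laH (sym_incl w) (\<alpha> l) - ?raH (\<alpha> l) (sym_incl w)) l"
        using fun_cong[OF fun_cong[OF ra_eq]] by (intro altsum_cong) (simp add: la_eq \<alpha>_mem)
      then show "D.kd \<alpha> l = 0" using kd_\<alpha>[of l] l that by simp
    qed
    finally show ?thesis by (simp only: D.Ups_zero)
  qed

  define G' where "G' = (\<lambda>l. G l - \<tau> l)"
  have G': "G' \<in> multilinear_maps UNIV coinduced q"
    using complex_vector.subspace_diff[OF subspace_multilinear_maps[OF subspace_coinduced] G \<tau>]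
    by (simp add: G'_def fun_diff_def)
  have G'_mem: "G' l \<in> coinduced" for l
    using G' complex_vector.subspace_0[OF subspace_coinduced]
    by (cases "length l = q") (auto simp: multilinear_maps_def)
  have G'_mem': "G' l a \<in> N" for l a
    using G'_mem by (auto simp: coinduced_def)
  have dG': "bar_d (*) ?laH ?raH G' (x # xs) = (\<lambda>a. L a (f (x # xs)))" if "length xs = q" for x xs
    unfolding G'_def bar_d_diff[of ?laH ?raH, OF laH raH] dG[OF that] d\<tau>[OF that] by simp
  have phi_G': "phi_star q G' = 0"
    using phi_star_diff[of q G \<tau>] D.phi_star_Ups[OF \<alpha>]
    by (simp add: G'_def \<tau>_def \<alpha>_def fun_diff_def zero_fun_def)

  \<comment> \<open>subtracting \<open>dg\<close> replaces \<open>f(a, xs)\<close> by \<open>G' xs a - a G' xs 1\<close>, the representative of the class of \<open>G'\<close>\<close>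
  define g where "g = (\<lambda>xs. G' xs 1)"
  have g: "g \<in> multilinear_maps UNIV N q"
    unfolding g_def
    by (rule multilinear_maps_linear_image[OF G', of "\<lambda>n. n 1"]) (auto simp: clinear_iff coinduced_def scaleC_fun_def)
  have dg: "bar_d (*) L (right_mult T) g (a # xs) = f (a # xs) - (G' xs a - L a (G' xs 1))" if "length xs = q" for a xs
    using fun_cong[OF dG'[OF that, of a], of 1] by (simp add: bar_d_def bdryH g_def L_one f_mem algebra_simps)

  define f' where "f' = (\<lambda>l. to_shift (G' l))"
  have f': "f' \<in> multilinear_maps UNIV shift q"
    unfolding f'_def by (rule multilinear_maps_linear_image[OF G' clinear_to_shift to_shift_mem])
  have "bar_d (*) shift_left (right_mult T) f' xs = 0" if len: "length xs = Suc q" for xs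
  proof -
    obtain x l where xs: "xs = x # l" "length l = q" using len by (cases xs) auto
    have "to_shift (bar_d (*) ?laH ?raH G' xs) = bar_d (*) shift_left (right_mult T) f' (map (\<lambda>x. x) xs)"
      by (rule bar_d_transport[where A = UNIV and T = to_shift and t = "\<lambda>x. x"])
        (simp_all add: clinearD[OF clinear_to_shift] f'_def xs to_shift_right to_shift_left G'_mem)
    then show ?thesis using dG'[OF xs(2)] by (simp add: xs to_shift_diagonal f_mem)
  qed
  then have f'_cocycle: "codiff (bar_complex UNIV (*) shift shift_left (right_mult T)) q f' = 0"
    by (simp add: fun_eq_iff codiff_bar)
  have "phi_star q f' = 0"
    unfolding f'_def phi_star_linear_image[OF clinear_to_shift]
    by (rule ext) (simp only: phi_G' zero_fun_apply clinearD(3)[OF clinear_to_shift])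
  from Suc.IH[OF shift_bimodule f' f'_cocycle this]
  have cob: "f' \<in> coboundaries (bar_complex UNIV (*) shift shift_left (right_mult T)) q" .
  have "\<exists>k\<in>multilinear_maps UNIV N q. \<forall>a xs. length xs = q \<longrightarrow>
      bar_d (*) L (right_mult T) k (a # xs) = - (G' xs a - L a (G' xs 1))"
  proof (cases q)
    case 0
    have f'_Nil: "- (G' [] a - L a (G' [] 1)) = 0" for a
    proof -
      have "f' [] (a # l) = 0" for l using cob 0 by (simp add: coboundaries_def)
      then have "(G' [] a - L a (G' [] 1)) l = 0" for l by (simp add: f'_def to_shift_def)
      then have "G' [] a - L a (G' [] 1) = 0" by (intro ext) (simp only: zero_fun_apply)
      then show ?thesis by (simp only: minus_zero)
    qed
    have "bar_d (*) L (right_mult T) 0 [a] = 0" for a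
      by (simp add: bar_d_def L_simps clinearD(3)[OF clinear_right_mult] del: zero_fun_def)
    moreover have "0 \<in> multilinear_maps UNIV N q"
      by (rule complex_vector.subspace_0[OF subspace_multilinear_maps[OF N]])
    ultimately show ?thesis
      using 0 f'_Nil by (intro bexI[of _ 0]) (simp_all only: length_0_conv simp_thms)
  next
    case (Suc r)
    then obtain h where h: "h \<in> multilinear_maps UNIV shift r"
      and f'h: "f' = codiff (bar_complex UNIV (*) shift shift_left (right_mult T)) r h"
      using cob by (auto simp: coboundaries_def bar_complex_def)
    have h_mem: "h l \<in> shift" for l
      using h complex_vector.subspace_0[OF pointwise_bimodule.N[OF shift_bimodule]]
      by (cases "length l = r") (auto simp: multilinear_maps_def)
    \<comment> \<open>reading the shifted argument as first argument again turns \<open>d\<close> into \<open>- d\<close>\<close>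
    define k where "k = (\<lambda>xs. case xs of [] \<Rightarrow> (\<lambda>m. 0) | a # l \<Rightarrow> (\<lambda>m. h l (a # m)))"
    have k_Cons: "k (a # l) = (\<lambda>m. h l (a # m))" for a l by (simp add: k_def)
    have "(\<lambda>l m. h l (a # m)) \<in> multilinear_maps UNIV N r" for a
      by (rule multilinear_maps_linear_image[OF h, of "\<lambda>w m. w (a # m)"])
        (simp add: clinear_iff fun_eq_iff scaleC_fun_def, rule shiftD(2))
    then have "k \<in> multilinear_maps UNIV N q"
      unfolding Suc by (simp add: multilinear_maps_Suc k_def fun_eq_iff scaleC_fun_def
          shiftD(3)[OF h_mem] shiftD(4)[OF h_mem] zero_fun_def)
    moreover have "bar_d (*) L (right_mult T) k (a # xs) = - (G' xs a - L a (G' xs 1))" if len: "length xs = q" for a xs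
    proof -
      obtain x l where xs: "xs = x # l" "length l = r" using len Suc by (cases xs) auto
      have ev: "bdry (*) (right_mult T) (\<lambda>l. k (a # l)) xs = (\<lambda>m. bdry (*) (right_mult T) h xs (a # m))"
        using bdry_transport[where A = UNIV and T = "\<lambda>w m. w (a # m)" and t = "\<lambda>x. x" and mul = "(*)" and mul' = "(*)"
            and xs = xs and f = h and f' = "\<lambda>l. k (a # l)" and ra = "right_mult T" and ra' = "right_mult T"]
        by (simp add: fun_eq_iff k_Cons right_mult_def)
      have "(\<lambda>m. f' xs (a # m)) = G' xs a - L a (G' xs 1)"
        by (simp add: fun_eq_iff f'_def to_shift_def)
      moreover have "f' xs = bar_d (*) shift_left (right_mult T) h xs"
        using len Suc by (simp add: f'h codiff_bar)
      ultimately have "G' xs a - L a (G' xs 1) = (\<lambda>m. bar_d (*) shift_left (right_mult T) h xs (a # m))"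
        by simp
      also have "\<dots> = - bar_d (*) L (right_mult T) k (a # xs)"
        using ev by (simp add: fun_eq_iff bar_d_def shift_left_def xs k_Cons)
      finally show ?thesis by simp
    qed
    ultimately show ?thesis by blast
  qed
  then obtain k where k: "k \<in> multilinear_maps UNIV N q"
    and dk: "\<And>a xs. length xs = q \<Longrightarrow> bar_d (*) L (right_mult T) k (a # xs) = - (G' xs a - L a (G' xs 1))"
    by blast
  have "f = codiff (bar_complex UNIV (*) N L (right_mult T)) q (\<lambda>l. g l - k l)"
  proof
    fix xs
    show "f xs = codiff (bar_complex UNIV (*) N L (right_mult T)) q (\<lambda>l. g l - k l) xs"
    proof (cases "length xs = Suc q")
      case True
      then obtain a l where xs: "xs = a # l" "length l = q" by (cases xs) auto
      show ?thesis
        using dg[OF xs(2), of a] dk[OF xs(2), of a]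
        by (simp add: codiff_bar True bar_d_diff[OF L_linear clinear_right_mult] xs)
    next
      case False
      then show ?thesis using multilinear_mapsD(2)[OF f, of xs] by (simp add: codiff_bar)
    qed
  qed
  moreover have "(\<lambda>l. g l - k l) \<in> multilinear_maps UNIV N q"
    using complex_vector.subspace_diff[OF subspace_multilinear_maps[OF N] g k] by (simp add: fun_diff_def)
  ultimately show ?case
    by (auto simp: coboundaries_def bar_complex_def)
qed

section \<open>The skew group algebra\<close>

locale skew_algebra = group G for G :: "('g, 'x) monoid_scheme" (structure) +
  fixes \<rho> :: "'g \<Rightarrow> 'v::complex_vector \<Rightarrow> 'v"
  assumes finite_carrier: "finite (carrier G)" and action: "linear_action G \<rho>"
begin

abbreviation gact :: "'g \<Rightarrow> 'v sym \<Rightarrow> 'v sym" where "gact g \<equiv> sym_map (\<rho> g)"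

abbreviation smul :: "('g \<Rightarrow> 'v sym) \<Rightarrow> ('g \<Rightarrow> 'v sym) \<Rightarrow> 'g \<Rightarrow> 'v sym" (infixl "\<odot>" 72) where
  "F \<odot> H \<equiv> skew_mult G \<rho> F H"

abbreviation grp :: "'g \<Rightarrow> 'g \<Rightarrow> 'v sym" where "grp g \<equiv> skew_single g 1"

abbreviation emb :: "'v sym \<Rightarrow> 'g \<Rightarrow> 'v sym" where "emb \<equiv> skew_emb G"

abbreviation A :: "('g \<Rightarrow> 'v sym) set" where "A \<equiv> skew_carrier G"

lemma clinear_action: "g \<in> carrier G \<Longrightarrow> clinear (\<rho> g)"
  using action by (simp add: linear_action_def)

lemma gact_simps:
  assumes "g \<in> carrier G"
  shows "gact g (a + b) = gact g a + gact g b" "gact g (a * b) = gact g a * gact g b" "gact g 1 = 1" "gact g 0 = 0"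
    "gact g (z *\<^sub>C a) = z *\<^sub>C gact g a"
  using ring_mapD[OF ring_map_sym_map[OF clinear_action[OF assms]]] sym_map_scale[OF clinear_action[OF assms]] by auto

lemma gact_sum: "g \<in> carrier G \<Longrightarrow> gact g (sum f I) = (\<Sum>i\<in>I. gact g (f i))"
  by (rule ring_map_sum[OF ring_map_sym_map[OF clinear_action]])

lemma gact_mult: "g \<in> carrier G \<Longrightarrow> h \<in> carrier G \<Longrightarrow> gact g (gact h a) = gact (g \<otimes> h) a"
  using action by (intro sym_map_compose) (auto simp: linear_action_def)

lemma gact_one: "gact \<one> a = a"
  using action by (intro sym_map_ident) (auto simp: linear_action_def)

lemma gact_inv: "g \<in> carrier G \<Longrightarrow> gact g (gact (inv g) a) = a" "g \<in> carrier G \<Longrightarrow> gact (inv g) (gact g a) = a"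
  by (simp_all add: gact_mult gact_one)

lemma smul_apply: "(F \<odot> H) k = (\<Sum>g\<in>carrier G. \<Sum>h\<in>carrier G. if k = g \<otimes> h then F g * gact g (H h) else 0)"
  by (simp add: skew_mult_def sum_fun skew_single_def)

lemma subspace_A: "complex_vector.subspace A"
  by (auto simp: complex_vector.subspace_def skew_carrier_def scaleC_fun_def)

lemma smul_mem [simp]: "F \<odot> H \<in> A"
  by (auto simp: skew_carrier_def smul_apply intro!: sum.neutral)

lemma single_mem [simp]: "g \<in> carrier G \<Longrightarrow> skew_single g a \<in> A"
  by (auto simp: skew_carrier_def skew_single_def)

lemma emb_mem [simp]: "emb a \<in> A"
  by (simp add: skew_emb_def)

lemma clinear_smul_right: "clinear (\<lambda>H. F \<odot> H)"
  unfolding clinear_iff fun_eq_iff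
  by (auto simp: smul_apply scaleC_fun_def gact_simps distrib_left sum.distrib[symmetric] sym_scale_mult
      complex_vector.scale_sum_right intro!: sum.cong)

lemma clinear_smul_left: "clinear (\<lambda>F. F \<odot> H)"
  unfolding clinear_iff fun_eq_iff
  by (auto simp: smul_apply scaleC_fun_def distrib_right sum.distrib[symmetric] sym_scale_mult
      complex_vector.scale_sum_right intro!: sum.cong)

lemmas smul_right = clinearD[OF clinear_smul_right] clinear_sum[OF clinear_smul_right]
lemmas smul_left = clinearD[OF clinear_smul_left] clinear_sum[OF clinear_smul_left]

lemma single_mult:
  assumes "g \<in> carrier G" "h \<in> carrier G"
  shows "skew_single g a \<odot> skew_single h b = skew_single (g \<otimes> h) (a * gact g b)"
proof
  fix k
  have "(skew_single g a \<odot> skew_single h b) k =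
      (\<Sum>g'\<in>carrier G. if g' = g then (\<Sum>h'\<in>carrier G. if h' = h then (if k = g \<otimes> h then a * gact g b else 0) else 0) else 0)"
    unfolding smul_apply skew_single_def
    by (intro sum.cong refl) (auto simp: gact_simps intro!: sum.neutral sum.cong)
  then show "(skew_single g a \<odot> skew_single h b) k = skew_single (g \<otimes> h) (a * gact g b) k"
    using assms finite_carrier by (simp add: skew_single_def)
qed

lemma single_decomposition: "F \<in> A \<Longrightarrow> (\<Sum>g\<in>carrier G. skew_single g (F g)) = F"
  using finite_carrier by (auto simp: fun_eq_iff sum_fun skew_single_def skew_carrier_def)

lemma A_induct [consumes 1, case_names single sum]:
  assumes "F \<in> A" and "\<And>g a. g \<in> carrier G \<Longrightarrow> P (skew_single g a)"
    and "\<And>f. (\<And>g. g \<in> carrier G \<Longrightarrow> P (f g)) \<Longrightarrow> P (\<Sum>g\<in>carrier G. f g)"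
  shows "P F"
  using assms(3)[of "\<lambda>g. skew_single g (F g)"] assms(1,2) by (simp add: single_decomposition)

lemma smul_assoc:
  assumes "F \<in> A" "H \<in> A" "K \<in> A"
  shows "F \<odot> H \<odot> K = F \<odot> (H \<odot> K)"
  using assms(1)
proof (induction rule: A_induct)
  case (single g a)
  from assms(2) show ?case
  proof (induction rule: A_induct)
    case (single h b)
    from assms(3) show ?case
    proof (induction rule: A_induct)
      case (single k c)
      then show ?case
        using \<open>g \<in> carrier G\<close> \<open>h \<in> carrier G\<close>
        by (simp add: single_mult m_assoc gact_simps gact_mult mult.assoc)
    qed (simp add: smul_right)
  qed (simp add: smul_right smul_left)
qed (simp add: smul_left)

lemma grp_one_left: "F \<in> A \<Longrightarrow> grp \<one> \<odot> F = F"
  by (induction rule: A_induct) (simp_all add: single_mult smul_right gact_one)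

lemma grp_one_right: "F \<in> A \<Longrightarrow> F \<odot> grp \<one> = F"
  by (induction rule: A_induct) (simp_all add: single_mult smul_left gact_simps)

lemma grp_mult: "g \<in> carrier G \<Longrightarrow> h \<in> carrier G \<Longrightarrow> grp g \<odot> grp h = grp (g \<otimes> h)"
  by (simp add: single_mult gact_simps)

lemma grp_cancel:
  assumes "g \<in> carrier G" "F \<in> A"
  shows "grp g \<odot> (grp (inv g) \<odot> F) = F" "grp (inv g) \<odot> (grp g \<odot> F) = F"
    "F \<odot> grp g \<odot> grp (inv g) = F" "F \<odot> grp (inv g) \<odot> grp g = F"
  using assms by (simp_all add: smul_assoc[symmetric] grp_mult grp_one_left)
    (simp_all add: smul_assoc grp_mult grp_one_right)

lemma emb_mult: "emb (a * b) = emb a \<odot> emb b"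
  by (simp add: skew_emb_def single_mult gact_one)

lemma clinear_emb: "clinear emb"
  by (auto simp: clinear_iff skew_emb_def skew_single_def fun_eq_iff scaleC_fun_def)

lemma single_eq_emb: "g \<in> carrier G \<Longrightarrow> skew_single g a = emb a \<odot> grp g"
  by (simp add: skew_emb_def single_mult gact_one)

lemma emb_decomposition: "F \<in> A \<Longrightarrow> (\<Sum>g\<in>carrier G. emb (F g) \<odot> grp g) = F"
  using single_decomposition[of F] by (simp flip: single_eq_emb cong: sum.cong)

lemma grp_emb: "h \<in> carrier G \<Longrightarrow> grp h \<odot> emb a = emb (gact h a) \<odot> grp h"
  by (simp add: skew_emb_def single_mult gact_one gact_simps)

lemma skew_act_eq:
  assumes "h \<in> carrier G" "F \<in> A"
  shows "skew_act G \<rho> h F = grp h \<odot> F \<odot> grp (inv h)"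
proof -
  have "grp h \<odot> F \<odot> grp (inv h) = grp h \<odot> (\<Sum>g\<in>carrier G. skew_single g (F g)) \<odot> grp (inv h)"
    using assms by (simp add: single_decomposition)
  also have "\<dots> = skew_act G \<rho> h F"
    unfolding skew_act_def smul_left smul_right
    using assms by (intro sum.cong) (auto simp: single_mult gact_simps)
  finally show ?thesis by simp
qed

lemma clinear_skew_act: "h \<in> carrier G \<Longrightarrow> clinear (skew_act G \<rho> h)"
  unfolding clinear_iff fun_eq_iff skew_act_def
  by (auto simp: sum_fun skew_single_def scaleC_fun_def gact_simps sum.distrib[symmetric]
      complex_vector.scale_sum_right intro!: sum.cong)

lemma skew_act_mem: "h \<in> carrier G \<Longrightarrow> skew_act G \<rho> h F \<in> A"
  by (auto simp: skew_act_def sum_fun skew_single_def skew_carrier_def intro!: sum.neutral)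

section \<open>Averaging over the group\<close>

definition avg :: "('g \<Rightarrow> 'c::complex_vector) \<Rightarrow> 'c" where
  "avg f = (1 / of_nat (card (carrier G))) *\<^sub>C (\<Sum>g\<in>carrier G. f g)"

lemma card_carrier: "of_nat (card (carrier G)) \<noteq> (0 :: complex)"
  using finite_carrier one_closed by auto

lemma avg_const: "avg (\<lambda>g. x) = x"
proof -
  have "(\<Sum>g\<in>carrier G. x) = of_nat (card (carrier G)) *\<^sub>C x"
    by (simp add: complex_vector.sum_constant_scale)
  then show ?thesis using card_carrier by (simp add: avg_def scaleC_scaleC scaleC_one)
qed

lemma avg_cong: "(\<And>g. g \<in> carrier G \<Longrightarrow> f g = h g) \<Longrightarrow> avg f = avg h"
  by (simp add: avg_def cong: sum.cong)

lemma avg_linear: "clinear T \<Longrightarrow> T (avg f) = avg (\<lambda>g. T (f g))"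
  by (simp add: avg_def clinearD clinear_sum)

lemma avg_diff: "avg (\<lambda>g. f g - h g) = avg f - avg h"
  by (simp add: avg_def sum_subtractf complex_vector.scale_right_diff_distrib)

lemma avg_add: "avg (\<lambda>g. f g + h g) = avg f + avg h"
  by (simp add: avg_def sum.distrib scaleC_add_right)

lemma avg_scale: "avg (\<lambda>g. c *\<^sub>C f g) = c *\<^sub>C avg f"
  by (simp add: avg_def complex_vector.scale_sum_right scaleC_scaleC mult.commute)

lemma avg_mem: "complex_vector.subspace M \<Longrightarrow> (\<And>g. g \<in> carrier G \<Longrightarrow> f g \<in> M) \<Longrightarrow> avg f \<in> M"
  unfolding avg_def by (intro complex_vector.subspace_scale complex_vector.subspace_sum) auto

lemma avg_fun: "avg f = (\<lambda>x. avg (\<lambda>g. f g x))"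
  by (simp add: avg_def sum_fun scaleC_fun_def)

lemma avg_translate: "h \<in> carrier G \<Longrightarrow> avg (\<lambda>g. f (h \<otimes> g)) = avg f"
  unfolding avg_def
  by (rule arg_cong[where f = "scaleC _"], rule sum.reindex_bij_betw,
      rule bij_betw_byWitness[where f' = "\<lambda>g. inv h \<otimes> g"]) (auto simp: m_assoc[symmetric])

lemma avg_sum: "avg (\<lambda>g. \<Sum>i\<in>I. f i g) = (\<Sum>i\<in>I. avg (f i))"
  unfolding avg_def by (subst sum.swap) (simp add: complex_vector.scale_sum_right)

end

section \<open>Averaging cochains over the group algebra\<close>

lemma telescope_sum:
  fixes a :: "'c::ab_group_add"
  assumes "a = e - m + S - T" "e = F - (F' - B)" "m = F - M" "h = F' - M - (B - T)"
  shows "a + h = S"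
  using assms by simp

lemma telescope_pair:
  fixes a :: "'c::ab_group_add"
  assumes "a = F - X - P" "b = X - Q" "P + Q = R"
  shows "a + b = F - R"
  using assms by (auto simp: algebra_simps)

context skew_algebra
begin

text \<open>
  The average over \<open>g\<^sub>1, \<dots>, g\<^sub>p\<close> of
  \<open>f(g\<^sup>-\<^sup>1 x\<^sub>1 g\<^sub>1, g\<^sub>1\<^sup>-\<^sup>1 x\<^sub>2 g\<^sub>2, \<dots>, g\<^bsub>p-1\<^esub>\<^sup>-\<^sup>1 x\<^sub>p g\<^sub>p) g\<^sub>p\<^sup>-\<^sup>1\<close>.
\<close>

fun sandwich :: "'g \<Rightarrow> (('g \<Rightarrow> 'v sym) list \<Rightarrow> 'g \<Rightarrow> 'v sym) \<Rightarrow> ('g \<Rightarrow> 'v sym) list \<Rightarrow> 'g \<Rightarrow> 'v sym" where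
  "sandwich g f [] = f [] \<odot> grp (inv g)"
| "sandwich g f (x # xs) = avg (\<lambda>k. sandwich k (\<lambda>l. f ((grp (inv g) \<odot> x \<odot> grp k) # l)) xs)"

text \<open>
  The alternating sum over \<open>i\<close> of the averages of
  \<open>f(g\<^sup>-\<^sup>1 x\<^sub>1 g\<^sub>1, \<dots>, g\<^bsub>i-1\<^esub>\<^sup>-\<^sup>1 x\<^sub>i g\<^sub>i, g\<^sub>i\<^sup>-\<^sup>1, x\<^bsub>i+1\<^esub>, \<dots>, x\<^sub>p)\<close>: the entries are sandwiched up to
  position \<open>i\<close>, where a group element is inserted.
\<close>

fun homotopy :: "'g \<Rightarrow> (('g \<Rightarrow> 'v sym) list \<Rightarrow> 'm::complex_vector) \<Rightarrow> ('g \<Rightarrow> 'v sym) list \<Rightarrow> 'm" where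
  "homotopy g f [] = f [grp (inv g)]"
| "homotopy g f (x # xs) =
    f (grp (inv g) # x # xs) - avg (\<lambda>k. homotopy k (\<lambda>l. f ((grp (inv g) \<odot> x \<odot> grp k) # l)) xs)"

definition relative_part :: "(('g \<Rightarrow> 'v sym) list \<Rightarrow> 'g \<Rightarrow> 'v sym) \<Rightarrow> ('g \<Rightarrow> 'v sym) list \<Rightarrow> 'g \<Rightarrow> 'v sym" where
  "relative_part f xs = avg (\<lambda>g. grp g \<odot> sandwich g f xs)"

definition full_homotopy :: "(('g \<Rightarrow> 'v sym) list \<Rightarrow> 'g \<Rightarrow> 'v sym) \<Rightarrow> ('g \<Rightarrow> 'v sym) list \<Rightarrow> 'g \<Rightarrow> 'v sym" where
  "full_homotopy f xs = avg (\<lambda>g. grp g \<odot> homotopy g f xs)"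

abbreviation skd where "skd \<equiv> bar_d (skew_mult G \<rho>) (skew_mult G \<rho>) (skew_mult G \<rho>)"
abbreviation skb where "skb \<equiv> bdry (skew_mult G \<rho>) (skew_mult G \<rho>)"

lemma homotopy_cong:
  assumes "\<And>l. length l = Suc (length xs) \<Longrightarrow> set l \<subseteq> A \<Longrightarrow> F l = F' l" "g \<in> carrier G" "set xs \<subseteq> A"
  shows "homotopy g F xs = homotopy g F' xs"
  using assms
proof (induction xs arbitrary: g F F')
  case (Cons x xs)
  have "homotopy k (\<lambda>l. F ((grp (inv g) \<odot> x \<odot> grp k) # l)) xs =
      homotopy k (\<lambda>l. F' ((grp (inv g) \<odot> x \<odot> grp k) # l)) xs" if "k \<in> carrier G" for k
    by (rule Cons.IH) (use Cons.prems that in auto)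
  then show ?case using Cons.prems by (auto intro!: avg_cong arg_cong2[where f = minus])
qed simp

lemma homotopy_diff: "homotopy g (\<lambda>l. F l - F' l) xs = homotopy g F xs - homotopy g F' xs"
  by (induction xs arbitrary: g F F') (simp_all add: avg_diff)

lemma homotopy_add: "homotopy g (\<lambda>l. F l + F' l) xs = homotopy g F xs + homotopy g F' xs"
  by (induction xs arbitrary: g F F') (simp_all add: avg_add)

lemma homotopy_scale: "homotopy g (\<lambda>l. c *\<^sub>C F l) xs = c *\<^sub>C homotopy g F xs"
  by (induction xs arbitrary: g F) (simp_all add: avg_scale complex_vector.scale_right_diff_distrib)

lemma homotopy_zero: "homotopy g (\<lambda>l. 0) xs = 0"
  using homotopy_diff[of g "\<lambda>l. 0" "\<lambda>l. 0" xs] by simp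

lemma bdry_avg: "skb (\<lambda>l. avg (\<lambda>k. F k l)) xs = avg (\<lambda>k. skb (F k) xs)"
  unfolding avg_def by (simp add: bdry_scale[OF clinear_smul_left] bdry_sum[OF clinear_smul_left])

lemma homotopy_mem:
  assumes "\<And>l. set l \<subseteq> A \<Longrightarrow> F l \<in> A" "g \<in> carrier G" "set xs \<subseteq> A"
  shows "homotopy g F xs \<in> A"
  using assms
proof (induction xs arbitrary: g F)
  case (Cons x xs)
  have "homotopy k (\<lambda>l. F ((grp (inv g) \<odot> x \<odot> grp k) # l)) xs \<in> A" if "k \<in> carrier G" for k
    by (rule Cons.IH) (use Cons.prems that in auto)
  moreover have "F (grp (inv g) # x # xs) \<in> A"
    using Cons.prems by simp
  ultimately show ?case
    unfolding homotopy.simps by (intro complex_vector.subspace_diff[OF subspace_A] avg_mem subspace_A)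
qed simp

text \<open>
  Multiplying the inserted element by its left or by its right neighbour gives the same result for
  adjacent positions of the insertion, so these terms cancel.  What survives is the term in which the
  element stands at the end and acts from the right.
\<close>

lemma homotopy_bdry:
  assumes "\<And>l. set l \<subseteq> A \<Longrightarrow> f l \<in> A" "g \<in> carrier G" "set xs \<subseteq> A"
  shows "homotopy g (skb f) xs + skb (homotopy g f) xs = sandwich g f xs"
  using assms
proof (induction xs arbitrary: g f)
  case Nil
  then show ?case by simp
next
  case (Cons x xs)
  note f = Cons.prems(1) and g = Cons.prems(2)
  have x: "x \<in> A" and xs: "set xs \<subseteq> A" using Cons.prems(3) by auto
  let ?e = "grp (inv g)"
  let ?y = "\<lambda>k. ?e \<odot> x \<odot> grp k"
  \<comment> \<open>the term of \<^const>\<open>bdry\<close> that multiplies the first two arguments, in a list with first entry \<open>y\<close>\<close>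
  define merge where "merge = (\<lambda>y l. case l of [] \<Rightarrow> 0 | z # l' \<Rightarrow> f (y \<odot> z # l'))"
  have IH: "homotopy k (skb (\<lambda>l. f (?y k # l))) xs =
      sandwich k (\<lambda>l. f (?y k # l)) xs - skb (homotopy k (\<lambda>l. f (?y k # l))) xs" if "k \<in> carrier G" for k
    unfolding eq_diff_eq by (rule Cons.IH) (use f that xs in auto)
  have inner: "homotopy k (\<lambda>l. skb f (?y k # l)) xs =
      homotopy k (merge (?y k)) xs - (sandwich k (\<lambda>l. f (?y k # l)) xs - skb (homotopy k (\<lambda>l. f (?y k # l))) xs)"
    if k: "k \<in> carrier G" for k
  proof -
    have "homotopy k (\<lambda>l. skb f (?y k # l)) xs = homotopy k (\<lambda>l. merge (?y k) l - skb (\<lambda>l. f (?y k # l)) l) xs"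
    proof (rule homotopy_cong[OF _ k xs])
      fix l :: "('g \<Rightarrow> 'v sym) list" assume "length l = Suc (length xs)"
      then show "skb f (?y k # l) = merge (?y k) l - skb (\<lambda>l. f (?y k # l)) l"
        by (cases l) (simp_all add: merge_def)
    qed
    then show ?thesis by (simp only: homotopy_diff IH[OF k])
  qed
  have hom: "homotopy g (skb f) (x # xs) = skb f (?e # x # xs) - avg (\<lambda>k. homotopy k (merge (?y k)) xs)
      + avg (\<lambda>k. sandwich k (\<lambda>l. f (?y k # l)) xs) - avg (\<lambda>k. skb (homotopy k (\<lambda>l. f (?y k # l))) xs)"
    by (simp add: inner avg_diff cong: avg_cong)
  have unit: "?y k \<odot> grp (inv k) = ?e \<odot> x" if "k \<in> carrier G" for k
    using that by (simp add: grp_cancel)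
  show ?case
  proof (cases xs)
    case Nil
    have "avg (\<lambda>k. homotopy k (merge (?y k)) []) = f [?e \<odot> x]"
      by (simp add: merge_def unit avg_const cong: avg_cong)
    then show ?thesis unfolding hom by (simp add: Nil avg_const)
  next
    case (Cons z zs)
    have z: "z \<in> A" and zs: "set zs \<subseteq> A" using xs Cons by auto
    have mrg: "homotopy k (merge (?y k)) (z # zs) =
        f (?e \<odot> x # z # zs) - avg (\<lambda>k'. homotopy k' (\<lambda>l. f ((?e \<odot> (x \<odot> z) \<odot> grp k') # l)) zs)"
      if k: "k \<in> carrier G" for k
    proof -
      have "?y k \<odot> (grp (inv k) \<odot> z \<odot> grp k') = ?e \<odot> (x \<odot> z) \<odot> grp k'" if k': "k' \<in> carrier G" for k'
      proof -
        have "?y k \<odot> (grp (inv k) \<odot> z \<odot> grp k') = ?y k \<odot> grp (inv k) \<odot> z \<odot> grp k'"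
          using k k' z by (simp add: smul_assoc)
        also have "\<dots> = ?e \<odot> (x \<odot> z) \<odot> grp k'"
          unfolding unit[OF k] using g x z by (simp add: smul_assoc)
        finally show ?thesis .
      qed
      then show ?thesis
        using k by (simp add: merge_def unit cong: avg_cong)
    qed
    let ?M = "avg (\<lambda>k'. homotopy k' (\<lambda>l. f ((?e \<odot> (x \<odot> z) \<odot> grp k') # l)) zs)"
    let ?T = "avg (\<lambda>k. skb (homotopy k (\<lambda>l. f (?y k # l))) xs)"
    let ?B = "skb (\<lambda>l. f (?e # x # l)) xs"
    have 1: "avg (\<lambda>k. homotopy k (merge (?y k)) xs) = f (?e \<odot> x # z # zs) - ?M"
      unfolding Cons by (subst avg_cong[OF mrg]) (simp_all only: avg_const)
    have 2: "skb (homotopy g f) (x # xs) = f (?e # x \<odot> z # zs) - ?M - (?B - ?T)"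
      unfolding Cons bdry.simps homotopy.simps bdry_diff[OF clinear_smul_left] bdry_avg ..
    have 3: "skb f (?e # x # xs) = f (?e \<odot> x # z # zs) - (f (?e # x \<odot> z # zs) - ?B)"
      unfolding Cons bdry.simps ..
    show ?thesis
      by (rule telescope_sum[OF hom 3 1 2, folded sandwich.simps(2)])
  qed
qed

text \<open>
  To the previous identity the left action adds the terms in which it meets an element inserted at the
  front, and these give back \<open>f\<close>.
\<close>

lemma full_homotopy_formula:
  assumes f: "\<And>l. set l \<subseteq> A \<Longrightarrow> f l \<in> A" and x: "x \<in> A" and xs: "set xs \<subseteq> A"
  shows "full_homotopy (skd f) (x # xs) + skd (full_homotopy f) (x # xs) = f (x # xs) - relative_part f (x # xs)"
proof -
  have left: "homotopy k (\<lambda>l. a \<odot> F l) xs = a \<odot> homotopy k F xs" for a k F xs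
    by (induction xs arbitrary: k F) (simp_all add: smul_right avg_linear[OF clinear_smul_right])
  have skd_split: "homotopy g (skd f) (x # xs) =
      grp (inv g) \<odot> f (x # xs) - avg (\<lambda>k. (grp (inv g) \<odot> x \<odot> grp k) \<odot> homotopy k f xs) - homotopy g (skb f) (x # xs)" for g
    unfolding bar_d_def by (simp add: homotopy_diff left avg_diff)
  have hmem: "homotopy k f xs \<in> A" if "k \<in> carrier G" for k
    by (rule homotopy_mem[OF f that xs])
  have smem: "sandwich k F xs \<in> A" for k F xs
    by (induction xs arbitrary: k F) (auto intro!: avg_mem subspace_A simp: avg_def complex_vector.subspace_scale[OF subspace_A] complex_vector.subspace_sum[OF subspace_A])
  have *: "grp g \<odot> homotopy g (skd f) (x # xs) =
      f (x # xs) - x \<odot> full_homotopy f xs - grp g \<odot> homotopy g (skb f) (x # xs)" if g: "g \<in> carrier G" for g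
  proof -
    have "grp g \<odot> ((grp (inv g) \<odot> x \<odot> grp k) \<odot> homotopy k f xs) = x \<odot> (grp k \<odot> homotopy k f xs)"
      if k: "k \<in> carrier G" for k
      using g k x hmem[OF k] by (simp add: smul_assoc grp_cancel)
    then have "grp g \<odot> avg (\<lambda>k. (grp (inv g) \<odot> x \<odot> grp k) \<odot> homotopy k f xs) = x \<odot> full_homotopy f xs"
      by (simp add: full_homotopy_def avg_linear[OF clinear_smul_right] cong: avg_cong)
    then show ?thesis
      unfolding skd_split using f[of "x # xs"] x xs g by (simp add: smul_right grp_cancel)
  qed
  have "full_homotopy (skd f) (x # xs) =
      f (x # xs) - x \<odot> full_homotopy f xs - avg (\<lambda>g. grp g \<odot> homotopy g (skb f) (x # xs))"
    unfolding full_homotopy_def[of "skd f"] by (subst avg_cong[OF *]) (simp_all add: avg_diff avg_const)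
  moreover have "skd (full_homotopy f) (x # xs) = x \<odot> full_homotopy f xs - avg (\<lambda>g. grp g \<odot> skb (homotopy g f) (x # xs))"
  proof -
    have "skb (\<lambda>l. grp g \<odot> F l) ys = grp g \<odot> skb F ys" if "set ys \<subseteq> A" "\<And>l. set l \<subseteq> A \<Longrightarrow> F l \<in> A" "g \<in> carrier G" for g F ys
      using bdry_transport[where A = A and t = "\<lambda>x. x" and T = "\<lambda>m. grp g \<odot> m" and f = F and f' = "\<lambda>l. grp g \<odot> F l" and xs = ys
          and mul = "skew_mult G \<rho>" and mul' = "skew_mult G \<rho>" and ra = "skew_mult G \<rho>" and ra' = "skew_mult G \<rho>"] that
      by (simp add: smul_right smul_assoc subset_iff)
    then have "avg (\<lambda>g. skb (\<lambda>l. grp g \<odot> homotopy g f l) (x # xs)) = avg (\<lambda>g. grp g \<odot> skb (homotopy g f) (x # xs))"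
      using x xs homotopy_mem[OF f] by (intro avg_cong) simp
    moreover have "full_homotopy f = (\<lambda>l. avg (\<lambda>g. grp g \<odot> homotopy g f l))"
      by (rule ext, rule full_homotopy_def)
    ultimately show ?thesis by (simp only: bar_d_def bdry_avg list.sel)
  qed
  moreover have "avg (\<lambda>g. grp g \<odot> homotopy g (skb f) (x # xs)) + avg (\<lambda>g. grp g \<odot> skb (homotopy g f) (x # xs)) =
      relative_part f (x # xs)"
    unfolding relative_part_def avg_add[symmetric] smul_right(1)[symmetric]
    using x xs by (intro avg_cong arg_cong2[where f = "skew_mult G \<rho>"] refl homotopy_bdry f) auto
  ultimately show ?thesis
    by (rule telescope_pair)
qed

end

lemma bdry_cong:
  assumes "\<And>l. length l = p \<Longrightarrow> set l \<subseteq> A \<Longrightarrow> f l = f' l" "\<And>x y. x \<in> A \<Longrightarrow> y \<in> A \<Longrightarrow> mul x y \<in> A"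
    "set xs \<subseteq> A" "length xs = Suc p"
  shows "bdry mul ra f xs = bdry mul ra f' xs"
  using assms(1,3,4)
proof (induction xs arbitrary: f f' p rule: induct_list012)
  case (3 x y zs)
  then obtain q where p: "p = Suc q" "length zs = q" by auto
  have "bdry mul ra (\<lambda>l. f (x # l)) (y # zs) = bdry mul ra (\<lambda>l. f' (x # l)) (y # zs)"
  proof (rule "3.IH"(2))
    show "length (y # zs) = Suc q" "set (y # zs) \<subseteq> A" using p "3.prems" by auto
    show "f (x # l) = f' (x # l)" if "length l = q" "set l \<subseteq> A" for l
      using "3.prems" p that by simp
  qed
  moreover have "f (mul x y # zs) = f' (mul x y # zs)"
    using "3.prems" p assms(2) by simp
  ultimately show ?case by simp
qed auto

lemma bar_d_cong:
  assumes "\<And>l. length l = p \<Longrightarrow> set l \<subseteq> A \<Longrightarrow> f l = f' l" "\<And>x y. x \<in> A \<Longrightarrow> y \<in> A \<Longrightarrow> mul x y \<in> A"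
    "set xs \<subseteq> A" "length xs = Suc p"
  shows "bar_d mul la ra f xs = bar_d mul la ra f' xs"
proof -
  obtain x l where "xs = x # l" "length l = p" using assms(4) by (cases xs) auto
  then show ?thesis
    using bdry_cong[of p A f f' mul xs ra] assms by (simp add: bar_d_def)
qed

context skew_algebra
begin

section \<open>Extending equivariant cochains to the skew group algebra\<close>

text \<open>
  The cochains that are built by recursion do not vanish on lists outside their domain; \<open>cut\<close> makes
  them do so, and \<open>multilinear_on\<close> is multilinearity without that condition.
\<close>

fun multilinear_on :: "nat \<Rightarrow> (('g \<Rightarrow> 'v sym) list \<Rightarrow> 'g \<Rightarrow> 'v sym) \<Rightarrow> bool" where
  "multilinear_on 0 f \<longleftrightarrow> f [] \<in> A"
| "multilinear_on (Suc p) f \<longleftrightarrow> (\<forall>x\<in>A. multilinear_on p (\<lambda>l. f (x # l))) \<and>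
    (\<forall>x\<in>A. \<forall>y\<in>A. \<forall>l. length l = p \<longrightarrow> set l \<subseteq> A \<longrightarrow> f ((x + y) # l) = f (x # l) + f (y # l)) \<and>
    (\<forall>a. \<forall>x\<in>A. \<forall>l. length l = p \<longrightarrow> set l \<subseteq> A \<longrightarrow> f ((a *\<^sub>C x) # l) = a *\<^sub>C f (x # l))"

definition cut :: "nat \<Rightarrow> (('g \<Rightarrow> 'v sym) list \<Rightarrow> 'g \<Rightarrow> 'v sym) \<Rightarrow> ('g \<Rightarrow> 'v sym) list \<Rightarrow> 'g \<Rightarrow> 'v sym" where
  "cut p f xs = (if length xs = p \<and> set xs \<subseteq> A then f xs else 0)"

lemma cut_mem: "multilinear_on p f \<Longrightarrow> cut p f \<in> multilinear_maps A A p"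
proof (induction p arbitrary: f)
  case 0
  then show ?case by (auto simp: multilinear_maps_0 cut_def)
next
  case (Suc p)
  have tail: "(\<lambda>l. cut (Suc p) f (x # l)) \<in> multilinear_maps A A p" if x: "x \<in> A" for x
  proof -
    have "(\<lambda>l. cut (Suc p) f (x # l)) = cut p (\<lambda>l. f (x # l))"
      by (rule ext) (simp add: cut_def x)
    then show ?thesis using Suc.IH Suc.prems x by (simp only: multilinear_on.simps)
  qed
  have closed: "x + y \<in> A" "a *\<^sub>C x \<in> A" if "x \<in> A" "y \<in> A" for x y a
    using that complex_vector.subspace_add[OF subspace_A] complex_vector.subspace_scale[OF subspace_A] by auto
  have add: "f ((x + y) # l) = f (x # l) + f (y # l)" and scale: "f ((a *\<^sub>C x) # l) = a *\<^sub>C f (x # l)"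
    if "x \<in> A" "y \<in> A" "length l = p" "set l \<subseteq> A" for x y l a
    using Suc.prems that by (simp_all only: multilinear_on.simps)
  show ?case
    unfolding multilinear_maps_Suc[OF subspace_A]
  proof (intro conjI ballI allI impI tail)
    fix x y l a assume "x \<in> A" "y \<in> A"
    then show "cut (Suc p) f ((x + y) # l) = cut (Suc p) f (x # l) + cut (Suc p) f (y # l)"
      by (cases "length l = p \<and> set l \<subseteq> A") (auto simp: cut_def closed add)
  next
    fix x l a assume "x \<in> A"
    then show "cut (Suc p) f ((a *\<^sub>C x) # l) = a *\<^sub>C cut (Suc p) f (x # l)"
      by (cases "length l = p \<and> set l \<subseteq> A") (auto simp: cut_def closed scale)
  qed (simp_all add: cut_def)
qed

lemma multilinear_on_of: "f \<in> multilinear_maps A A p \<Longrightarrow> multilinear_on p f"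
  by (induction p arbitrary: f) (simp_all add: multilinear_maps_0 multilinear_maps_Suc[OF subspace_A])

lemma multilinear_on_diff: "multilinear_on p f \<Longrightarrow> multilinear_on p h \<Longrightarrow> multilinear_on p (\<lambda>l. f l - h l)"
proof (induction p arbitrary: f h)
  case 0
  then show ?case unfolding multilinear_on.simps by (rule complex_vector.subspace_diff[OF subspace_A])
next
  case (Suc p)
  show ?case
    unfolding multilinear_on.simps
  proof (intro conjI ballI allI impI)
    show "multilinear_on p (\<lambda>l. f (x # l) - h (x # l))" if "x \<in> A" for x
      by (rule Suc.IH) (use Suc.prems that in simp_all)
    show "f ((x + y) # l) - h ((x + y) # l) = f (x # l) - h (x # l) + (f (y # l) - h (y # l))"
      if "x \<in> A" "y \<in> A" "length l = p" "set l \<subseteq> A" for x y l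
      using Suc.prems that by (simp add: algebra_simps)
    show "f ((a *\<^sub>C x) # l) - h ((a *\<^sub>C x) # l) = a *\<^sub>C (f (x # l) - h (x # l))"
      if "x \<in> A" "length l = p" "set l \<subseteq> A" for a x l
      using Suc.prems that by (simp add: complex_vector.scale_right_diff_distrib)
  qed
qed

lemma multilinear_on_comp:
  "clinear T \<Longrightarrow> (\<And>x. x \<in> A \<Longrightarrow> T x \<in> A) \<Longrightarrow> multilinear_on p f \<Longrightarrow> multilinear_on p (\<lambda>l. T (f l))"
  by (induction p arbitrary: f) (simp_all add: clinearD)

lemma multilinear_on_sum:
  "(\<And>i. i \<in> I \<Longrightarrow> multilinear_on p (f i)) \<Longrightarrow> multilinear_on p (\<lambda>l. \<Sum>i\<in>I. f i l)"
proof (induction p arbitrary: f)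
  case 0
  then show ?case unfolding multilinear_on.simps by (intro complex_vector.subspace_sum[OF subspace_A])
next
  case (Suc p)
  then show ?case
    by (simp only: multilinear_on.simps) (simp add: sum.distrib complex_vector.scale_sum_right cong: sum.cong)
qed

lemma multilinear_on_avg:
  assumes "\<And>g. g \<in> carrier G \<Longrightarrow> multilinear_on p (f g)"
  shows "multilinear_on p (\<lambda>l. avg (\<lambda>g. f g l))"
  unfolding avg_def
  by (rule multilinear_on_comp[OF _ _ multilinear_on_sum[OF assms]])
    (auto simp: clinear_iff scaleC_add_right scaleC_scaleC mult.commute complex_vector.subspace_scale[OF subspace_A])

lemma homotopy_multilinear:
  assumes "multilinear_on (Suc p) f" "g \<in> carrier G"
  shows "multilinear_on p (homotopy g f)"
  using assms
proof (induction p arbitrary: f g)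
  case 0
  then show ?case by simp
next
  case (Suc p)
  let ?e = "grp (inv g)"
  have e: "?e \<in> A" using Suc.prems by simp
  have f1: "multilinear_on (Suc p) (\<lambda>l. f (x # l))" if "x \<in> A" for x
    using Suc.prems(1) that by (subst (asm) multilinear_on.simps) blast
  have f_add: "f ((x + y) # l) = f (x # l) + f (y # l)" and f_scale: "f ((a *\<^sub>C x) # l) = a *\<^sub>C f (x # l)"
    if "x \<in> A" "y \<in> A" "length l = Suc p" "set l \<subseteq> A" for x y l a
    using Suc.prems(1) that by (subst (asm) (1) multilinear_on.simps, blast)+
  have "multilinear_on p (\<lambda>l. homotopy g f (x # l))" if x: "x \<in> A" for x
    unfolding homotopy.simps
  proof (intro multilinear_on_diff multilinear_on_avg Suc.IH f1)
    show "multilinear_on p (\<lambda>l. f (?e # x # l))"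
      using f1[OF e] x by simp
  qed simp_all
  moreover have "homotopy g f ((x + y) # l) = homotopy g f (x # l) + homotopy g f (y # l)"
    if x: "x \<in> A" "y \<in> A" and l: "length l = p" "set l \<subseteq> A" for x y l
  proof -
    have "homotopy k (\<lambda>m. f ((?e \<odot> (x + y) \<odot> grp k) # m)) l =
        homotopy k (\<lambda>m. f ((?e \<odot> x \<odot> grp k) # m)) l + homotopy k (\<lambda>m. f ((?e \<odot> y \<odot> grp k) # m)) l"
      if "k \<in> carrier G" for k
      unfolding homotopy_add[symmetric] smul_left smul_right
      by (rule homotopy_cong[OF _ that l(2)]) (rule f_add, use l in auto)
    moreover have "f (?e # (x + y) # l) = f (?e # x # l) + f (?e # y # l)"
      using f1[OF e] x l by simp
    ultimately show ?thesis
      by (simp add: avg_add cong: avg_cong)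
  qed
  moreover have "homotopy g f ((a *\<^sub>C x) # l) = a *\<^sub>C homotopy g f (x # l)"
    if x: "x \<in> A" and l: "length l = p" "set l \<subseteq> A" for x l a
  proof -
    have "homotopy k (\<lambda>m. f ((?e \<odot> (a *\<^sub>C x) \<odot> grp k) # m)) l = a *\<^sub>C homotopy k (\<lambda>m. f ((?e \<odot> x \<odot> grp k) # m)) l"
      if "k \<in> carrier G" for k
      unfolding homotopy_scale[symmetric] smul_left smul_right
      by (rule homotopy_cong[OF _ that l(2)]) (rule f_scale[OF _ e], use l in auto)
    moreover have "f (?e # (a *\<^sub>C x) # l) = a *\<^sub>C f (?e # x # l)"
      using f1[OF e] x l by simp
    ultimately show ?thesis
      by (simp add: avg_scale complex_vector.scale_right_diff_distrib cong: avg_cong)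
  qed
  ultimately show ?case by simp
qed

lemma full_homotopy_multilinear: "multilinear_on (Suc p) f \<Longrightarrow> multilinear_on p (full_homotopy f)"
  unfolding full_homotopy_def[abs_def]
  by (intro multilinear_on_avg multilinear_on_comp[OF clinear_smul_right] homotopy_multilinear) auto

text \<open>
  The value at \<open>s\<^sub>1 g\<^sub>1, \<dots>, s\<^sub>p g\<^sub>p\<close> is \<open>f(s\<^sub>1, g\<^sub>1 s\<^sub>2, g\<^sub>1 g\<^sub>2 s\<^sub>3, \<dots>) g\<^sub>1 \<dots> g\<^sub>p\<close>: all group elements are
  moved to the right, and \<open>h\<close> is the product of those already passed.
\<close>

fun extend :: "'g \<Rightarrow> ('v sym list \<Rightarrow> 'g \<Rightarrow> 'v sym) \<Rightarrow> ('g \<Rightarrow> 'v sym) list \<Rightarrow> 'g \<Rightarrow> 'v sym" where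
  "extend h f [] = f [] \<odot> grp h"
| "extend h f (x # xs) = (\<Sum>g\<in>carrier G. extend (h \<otimes> g) (\<lambda>l. f (gact h (x g) # l)) xs)"

lemma extend_add: "extend h (\<lambda>l. f l + f' l) xs = extend h f xs + extend h f' xs"
proof (induction xs arbitrary: h f f')
  case Nil
  show ?case unfolding extend.simps by (rule smul_left)
next
  case (Cons x xs)
  show ?case unfolding extend.simps Cons.IH sum.distrib ..
qed

lemma extend_linear_image:
  assumes "clinear T" "\<And>l h. T (f l \<odot> grp h) = T (f l) \<odot> grp h"
  shows "extend h (\<lambda>l. T (f l)) xs = T (extend h f xs)"
  using assms(2)
proof (induction xs arbitrary: h f)
  case (Cons x xs)
  show ?case unfolding extend.simps clinear_sum[OF assms(1)]
    by (intro sum.cong refl Cons.IH Cons.prems)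
qed simp

lemma extend_scale: "extend h (\<lambda>l. c *\<^sub>C f l) xs = c *\<^sub>C extend h f xs"
  by (rule extend_linear_image[where T = "\<lambda>x. c *\<^sub>C x"])
    (simp_all only: smul_left clinear_iff scaleC_add_right scaleC_scaleC mult.commute[of c] simp_thms)

lemma extend_zero: "extend h (\<lambda>l. 0) xs = 0"
  using extend_scale[of h 0 "\<lambda>l. 0" xs] by (simp only: complex_vector.scale_zero_left)

lemma extend_sum: "extend h (\<lambda>l. \<Sum>i\<in>I. f i l) xs = (\<Sum>i\<in>I. extend h (f i) xs)"
proof (induction I rule: infinite_finite_induct)
  case (insert i I)
  have "extend h (\<lambda>l. \<Sum>i\<in>insert i I. f i l) xs = extend h (\<lambda>l. f i l + (\<Sum>i\<in>I. f i l)) xs"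
    by (simp only: sum.insert[OF insert.hyps])
  also have "\<dots> = extend h (f i) xs + extend h (\<lambda>l. \<Sum>i\<in>I. f i l) xs" by (rule extend_add)
  finally show ?case by (simp only: sum.insert[OF insert.hyps] insert.IH)
qed (simp_all only: sum.infinite sum.empty extend_zero not_False_eq_True)

lemma extend_avg: "extend h (\<lambda>l. avg (\<lambda>k. f k l)) xs = avg (\<lambda>k. extend h (f k) xs)"
  unfolding avg_def extend_scale extend_sum ..

lemma extend_diff: "extend h (\<lambda>l. f l - f' l) xs = extend h f xs - extend h f' xs"
  using extend_add[of h "\<lambda>l. f l - f' l" f' xs] by (simp only: diff_add_cancel eq_diff_eq)

lemma extend_multilinear:
  assumes "f \<in> multilinear_maps UNIV A p" "h \<in> carrier G"
  shows "multilinear_on p (extend h f)"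
  using assms
proof (induction p arbitrary: f h)
  case 0
  then show ?case by simp
next
  case (Suc p)
  have f: "f ((x + y) # l) = f (x # l) + f (y # l)" "f ((a *\<^sub>C x) # l) = a *\<^sub>C f (x # l)"
    "(\<lambda>l. f (x # l)) \<in> multilinear_maps UNIV A p" for x y a l
    using Suc.prems(1) by (simp_all add: multilinear_maps_Suc)
  have app: "(x + y) g = x g + y g" "(a *\<^sub>C x) g = a *\<^sub>C x g" for x y :: "'g \<Rightarrow> 'v sym" and g a
    by (simp_all add: scaleC_fun_def)
  show ?case
    unfolding multilinear_on.simps
    unfolding extend.simps app gact_simps(1)[OF Suc.prems(2)] gact_simps(5)[OF Suc.prems(2)] f(1,2)
      extend_add extend_scale sum.distrib complex_vector.scale_sum_right
    using Suc.prems(2) by (intro conjI ballI allI impI refl multilinear_on_sum Suc.IH f(3) m_closed)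
qed

lemma smul_emb_apply: "F \<in> A \<Longrightarrow> (emb a \<odot> F) k = a * F k"
proof -
  assume F: "F \<in> A"
  have "(emb a \<odot> F) k = (\<Sum>h\<in>carrier G. if h = k then a * F k else 0)"
  proof -
    have "(emb a \<odot> F) k = (\<Sum>g\<in>carrier G. if g = \<one> then (\<Sum>h\<in>carrier G. if h = k then a * F k else 0) else 0)"
      unfolding smul_apply skew_emb_def skew_single_def
      by (intro sum.cong refl) (auto simp: gact_one intro!: sum.neutral sum.cong)
    then show ?thesis using finite_carrier by simp
  qed
  then show ?thesis using F finite_carrier by (auto simp: skew_carrier_def)
qed

abbreviation laS :: "'v sym \<Rightarrow> ('g \<Rightarrow> 'v sym) \<Rightarrow> 'g \<Rightarrow> 'v sym" where "laS a F \<equiv> emb a \<odot> F"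
abbreviation raS :: "('g \<Rightarrow> 'v sym) \<Rightarrow> 'v sym \<Rightarrow> 'g \<Rightarrow> 'v sym" where "raS F a \<equiv> F \<odot> emb a"

text \<open>
  Moving the group elements to the right turns \<open>(s\<^sub>1 g\<^sub>1)(s\<^sub>2 g\<^sub>2)\<close> into the product of \<open>s\<^sub>1\<close> and \<open>g\<^sub>1 s\<^sub>2\<close>
  followed by \<open>g\<^sub>1 g\<^sub>2\<close>, which is what \<^const>\<open>extend\<close> does to two neighbours anyway.
\<close>

lemma extend_bdry:
  assumes "f \<in> multilinear_maps UNIV A p" "h \<in> carrier G" "length xs = p" "set (x # xs) \<subseteq> A"
  shows "skb (extend h f) (x # xs) = extend h (bdry (*) raS f) (x # xs)"
  using assms
proof (induction p arbitrary: f h x xs)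
  case 0
  have f: "f [] \<in> A" and h: "h \<in> carrier G" and x: "x \<in> A" and xs: "xs = []"
    using 0 by (auto simp: multilinear_maps_0)
  have "(\<Sum>g\<in>carrier G. f [] \<odot> emb (gact h (x g)) \<odot> grp (h \<otimes> g)) = f [] \<odot> (grp h \<odot> (\<Sum>g\<in>carrier G. emb (x g) \<odot> grp g))"
    unfolding smul_right
    by (rule sum.cong) (simp_all add: f h smul_assoc grp_mult[symmetric] grp_emb flip: smul_assoc)
  then show ?case
    using f h x by (simp add: xs emb_decomposition smul_assoc)
next
  case (Suc p)
  then obtain y zs where xs: "xs = y # zs" "length zs = p" by (cases xs) auto
  have h: "h \<in> carrier G" and x: "x \<in> A" and y: "y \<in> A" and zs: "set zs \<subseteq> A" using Suc.prems xs by auto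
  have f: "f ((a + b) # l) = f (a # l) + f (b # l)" "(\<lambda>l. f (a # l)) \<in> multilinear_maps UNIV A p" for a b l
    using Suc.prems(1) by (simp_all add: multilinear_maps_Suc)
  have f0: "f (0 # l) = 0" for l
    using f(1)[of 0 0 l] by (simp only: add_0_left) (metis add_cancel_right_left)
  have f_sum: "f (sum a I # l) = (\<Sum>i\<in>I. f (a i # l))" for a :: "'g \<Rightarrow> _" and I l
  proof (induction I rule: infinite_finite_induct)
    case (insert i I)
    show ?case unfolding sum.insert[OF insert.hyps] f(1) insert.IH ..
  qed (simp_all only: sum.infinite sum.empty f0 not_False_eq_True)
  let ?P = "\<lambda>g g'. extend (h \<otimes> g \<otimes> g') (\<lambda>l. f ((gact h (x g) * gact (h \<otimes> g) (y g')) # l)) zs"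
  have IH: "skb (extend (h \<otimes> g) (\<lambda>l. f (gact h (x g) # l))) (y # zs) =
      extend (h \<otimes> g) (bdry (*) raS (\<lambda>l. f (gact h (x g) # l))) (y # zs)" if "g \<in> carrier G" for g
    by (rule Suc.IH[OF f(2)]) (use that h xs y zs in auto)
  have prod: "extend h f ((x \<odot> y) # zs) = (\<Sum>g\<in>carrier G. \<Sum>g'\<in>carrier G. ?P g g')"
  proof -
    have "extend (h \<otimes> k) (\<lambda>l. f (gact h ((x \<odot> y) k) # l)) zs =
      (\<Sum>g\<in>carrier G. \<Sum>g'\<in>carrier G. if k = g \<otimes> g' then ?P g g' else 0)" if k: "k \<in> carrier G" for k
    proof -
      have "extend (h \<otimes> k) (\<lambda>l. f (gact h ((x \<odot> y) k) # l)) zs =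
        (\<Sum>g\<in>carrier G. \<Sum>g'\<in>carrier G. extend (h \<otimes> k) (\<lambda>l. f (gact h (if k = g \<otimes> g' then x g * gact g (y g') else 0) # l)) zs)"
        unfolding smul_apply gact_sum[OF h] f_sum extend_sum ..
      also have "\<dots> = (\<Sum>g\<in>carrier G. \<Sum>g'\<in>carrier G. if k = g \<otimes> g' then ?P g g' else 0)"
        using h by (intro sum.cong refl) (auto simp: gact_simps gact_mult m_assoc f0 extend_zero)
      finally show ?thesis .
    qed
    then have "extend h f ((x \<odot> y) # zs) =
      (\<Sum>k\<in>carrier G. \<Sum>g\<in>carrier G. \<Sum>g'\<in>carrier G. if k = g \<otimes> g' then ?P g g' else 0)"
      by (simp cong: sum.cong)
    also have "\<dots> = (\<Sum>g\<in>carrier G. \<Sum>g'\<in>carrier G. \<Sum>k\<in>carrier G. if k = g \<otimes> g' then ?P g g' else 0)"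
      by (subst sum.swap, rule sum.cong[OF refl], rule sum.swap)
    also have "\<dots> = (\<Sum>g\<in>carrier G. \<Sum>g'\<in>carrier G. ?P g g')"
      using finite_carrier by (intro sum.cong refl) simp
    finally show ?thesis .
  qed
  have "skb (extend h f) (x # xs) = (\<Sum>g\<in>carrier G. \<Sum>g'\<in>carrier G. ?P g g') -
      (\<Sum>g\<in>carrier G. extend (h \<otimes> g) (bdry (*) raS (\<lambda>l. f (gact h (x g) # l))) (y # zs))"
    unfolding xs bdry.simps prod extend.simps(2)[of h f x] bdry_sum[OF clinear_smul_left] by (simp only: IH cong: sum.cong)
  also have "\<dots> = extend h (bdry (*) raS f) (x # xs)"
    unfolding xs extend.simps bdry.simps extend_diff sum_subtractf ..
  finally show ?case .
qed

definition equivariant :: "('v sym list \<Rightarrow> 'g \<Rightarrow> 'v sym) \<Rightarrow> bool" where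
  "equivariant f \<longleftrightarrow> (\<forall>h\<in>carrier G. \<forall>l. f (map (gact h) l) = grp h \<odot> f l \<odot> grp (inv h))"

lemma extend_translate:
  assumes "\<And>l. f' (map (gact h) l) = grp h \<odot> f l \<odot> grp (inv h)" "\<And>l. f l \<in> A" "h \<in> carrier G" "k \<in> carrier G"
  shows "extend (h \<otimes> k) f' xs = grp h \<odot> extend k f xs"
  using assms(1,2,4)
proof (induction xs arbitrary: k f f')
  case Nil
  have "f' [] = grp h \<odot> f [] \<odot> grp (inv h)" using Nil(1)[of "[]"] by simp
  then show ?case
    using Nil assms(3) by (simp add: grp_mult[symmetric] smul_assoc grp_cancel)
next
  case (Cons x xs)
  have "extend (h \<otimes> k \<otimes> g) (\<lambda>l. f' (gact (h \<otimes> k) (x g) # l)) xs =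
      grp h \<odot> extend (k \<otimes> g) (\<lambda>l. f (gact k (x g) # l)) xs" if g: "g \<in> carrier G" for g
    using Cons.IH[of "\<lambda>l. f' (gact (h \<otimes> k) (x g) # l)" "\<lambda>l. f (gact k (x g) # l)" "k \<otimes> g"]
      Cons.prems(1)[of "gact k (x g) # _"] Cons.prems(2,3) g assms(3)
    by (simp add: m_assoc gact_mult)
  then show ?case by (simp add: smul_right cong: sum.cong)
qed

text \<open>
  Only the term with the left action needs equivariance: there the group component of the first
  argument has to be moved past the value of \<open>f\<close>.
\<close>

lemma extend_cocycle:
  assumes f: "f \<in> multilinear_maps UNIV A p" "equivariant f" and xs: "length xs = p" "set (x # xs) \<subseteq> A"
  shows "skd (extend \<one> f) (x # xs) = extend \<one> (bar_d (*) laS raS f) (x # xs)"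
proof -
  have mem: "f l \<in> A" for l
    using f(1) complex_vector.subspace_0[OF subspace_A] by (cases "length l = p") (auto simp: multilinear_maps_def)
  have "x \<odot> extend \<one> f xs = (\<Sum>g\<in>carrier G. emb (x g) \<odot> grp g) \<odot> extend \<one> f xs"
    using xs by (simp add: emb_decomposition)
  also have "\<dots> = (\<Sum>g\<in>carrier G. extend g (\<lambda>l. emb (x g) \<odot> f l) xs)"
    unfolding smul_left
  proof (rule sum.cong[OF refl])
    fix g assume g: "g \<in> carrier G"
    have ext_mem: "extend k f' xs \<in> A" if "\<And>l. f' l \<in> A" for k f' xs
      using that by (induction xs arbitrary: k f') (auto intro!: complex_vector.subspace_sum[OF subspace_A])
    have "extend g f xs = grp g \<odot> extend \<one> f xs"
      using extend_translate[of f g f \<one> xs] f(2) mem g by (simp add: equivariant_def)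
    then have "emb (x g) \<odot> grp g \<odot> extend \<one> f xs = emb (x g) \<odot> extend g f xs"
      using g ext_mem[OF mem] by (simp add: smul_assoc)
    also have "\<dots> = extend g (\<lambda>l. emb (x g) \<odot> f l) xs"
    proof -
      have "extend k (\<lambda>l. emb a \<odot> f' l) xs = emb a \<odot> extend k f' xs" if "\<And>l. f' l \<in> A" "k \<in> carrier G" for k f' a xs
        using that by (induction xs arbitrary: k f') (simp_all add: smul_assoc smul_right)
      then show ?thesis using mem g by simp
    qed
    finally show "emb (x g) \<odot> grp g \<odot> extend \<one> f xs = extend g (\<lambda>l. emb (x g) \<odot> f l) xs" .
  qed
  also have "\<dots> = extend \<one> (\<lambda>l. laS (hd l) (f (tl l))) (x # xs)"
    by (simp add: gact_one cong: sum.cong)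
  finally show ?thesis
    unfolding bar_d_def extend_diff using extend_bdry[OF f(1) one_closed xs] by simp
qed

lemma extend_map_emb: "f \<in> multilinear_maps UNIV A p \<Longrightarrow> length ss = p \<Longrightarrow> extend \<one> f (map emb ss) = f ss"
proof (induction ss arbitrary: f p)
  case Nil
  then show ?case by (simp add: grp_one_right multilinear_maps_0)
next
  case (Cons s ss)
  then obtain q where p: "p = Suc q" "length ss = q" by auto
  have f: "f ((a + b) # l) = f (a # l) + f (b # l)" "(\<lambda>l. f (a # l)) \<in> multilinear_maps UNIV A q" for a b l
    using Cons.prems(1) by (simp_all add: multilinear_maps_Suc p)
  have f0: "(\<lambda>l. f (0 # l)) = (\<lambda>l. 0)"
  proof
    show "f (0 # l) = 0" for l
      using f(1)[of 0 0 l] by (simp only: add_0_left) (metis add_cancel_right_left)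
  qed
  have "extend \<one> f (map emb (s # ss)) =
      (\<Sum>g\<in>carrier G. if g = \<one> then extend \<one> (\<lambda>l. f (s # l)) (map emb ss) else 0)"
    unfolding list.map extend.simps
  proof (rule sum.cong[OF refl])
    fix g assume "g \<in> carrier G"
    show "extend (\<one> \<otimes> g) (\<lambda>l. f (gact \<one> (emb s g) # l)) (map emb ss) =
        (if g = \<one> then extend \<one> (\<lambda>l. f (s # l)) (map emb ss) else 0)"
    proof (cases "g = \<one>")
      case True
      then show ?thesis by (simp add: gact_one skew_emb_def skew_single_def)
    next
      case False
      then have "gact \<one> (emb s g) = 0" by (simp add: gact_one skew_emb_def skew_single_def)
      then show ?thesis using False by (simp only: f0 extend_zero if_False)
    qed
  qed
  also have "\<dots> = f (s # ss)"
    using finite_carrier Cons.IH[OF f(2) p(2), of s] by simp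
  finally show ?case .
qed

end

context skew_algebra
begin

lemma sandwich_sum: "sandwich g (\<lambda>l. \<Sum>i\<in>I. F i l) xs = (\<Sum>i\<in>I. sandwich g (F i) xs)"
proof (induction xs arbitrary: g F)
  case Nil
  show ?case unfolding sandwich.simps by (rule smul_left)
next
  case (Cons x xs)
  show ?case unfolding sandwich.simps Cons.IH avg_sum ..
qed

lemma sandwich_cong:
  assumes "\<And>l. length l = length xs \<Longrightarrow> set l \<subseteq> A \<Longrightarrow> F l = F' l" "set xs \<subseteq> A"
  shows "sandwich g F xs = sandwich g F' xs"
  using assms
proof (induction xs arbitrary: g F F')
  case (Cons x xs)
  have "sandwich k (\<lambda>l. F ((grp (inv g) \<odot> x \<odot> grp k) # l)) xs =
      sandwich k (\<lambda>l. F' ((grp (inv g) \<odot> x \<odot> grp k) # l)) xs" for k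
    by (rule Cons.IH) (use Cons.prems in auto)
  then show ?case unfolding sandwich.simps by simp
qed simp

lemma sandwich_mem: "sandwich g F xs \<in> A"
  by (induction xs arbitrary: g F) (auto simp: avg_def intro!: complex_vector.subspace_scale[OF subspace_A] complex_vector.subspace_sum[OF subspace_A])

lemma multilinear_on_head_sum:
  assumes f: "multilinear_on (Suc p) f" and a: "\<And>i. i \<in> I \<Longrightarrow> a i \<in> A" and l: "length l = p" "set l \<subseteq> A"
  shows "f (sum a I # l) = (\<Sum>i\<in>I. f (a i # l))"
  using a
proof (induction I rule: infinite_finite_induct)
  case (insert i I)
  have "sum a I \<in> A" using insert.prems by (intro complex_vector.subspace_sum[OF subspace_A]) auto
  then have "f ((a i + sum a I) # l) = f (a i # l) + f (sum a I # l)"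
    using f insert.prems l by simp
  then show ?case using insert.IH insert.prems by (simp only: sum.insert[OF insert.hyps]) simp
next
  case (infinite I)
  have "f ((0 *\<^sub>C 0) # l) = 0 *\<^sub>C f (0 # l)"
    using f l complex_vector.subspace_0[OF subspace_A] by (simp only: multilinear_on.simps)
  then show ?case using infinite by (simp only: sum.infinite complex_vector.scale_zero_left not_False_eq_True)
next
  case empty
  have "f ((0 *\<^sub>C 0) # l) = 0 *\<^sub>C f (0 # l)"
    using f l complex_vector.subspace_0[OF subspace_A] by (simp only: multilinear_on.simps)
  then show ?case by (simp only: sum.empty complex_vector.scale_zero_left)
qed

text \<open>
  The average over the gap behind an entry absorbs its group component.  Hence a sandwiched cochain is
  determined by its values on \<open>S(V)\<close>.
\<close>

lemma extend_sandwich: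
  assumes "multilinear_on (length xs) f" "set xs \<subseteq> A" "h \<in> carrier G" "g \<in> carrier G"
  shows "extend h (\<lambda>l. sandwich g f (map emb l)) xs = sandwich (inv h \<otimes> g) f xs"
  using assms
proof (induction xs arbitrary: h g f)
  case Nil
  then show ?case
    by (simp add: inv_mult_group smul_assoc grp_mult)
next
  case (Cons x xs)
  have x: "x \<in> A" and xs: "set xs \<subseteq> A" and h: "h \<in> carrier G" and g: "g \<in> carrier G" using Cons.prems by auto
  have f: "multilinear_on (length xs) (\<lambda>l. f (y # l))" if "y \<in> A" for y
    using Cons.prems(1) that by simp
  let ?e = "grp (inv g)"
  have step: "extend (h \<otimes> k) (\<lambda>l. sandwich g f (map emb (gact h (x k) # l))) xs =
      avg (\<lambda>g'. sandwich g' (\<lambda>l. f ((?e \<odot> emb (gact h (x k)) \<odot> grp (h \<otimes> k \<otimes> g')) # l)) xs)"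
    if k: "k \<in> carrier G" for k
  proof -
    let ?F = "\<lambda>g' l. f ((?e \<odot> emb (gact h (x k)) \<odot> grp g') # l)"
    have "extend (h \<otimes> k) (\<lambda>l. sandwich g f (map emb (gact h (x k) # l))) xs =
        avg (\<lambda>g'. extend (h \<otimes> k) (\<lambda>l. sandwich g' (?F g') (map emb l)) xs)"
      unfolding list.map sandwich.simps extend_avg ..
    also have "\<dots> = avg (\<lambda>g'. sandwich (inv (h \<otimes> k) \<otimes> g') (?F g') xs)"
      by (intro avg_cong Cons.IH f xs) (use h k in auto)
    also have "\<dots> = avg (\<lambda>g'. sandwich (inv (h \<otimes> k) \<otimes> (h \<otimes> k \<otimes> g')) (?F (h \<otimes> k \<otimes> g')) xs)"
      using h k by (intro avg_translate[symmetric, where h = "h \<otimes> k"]) simp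
    also have "\<dots> = avg (\<lambda>g'. sandwich g' (?F (h \<otimes> k \<otimes> g')) xs)"
    proof (rule avg_cong)
      fix g' assume "g' \<in> carrier G"
      then have "inv (h \<otimes> k) \<otimes> (h \<otimes> k \<otimes> g') = g'"
        using m_assoc[of "inv (h \<otimes> k)" "h \<otimes> k" g'] h k by simp
      then show "sandwich (inv (h \<otimes> k) \<otimes> (h \<otimes> k \<otimes> g')) (?F (h \<otimes> k \<otimes> g')) xs = sandwich g' (?F (h \<otimes> k \<otimes> g')) xs"
        by (simp only:)
    qed
    finally show ?thesis .
  qed
  have elt: "(\<Sum>k\<in>carrier G. ?e \<odot> emb (gact h (x k)) \<odot> grp (h \<otimes> k \<otimes> g')) = ?e \<odot> grp h \<odot> x \<odot> grp g'"
    if g': "g' \<in> carrier G" for g'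
  proof -
    have "?e \<odot> emb (gact h (x k)) \<odot> grp (h \<otimes> k \<otimes> g') = ?e \<odot> grp h \<odot> (emb (x k) \<odot> grp k) \<odot> grp g'"
      if k: "k \<in> carrier G" for k
    proof -
      have "?e \<odot> emb (gact h (x k)) \<odot> grp (h \<otimes> k \<otimes> g') = ?e \<odot> (emb (gact h (x k)) \<odot> grp h) \<odot> grp k \<odot> grp g'"
        using h g g' k by (simp add: grp_mult[symmetric] smul_assoc)
      also have "\<dots> = ?e \<odot> grp h \<odot> (emb (x k) \<odot> grp k) \<odot> grp g'"
        unfolding grp_emb[OF h, symmetric] using h g g' k by (simp add: smul_assoc)
      finally show ?thesis .
    qed
    then have "(\<Sum>k\<in>carrier G. ?e \<odot> emb (gact h (x k)) \<odot> grp (h \<otimes> k \<otimes> g')) =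
        ?e \<odot> grp h \<odot> (\<Sum>k\<in>carrier G. emb (x k) \<odot> grp k) \<odot> grp g'"
      unfolding smul_left smul_right by (rule sum.cong[OF refl])
    then show ?thesis by (simp only: emb_decomposition[OF x])
  qed
  have "extend h (\<lambda>l. sandwich g f (map emb l)) (x # xs) =
      (\<Sum>k\<in>carrier G. avg (\<lambda>g'. sandwich g' (\<lambda>l. f ((?e \<odot> emb (gact h (x k)) \<odot> grp (h \<otimes> k \<otimes> g')) # l)) xs))"
    unfolding extend.simps by (rule sum.cong[OF refl step])
  also have "\<dots> = avg (\<lambda>g'. sandwich g' (\<lambda>l. \<Sum>k\<in>carrier G. f ((?e \<odot> emb (gact h (x k)) \<odot> grp (h \<otimes> k \<otimes> g')) # l)) xs)"
    unfolding sandwich_sum avg_sum ..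
  also have "\<dots> = avg (\<lambda>g'. sandwich g' (\<lambda>l. f ((grp (inv (inv h \<otimes> g)) \<odot> x \<odot> grp g') # l)) xs)"
  proof (intro avg_cong sandwich_cong xs)
    fix g' and l :: "('g \<Rightarrow> 'v sym) list" assume g': "g' \<in> carrier G" and l: "length l = length xs" "set l \<subseteq> A"
    have "(\<Sum>k\<in>carrier G. f ((?e \<odot> emb (gact h (x k)) \<odot> grp (h \<otimes> k \<otimes> g')) # l)) =
        f ((\<Sum>k\<in>carrier G. ?e \<odot> emb (gact h (x k)) \<odot> grp (h \<otimes> k \<otimes> g')) # l)"
      using Cons.prems(1) l by (intro multilinear_on_head_sum[symmetric, where p = "length xs"]) simp_all
    also have "\<dots> = f ((grp (inv (inv h \<otimes> g)) \<odot> x \<odot> grp g') # l)"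
      using h g by (simp only: elt[OF g'] inv_mult_group inv_closed inv_inv grp_mult)
    finally show "(\<Sum>k\<in>carrier G. f ((?e \<odot> emb (gact h (x k)) \<odot> grp (h \<otimes> k \<otimes> g')) # l)) =
        f ((grp (inv (inv h \<otimes> g)) \<odot> x \<odot> grp g') # l)" .
  qed
  finally show ?case unfolding sandwich.simps .
qed

lemma extend_relative_part:
  assumes "multilinear_on (length xs) f" "set xs \<subseteq> A"
  shows "extend \<one> (\<lambda>l. relative_part f (map emb l)) xs = relative_part f xs"
proof -
  have left: "extend k (\<lambda>l. grp g \<odot> f' l) xs = grp g \<odot> extend k f' xs"
    if "\<And>l. f' l \<in> A" "k \<in> carrier G" "g \<in> carrier G" for k g f' xs
    using that by (induction xs arbitrary: k f') (simp_all add: smul_assoc smul_right)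
  have "extend \<one> (\<lambda>l. relative_part f (map emb l)) xs =
      avg (\<lambda>g. extend \<one> (\<lambda>l. grp g \<odot> sandwich g f (map emb l)) xs)"
    unfolding relative_part_def extend_avg ..
  also have "\<dots> = relative_part f xs"
    unfolding relative_part_def
    by (rule avg_cong) (simp add: left sandwich_mem extend_sandwich assms)
  finally show ?thesis .
qed

text \<open>Conjugating all entries by \<open>h\<close> amounts to translating every group element that is averaged over.\<close>

lemma sandwich_conjugate:
  assumes "\<And>l. f l \<in> A" "set xs \<subseteq> A" "h \<in> carrier G" "g \<in> carrier G"
  shows "sandwich (h \<otimes> g) f (map (\<lambda>x. grp h \<odot> x \<odot> grp (inv h)) xs) = sandwich g f xs \<odot> grp (inv h)"
  using assms(1,2,4)
proof (induction xs arbitrary: g f)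
  case Nil
  then show ?case using assms(3) by (simp add: inv_mult_group smul_assoc grp_mult)
next
  case (Cons x xs)
  have x: "x \<in> A" and xs: "set xs \<subseteq> A" and g: "g \<in> carrier G" and h: "h \<in> carrier G"
    using Cons.prems assms(3) by auto
  let ?c = "\<lambda>x. grp h \<odot> x \<odot> grp (inv h)"
  have elt: "grp (inv (h \<otimes> g)) \<odot> ?c x \<odot> grp (h \<otimes> k) = grp (inv g) \<odot> x \<odot> grp k" if k: "k \<in> carrier G" for k
    using x g h k by (simp add: inv_mult_group grp_mult[symmetric] smul_assoc grp_cancel)
  have "sandwich (h \<otimes> g) f (map ?c (x # xs)) =
      avg (\<lambda>k. sandwich (h \<otimes> k) (\<lambda>l. f ((grp (inv (h \<otimes> g)) \<odot> ?c x \<odot> grp (h \<otimes> k)) # l)) (map ?c xs))"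
    unfolding list.map sandwich.simps by (rule avg_translate[OF h, symmetric])
  also have "\<dots> = avg (\<lambda>k. sandwich k (\<lambda>l. f ((grp (inv g) \<odot> x \<odot> grp k) # l)) xs \<odot> grp (inv h))"
    by (rule avg_cong) (simp only: elt Cons.IH[OF Cons.prems(1) xs])
  also have "\<dots> = sandwich g f (x # xs) \<odot> grp (inv h)"
    unfolding sandwich.simps avg_linear[OF clinear_smul_left] ..
  finally show ?case .
qed

lemma relative_part_equivariant:
  assumes "\<And>l. f l \<in> A"
  shows "equivariant (\<lambda>l. relative_part f (map emb l))"
  unfolding equivariant_def
proof (intro ballI allI)
  fix h l assume h: "h \<in> carrier G"
  let ?c = "\<lambda>x. grp h \<odot> x \<odot> grp (inv h)"
  have "emb (gact h a) = ?c (emb a)" for a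
    using h by (simp add: grp_emb grp_cancel)
  then have m: "map emb (map (gact h) l) = map ?c (map emb l)" by simp
  have "relative_part f (map ?c (map emb l)) = avg (\<lambda>g. grp (h \<otimes> g) \<odot> sandwich (h \<otimes> g) f (map ?c (map emb l)))"
    unfolding relative_part_def by (rule avg_translate[OF h, symmetric])
  also have "\<dots> = avg (\<lambda>g. grp h \<odot> (grp g \<odot> sandwich g f (map emb l)) \<odot> grp (inv h))"
  proof (rule avg_cong)
    fix g assume g: "g \<in> carrier G"
    have "sandwich (h \<otimes> g) f (map ?c (map emb l)) = sandwich g f (map emb l) \<odot> grp (inv h)"
      by (rule sandwich_conjugate[OF assms _ h g]) auto
    then show "grp (h \<otimes> g) \<odot> sandwich (h \<otimes> g) f (map ?c (map emb l)) =
        grp h \<odot> (grp g \<odot> sandwich g f (map emb l)) \<odot> grp (inv h)"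
      using g h by (simp only: grp_mult[symmetric]) (simp add: smul_assoc sandwich_mem)
  qed
  also have "\<dots> = grp h \<odot> relative_part f (map emb l) \<odot> grp (inv h)"
    unfolding relative_part_def avg_linear[OF clinear_smul_left] avg_linear[OF clinear_smul_right] ..
  finally show "relative_part f (map emb (map (gact h) l)) = grp h \<odot> relative_part f (map emb l) \<odot> grp (inv h)"
    unfolding m .
qed

section \<open>Restriction to the symmetric algebra\<close>

lemma sym_bar_eq: "sym_bar G \<rho> = bar_complex UNIV (*) A laS raS"
  by (simp add: sym_bar_def)

lemma clinear_laS: "clinear (laS a)" and clinear_raS: "clinear (\<lambda>F. raS F a)"
  by (rule clinear_smul_right, rule clinear_smul_left)

lemma linear_complex_sym_bar: "linear_complex (sym_bar G \<rho>)"
  unfolding sym_bar_eq by (intro linear_complex_bar subspace_A clinear_laS clinear_raS)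

lemma linear_complex_skew_bar: "linear_complex (skew_bar G \<rho>)"
  unfolding skew_bar_def by (intro linear_complex_bar subspace_A clinear_smul_left clinear_smul_right)

lemma cochains_sym_bar: "cochains (sym_bar G \<rho>) p = multilinear_maps UNIV A p"
  and cochains_skew_bar: "cochains (skew_bar G \<rho>) p = multilinear_maps A A p"
  by (simp_all add: sym_bar_eq skew_bar_def bar_complex_def)

lemma codiff_sym_bar: "codiff (sym_bar G \<rho>) p f xs = (if length xs = Suc p then bar_d (*) laS raS f xs else 0)"
  unfolding sym_bar_eq codiff_bar by simp

lemma codiff_skew_bar: "codiff (skew_bar G \<rho>) p f xs = (if length xs = Suc p \<and> set xs \<subseteq> A then skd f xs else 0)"
  unfolding skew_bar_def codiff_bar ..

lemma cochain_values: "f \<in> multilinear_maps B A p \<Longrightarrow> f l \<in> A"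
  using complex_vector.subspace_0[OF subspace_A]
  by (cases "length l = p \<and> set l \<subseteq> B") (auto simp: multilinear_maps_def)

lemma restrict_codiff:
  "restrict_cochain G (codiff (skew_bar G \<rho>) p f) = codiff (sym_bar G \<rho>) p (restrict_cochain G f)"
proof
  fix ss
  have "bar_d (*) laS raS (restrict_cochain G f) ss = skd f (map emb ss)" if "ss \<noteq> []"
    using that by (intro bar_d_transport[where A = UNIV and T = "\<lambda>x. x" and t = emb])
      (simp_all add: restrict_cochain_def emb_mult)
  moreover have "set (map emb ss) \<subseteq> A" by auto
  ultimately show "restrict_cochain G (codiff (skew_bar G \<rho>) p f) ss = codiff (sym_bar G \<rho>) p (restrict_cochain G f) ss"
    by (cases "ss = []") (simp_all add: codiff_sym_bar codiff_skew_bar restrict_cochain_def[of G "codiff _ _ _"] del: set_map)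
qed

lemma restrict_mem: "f \<in> multilinear_maps A A p \<Longrightarrow> restrict_cochain G f \<in> multilinear_maps UNIV A p"
proof -
  assume f: "f \<in> multilinear_maps A A p"
  have e: "map emb (xs @ z # ys) = map emb xs @ emb z # map emb ys" for xs z ys by simp
  have s: "set (map emb xs) \<subseteq> A" for xs by auto
  show ?thesis
    unfolding multilinear_maps_def restrict_cochain_def mem_Collect_eq e clinearD[OF clinear_emb]
    using f s by (auto simp: multilinear_maps_def simp del: set_map)
qed

lemma restrict_coboundaries:
  assumes "b \<in> coboundaries (skew_bar G \<rho>) p"
  shows "restrict_cochain G b \<in> coboundaries (sym_bar G \<rho>) p"
proof (cases p)
  case 0
  have "restrict_cochain G 0 = (0 :: 'v sym list \<Rightarrow> 'g \<Rightarrow> 'v sym)"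
    by (simp only: restrict_cochain_def zero_fun_def)
  then show ?thesis using assms 0 by (simp add: coboundaries_def)
next
  case (Suc q)
  then obtain k where "k \<in> multilinear_maps A A q" "b = codiff (skew_bar G \<rho>) q k"
    using assms by (auto simp: coboundaries_def cochains_skew_bar)
  then show ?thesis
    using restrict_mem by (auto simp: coboundaries_def Suc restrict_codiff cochains_sym_bar)
qed

lemma coh_hom_restrict: "coh_hom (skew_bar G \<rho>) (sym_bar G \<rho>) p (restrict_cochain G)"
  unfolding coh_hom_def
proof (intro conjI ballI allI impI restrict_coboundaries)
  fix f assume "f \<in> cocycles (skew_bar G \<rho>) p"
  then have "f \<in> multilinear_maps A A p" "codiff (skew_bar G \<rho>) p f = 0"
    by (auto simp: cocycles_def cochains_skew_bar)
  moreover have "restrict_cochain G 0 = (0 :: 'v sym list \<Rightarrow> 'g \<Rightarrow> 'v sym)"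
    by (simp only: restrict_cochain_def zero_fun_def)
  ultimately show "restrict_cochain G f \<in> cocycles (sym_bar G \<rho>) p"
    by (simp only: cocycles_def cochains_sym_bar mem_Collect_eq restrict_mem restrict_codiff[symmetric] simp_thms)
qed (simp_all add: restrict_cochain_def plus_fun_def scaleC_fun_def)

text \<open>
  The homotopy of \<open>f\<close> is a primitive of the difference.  In degree \<open>0\<close> there is no homotopy, but there the
  cocycle condition says that \<open>f\<close> commutes with the group elements.
\<close>

lemma cocycle_relative_part:
  assumes "f \<in> cocycles (skew_bar G \<rho>) p"
  obtains b where "b \<in> coboundaries (skew_bar G \<rho>) p"
    "\<And>xs. length xs = p \<Longrightarrow> set xs \<subseteq> A \<Longrightarrow> f xs = relative_part f xs + b xs"
proof (cases p)
  case 0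
  have f: "f \<in> multilinear_maps A A p" and df: "codiff (skew_bar G \<rho>) p f = 0"
    using assms by (auto simp: cocycles_def cochains_skew_bar)
  have "grp g \<odot> f [] = f [] \<odot> grp g" if "g \<in> carrier G" for g
  proof -
    have "skd f [grp g] = 0"
      using fun_cong[OF df, of "[grp g]"] that 0 unfolding codiff_skew_bar zero_fun_apply by simp
    then show ?thesis unfolding bar_d_def bdry.simps list.sel by (simp only: right_minus_eq)
  qed
  then have "grp g \<odot> sandwich g f [] = f []" if "g \<in> carrier G" for g
    using that cochain_values[OF f] by (simp add: smul_assoc[symmetric] grp_cancel)
  then have "relative_part f [] = f []"
    unfolding relative_part_def by (simp only: avg_const cong: avg_cong)
  then show ?thesis
    using 0 by (intro that[of 0]) (simp_all add: coboundaries_def)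
next
  case (Suc q)
  have f: "f \<in> multilinear_maps A A p" and df: "codiff (skew_bar G \<rho>) p f = 0"
    using assms by (auto simp: cocycles_def cochains_skew_bar)
  let ?k = "cut q (full_homotopy f)"
  have k: "?k \<in> multilinear_maps A A q"
    using f Suc by (intro cut_mem full_homotopy_multilinear multilinear_on_of) simp
  show ?thesis
  proof (rule that[of "codiff (skew_bar G \<rho>) q ?k"])
    show "codiff (skew_bar G \<rho>) q ?k \<in> coboundaries (skew_bar G \<rho>) p"
      using k by (simp add: coboundaries_def Suc cochains_skew_bar)
    fix xs assume xs: "length xs = p" "set xs \<subseteq> A"
    then obtain x l where xl: "xs = x # l" "length l = q" using Suc by (cases xs) auto
    have "homotopy g (skd f) xs = 0" if g: "g \<in> carrier G" for g
    proof -
      have "homotopy g (skd f) xs = homotopy g (\<lambda>l. 0) xs"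
      proof (rule homotopy_cong[OF _ g xs(2)])
        fix l' assume "length l' = Suc (length xs)" "set l' \<subseteq> A"
        then show "skd f l' = 0" using fun_cong[OF df, of l'] xs unfolding codiff_skew_bar zero_fun_apply by simp
      qed
      then show ?thesis by (simp only: homotopy_zero)
    qed
    then have zero: "full_homotopy (skd f) xs = 0"
      unfolding full_homotopy_def by (simp only: smul_right avg_const cong: avg_cong)
    have "skd ?k xs = skd (full_homotopy f) xs"
      by (rule bar_d_cong[where p = q and A = A]) (use xs Suc in \<open>auto simp: cut_def\<close>)
    then have "codiff (skew_bar G \<rho>) q ?k xs = skd (full_homotopy f) xs"
      using xs Suc by (simp add: codiff_skew_bar)
    also have "\<dots> = f xs - relative_part f xs"
      using full_homotopy_formula[of f x l] cochain_values[OF f] xs zero xl by simp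
    finally show "f xs = relative_part f xs + codiff (skew_bar G \<rho>) q ?k xs" by simp
  qed
qed

end

context skew_algebra
begin

section \<open>The group action on bar cochains\<close>

lemma scaleC_fun_apply: "(c *\<^sub>C f) x = c *\<^sub>C f x"
  by (simp add: scaleC_fun_def)


abbreviation actb where "actb \<equiv> act_bar G \<rho>"

lemma act_bar_mem:
  assumes h: "h \<in> carrier G" and f: "f \<in> multilinear_maps UNIV A p"
  shows "actb h f \<in> multilinear_maps UNIV A p"
proof -
  note lin = clinearD[OF clinear_skew_act[OF h]] clinearD[OF clinear_sym_map[OF clinear_action[OF inv_closed[OF h]]]]
  have "actb h f xs = 0" if "length xs \<noteq> p" for xs
    using multilinear_mapsD(2)[OF f] that unfolding act_bar_def by (simp only: lin length_map simp_thms)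
  then show ?thesis
    using f by (simp add: multilinear_maps_def) (simp add: act_bar_def skew_act_mem h lin)
qed

lemma act_bar_codiff:
  assumes h: "h \<in> carrier G" and f: "f \<in> multilinear_maps UNIV A p"
  shows "codiff (sym_bar G \<rho>) p (actb h f) = actb h (codiff (sym_bar G \<rho>) p f)"
proof
  fix xs
  note lin = clinearD[OF clinear_skew_act[OF h]]
  have cancel: "map (gact h) (map (gact (inv h)) l) = l" "map (gact (inv h)) (map (gact h) l) = l" for l
    using h by (simp_all add: gact_inv o_def)
  have "skew_act G \<rho> h (bar_d (*) laS raS f (map (gact (inv h)) xs)) = bar_d (*) laS raS (actb h f) (map (gact h) (map (gact (inv h)) xs))"
    if "xs \<noteq> []"
  proof (rule bar_d_transport[where A = UNIV and T = "skew_act G \<rho> h" and t = "gact h"])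
    fix l :: "'v sym list" and a
    have m: "f l \<in> A" by (rule cochain_values[OF f])
    show "skew_act G \<rho> h (f l) = actb h f (map (gact h) l)"
      unfolding act_bar_def cancel ..
    show "skew_act G \<rho> h (f l \<odot> emb a) = actb h f (map (gact h) l) \<odot> emb (gact h a)"
      unfolding act_bar_def cancel
      using h m grp_emb[of "inv h" "gact h a"] by (simp add: skew_act_eq smul_assoc gact_inv)
    show "skew_act G \<rho> h (emb a \<odot> f l) = emb (gact h a) \<odot> actb h f (map (gact h) l)"
      unfolding act_bar_def cancel
      using h m grp_emb[OF h, of a] by (simp add: skew_act_eq smul_assoc[symmetric])
  qed (use that h in \<open>simp_all add: lin gact_simps\<close>)
  then have *: "skew_act G \<rho> h (bar_d (*) laS raS f (map (gact (inv h)) xs)) = bar_d (*) laS raS (actb h f) xs" if "xs \<noteq> []"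
    using that unfolding cancel by simp
  show "codiff (sym_bar G \<rho>) p (actb h f) xs = actb h (codiff (sym_bar G \<rho>) p f) xs"
  proof (cases "length xs = Suc p")
    case True
    then have ne: "xs \<noteq> []" by auto
    show ?thesis using *[OF ne] True by (simp only: act_bar_def[of G \<rho> h "codiff _ _ _"] codiff_sym_bar length_map if_True refl)
  next
    case False
    then show ?thesis
      by (simp only: act_bar_def[of G \<rho> h "codiff _ _ _"] codiff_sym_bar length_map if_False lin)
  qed
qed

lemma act_bar_coboundaries:
  assumes h: "h \<in> carrier G" and x: "x \<in> coboundaries (sym_bar G \<rho>) p"
  shows "actb h x \<in> coboundaries (sym_bar G \<rho>) p"
proof (cases p)
  case 0
  have "actb h 0 = 0"
    unfolding act_bar_def zero_fun_apply clinearD(3)[OF clinear_skew_act[OF h]] by (simp only: zero_fun_def)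
  then show ?thesis using x 0 by (simp add: coboundaries_def)
next
  case (Suc q)
  then show ?thesis
    using x act_bar_mem[OF h] act_bar_codiff[OF h, symmetric]
    by (auto simp: coboundaries_def cochains_sym_bar)
qed

lemma act_bar_linear:
  assumes h: "h \<in> carrier G"
  shows "actb h (f + f') = actb h f + actb h f'" "actb h (c *\<^sub>C f) = c *\<^sub>C actb h f" "actb h (f - f') = actb h f - actb h f'"
    "actb h 0 = 0"
  by (rule ext, simp only: act_bar_def plus_fun_apply minus_apply zero_fun_apply scaleC_fun_apply clinearD[OF clinear_skew_act[OF h]])+

lemma coh_hom_act_bar:
  assumes h: "h \<in> carrier G"
  shows "coh_hom (sym_bar G \<rho>) (sym_bar G \<rho>) p (actb h)"
  unfolding coh_hom_def
  by (intro conjI ballI allI impI act_bar_linear[OF h] act_bar_coboundaries[OF h])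
    (auto simp: cocycles_def cochains_sym_bar act_bar_mem[OF h] act_bar_codiff[OF h] act_bar_linear[OF h])

lemma equivariant_act_bar:
  assumes "equivariant f" "\<And>l. f l \<in> A" "h \<in> carrier G"
  shows "actb h f = f"
proof
  fix l
  have "f (map (gact h) (map (gact (inv h)) l)) = grp h \<odot> f (map (gact (inv h)) l) \<odot> grp (inv h)"
    using assms(1,3) unfolding equivariant_def by blast
  moreover have "map (gact h) (map (gact (inv h)) l) = l"
    using assms(3) by (simp add: gact_inv o_def)
  ultimately show "actb h f l = f l"
    by (simp only: act_bar_def skew_act_eq[OF assms(3,2)])
qed

lemma equivariant_avg:
  assumes f: "\<And>l. f l \<in> A"
  shows "equivariant (\<lambda>l. avg (\<lambda>h. actb h f l))"
  unfolding equivariant_def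
proof (intro ballI allI)
  fix k l assume k: "k \<in> carrier G"
  have "avg (\<lambda>h. actb h f (map (gact k) l)) = avg (\<lambda>h. actb (k \<otimes> h) f (map (gact k) l))"
    by (rule avg_translate[OF k, symmetric])
  also have "\<dots> = avg (\<lambda>h. grp k \<odot> actb h f l \<odot> grp (inv k))"
  proof (rule avg_cong)
    fix h assume h: "h \<in> carrier G"
    have "map (gact (inv (k \<otimes> h))) (map (gact k) l) = map (gact (inv h)) l"
      using h k by (simp add: gact_mult inv_mult_group m_assoc)
    then show "actb (k \<otimes> h) f (map (gact k) l) = grp k \<odot> actb h f l \<odot> grp (inv k)"
      using h k f by (simp only: act_bar_def skew_act_eq m_closed)
        (simp add: inv_mult_group grp_mult[symmetric] smul_assoc)
  qed
  also have "\<dots> = grp k \<odot> avg (\<lambda>h. actb h f l) \<odot> grp (inv k)"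
    unfolding avg_linear[OF clinear_smul_left] avg_linear[OF clinear_smul_right] ..
  finally show "avg (\<lambda>h. actb h f (map (gact k) l)) = grp k \<odot> avg (\<lambda>h. actb h f l) \<odot> grp (inv k)" .
qed

lemma codiff_avg: "codiff (sym_bar G \<rho>) p (avg F) = avg (\<lambda>h. codiff (sym_bar G \<rho>) p (F h))"
proof
  fix xs
  have "bdry (*) raS (\<lambda>l. avg (\<lambda>h. F h l)) xs = avg (\<lambda>h. bdry (*) raS (F h) xs)"
    unfolding avg_def by (simp only: bdry_scale[OF clinear_raS] bdry_sum[OF clinear_raS])
  then have "bar_d (*) laS raS (\<lambda>l. avg (\<lambda>h. F h l)) xs = avg (\<lambda>h. bar_d (*) laS raS (F h) xs)"
    by (simp only: bar_d_def avg_diff avg_linear[OF clinear_laS])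
  then show "codiff (sym_bar G \<rho>) p (avg F) xs = avg (\<lambda>h. codiff (sym_bar G \<rho>) p (F h)) xs"
    by (cases "length xs = Suc p") (simp_all only: avg_fun[of F] avg_fun[of "\<lambda>h. codiff _ _ (F h)"] codiff_sym_bar if_True if_False avg_const refl)
qed

section \<open>Cohomology of the skew group algebra\<close>

lemma extend_cong:
  "(\<And>l. length l = length xs \<Longrightarrow> f l = f' l) \<Longrightarrow> extend h f xs = extend h f' xs"
proof (induction xs arbitrary: h f f')
  case (Cons x xs)
  have "extend (h \<otimes> g) (\<lambda>l. f (gact h (x g) # l)) xs = extend (h \<otimes> g) (\<lambda>l. f' (gact h (x g) # l)) xs" for g
    by (rule Cons.IH) (simp add: Cons.prems)
  then show ?case unfolding extend.simps by simp
qed simp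

lemma codiff_cut_extend:
  assumes f: "f \<in> multilinear_maps UNIV A q" "equivariant f" and xs: "length xs = Suc q" "set xs \<subseteq> A"
  shows "codiff (skew_bar G \<rho>) q (cut q (extend \<one> f)) xs = extend \<one> (codiff (sym_bar G \<rho>) q f) xs"
proof -
  obtain x l where xl: "xs = x # l" "length l = q" using xs(1) by (cases xs) auto
  have "skd (cut q (extend \<one> f)) xs = skd (extend \<one> f) xs"
    by (rule bar_d_cong[where p = q and A = A]) (use xs in \<open>auto simp: cut_def\<close>)
  also have "\<dots> = extend \<one> (bar_d (*) laS raS f) xs"
    unfolding xl(1) by (rule extend_cocycle[OF f]) (use xs xl in auto)
  also have "\<dots> = extend \<one> (codiff (sym_bar G \<rho>) q f) xs"
    by (rule extend_cong) (simp add: codiff_sym_bar xs(1))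
  finally show ?thesis using xs by (simp add: codiff_skew_bar)
qed

lemma relative_part_off:
  assumes f: "f \<in> multilinear_maps A A p" and l: "length l \<noteq> p" "set l \<subseteq> A"
  shows "relative_part f l = 0"
proof -
  have "sandwich g f l = 0" for g
  proof -
    have "sandwich g f l = sandwich g (\<lambda>l. 0) l"
      by (rule sandwich_cong[OF _ l(2)]) (use multilinear_mapsD(2)[OF f] l in \<open>simp only: simp_thms\<close>)
    also have "\<dots> = 0"
      using sandwich_sum[of g "\<lambda>_ _. 0" "{} :: nat set" l] by (simp only: sum.empty)
    finally show ?thesis .
  qed
  then show ?thesis unfolding relative_part_def by (simp only: smul_right avg_const)
qed

lemma relative_part_mem: "relative_part f l \<in> A"
  unfolding relative_part_def by (intro avg_mem subspace_A) simp

lemma coboundary_off: "b \<in> coboundaries (skew_bar G \<rho>) p \<Longrightarrow> length l \<noteq> p \<Longrightarrow> b l = 0"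
  by (cases p) (auto simp: coboundaries_def codiff_skew_bar)

lemma restrict_relative_part:
  assumes f: "f \<in> cocycles (skew_bar G \<rho>) p"
    and b: "b \<in> coboundaries (skew_bar G \<rho>) p"
    and fb: "\<And>xs. length xs = p \<Longrightarrow> set xs \<subseteq> A \<Longrightarrow> f xs = relative_part f xs + b xs"
  shows "restrict_cochain G f = (\<lambda>l. relative_part f (map emb l)) + restrict_cochain G b"
proof
  fix l :: "'v sym list"
  have fm: "f \<in> multilinear_maps A A p" using f by (simp add: cocycles_def cochains_skew_bar)
  have sub: "set (map emb l) \<subseteq> A" by auto
  have "f (map emb l) = relative_part f (map emb l) + b (map emb l)"
  proof (cases "length l = p")
    case True
    then show ?thesis using fb[of "map emb l"] sub by (simp only: length_map)
  next
    case False
    then have "length (map emb l) \<noteq> p" by simp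
    then show ?thesis
      using relative_part_off[OF fm _ sub] coboundary_off[OF b, of "map emb l"] multilinear_mapsD(2)[OF fm, of "map emb l"]
      by (simp only: add_0_left simp_thms)
  qed
  then show "restrict_cochain G f l = ((\<lambda>l. relative_part f (map emb l)) + restrict_cochain G b) l"
    by (simp only: restrict_cochain_def plus_fun_apply)
qed

text \<open>
  It suffices to treat the relative part of \<open>f\<close>.  Its restriction is equivariant and of the form \<open>dk\<close>;
  averaging \<open>k\<close> over the group does not change \<open>dk\<close>, and the extension of the average is a primitive of
  the relative part.
\<close>

lemma restrict_injective:
  assumes f: "f \<in> cocycles (skew_bar G \<rho>) p" and rf: "restrict_cochain G f \<in> coboundaries (sym_bar G \<rho>) p"
  shows "f \<in> coboundaries (skew_bar G \<rho>) p"
proof -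
  have fm: "f \<in> multilinear_maps A A p" using f by (simp add: cocycles_def cochains_skew_bar)
  obtain b where b: "b \<in> coboundaries (skew_bar G \<rho>) p"
    and fb: "\<And>xs. length xs = p \<Longrightarrow> set xs \<subseteq> A \<Longrightarrow> f xs = relative_part f xs + b xs"
    using cocycle_relative_part[OF f] by blast
  define r where "r = (\<lambda>l. relative_part f (map emb l))"
  have "restrict_cochain G f - restrict_cochain G b = r"
  proof -
    have "restrict_cochain G f = r + restrict_cochain G b"
      unfolding r_def by (rule restrict_relative_part[OF f b fb])
    then show ?thesis by (simp only: add_diff_cancel_right')
  qed
  then have r: "r \<in> coboundaries (sym_bar G \<rho>) p"
    using complex_vector.subspace_diff[OF subspace_coboundaries[OF linear_complex_sym_bar] rf restrict_coboundaries[OF b]] by simp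
  have r_eq: "equivariant r"
    unfolding r_def by (rule relative_part_equivariant[OF cochain_values[OF fm]])
  have ext_r: "extend \<one> r xs = relative_part f xs" if "length xs = p" "set xs \<subseteq> A" for xs
    unfolding r_def using that multilinear_on_of[OF fm] by (intro extend_relative_part) simp_all
  have "\<exists>c\<in>coboundaries (skew_bar G \<rho>) p. \<forall>xs. length xs = p \<longrightarrow> set xs \<subseteq> A \<longrightarrow> c xs = relative_part f xs"
  proof (cases p)
    case 0
    have "r = 0" using r 0 by (simp add: coboundaries_def)
    then have "relative_part f xs = 0" if "length xs = p" "set xs \<subseteq> A" for xs
      using ext_r[OF that] extend_zero[of \<one> xs] by (simp only: zero_fun_def)
    then show ?thesis
      by (intro bexI[of _ 0] allI impI)
        (simp_all only: zero_fun_apply complex_vector.subspace_0[OF subspace_coboundaries[OF linear_complex_skew_bar]])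
  next
    case (Suc q)
    then obtain k where k: "k \<in> multilinear_maps UNIV A q" and rk: "r = codiff (sym_bar G \<rho>) q k"
      using r by (auto simp: coboundaries_def cochains_sym_bar)
    \<comment> \<open>an equivariant primitive of \<open>r\<close>\<close>
    let ?k = "avg (\<lambda>h. actb h k)"
    have km: "?k \<in> multilinear_maps UNIV A q"
      by (intro avg_mem subspace_multilinear_maps subspace_A act_bar_mem k)
    have keq: "equivariant ?k"
      using equivariant_avg[OF cochain_values[OF k]] unfolding avg_fun[of "\<lambda>h. actb h k"] .
    have "codiff (sym_bar G \<rho>) q ?k = avg (\<lambda>h. r)"
      unfolding codiff_avg
    proof (rule avg_cong)
      fix h assume h: "h \<in> carrier G"
      show "codiff (sym_bar G \<rho>) q (actb h k) = r"
        unfolding act_bar_codiff[OF h k] rk[symmetric]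
        by (rule equivariant_act_bar[OF r_eq _ h]) (simp add: r_def relative_part_mem)
    qed
    then have dk: "codiff (sym_bar G \<rho>) q ?k = r" by (simp only: avg_const)
    let ?c = "codiff (skew_bar G \<rho>) q (cut q (extend \<one> ?k))"
    have "?c \<in> coboundaries (skew_bar G \<rho>) p"
      using cut_mem[OF extend_multilinear[OF km one_closed]] by (simp add: coboundaries_def Suc cochains_skew_bar)
    moreover have "?c xs = relative_part f xs" if "length xs = p" "set xs \<subseteq> A" for xs
      using codiff_cut_extend[OF km keq, of xs] ext_r[OF that] that Suc by (simp only: dk)
    ultimately show ?thesis by blast
  qed
  then obtain c where c: "c \<in> coboundaries (skew_bar G \<rho>) p"
    and cf: "\<And>xs. length xs = p \<Longrightarrow> set xs \<subseteq> A \<Longrightarrow> c xs = relative_part f xs" by blast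
  have "f = c + b"
  proof
    fix xs
    have off: "z xs = 0" if z: "z \<in> coboundaries (skew_bar G \<rho>) p" and xs: "\<not> (length xs = p \<and> set xs \<subseteq> A)" for z
    proof (cases p)
      case 0
      then show ?thesis using z by (simp add: coboundaries_def)
    next
      case (Suc q)
      then obtain w where "z = codiff (skew_bar G \<rho>) q w" using z by (auto simp: coboundaries_def)
      then show ?thesis using xs unfolding Suc by (simp only: codiff_skew_bar if_False)
    qed
    show "f xs = (c + b) xs"
    proof (cases "length xs = p \<and> set xs \<subseteq> A")
      case True
      then show ?thesis using fb[of xs] cf[of xs] by (simp only: plus_fun_apply)
    next
      case False
      show ?thesis
        by (simp only: plus_fun_apply off[OF b False] off[OF c False] multilinear_mapsD(2)[OF fm False] add_0_left)
    qed
  qed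
  then show ?thesis
    using complex_vector.subspace_add[OF subspace_coboundaries[OF linear_complex_skew_bar] c b] by simp
qed

text \<open>The relative part restricts to an equivariant cochain, and the action preserves coboundaries.\<close>

lemma restrict_invariant:
  assumes f: "f \<in> cocycles (skew_bar G \<rho>) p" and h: "h \<in> carrier G"
  shows "actb h (restrict_cochain G f) - restrict_cochain G f \<in> coboundaries (sym_bar G \<rho>) p"
proof -
  have fm: "f \<in> multilinear_maps A A p" using f by (simp add: cocycles_def cochains_skew_bar)
  obtain b where b: "b \<in> coboundaries (skew_bar G \<rho>) p"
    and fb: "\<And>xs. length xs = p \<Longrightarrow> set xs \<subseteq> A \<Longrightarrow> f xs = relative_part f xs + b xs"
    using cocycle_relative_part[OF f] by blast
  let ?r = "\<lambda>l. relative_part f (map emb l)"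
  have "actb h ?r = ?r"
    by (intro equivariant_act_bar relative_part_equivariant cochain_values[OF fm] relative_part_mem h)
  moreover have "restrict_cochain G f = ?r + restrict_cochain G b"
    by (rule restrict_relative_part[OF f b fb])
  ultimately have "actb h (restrict_cochain G f) - restrict_cochain G f = actb h (restrict_cochain G b) - restrict_cochain G b"
    by (simp only: act_bar_linear[OF h] add_diff_cancel_left)
  then show ?thesis
    using complex_vector.subspace_diff[OF subspace_coboundaries[OF linear_complex_sym_bar]
        act_bar_coboundaries[OF h restrict_coboundaries[OF b]] restrict_coboundaries[OF b]] by simp
qed

text \<open>
  The average of \<open>y\<close> over the group is cohomologous to \<open>y\<close>, because the class of \<open>y\<close> is invariant.  It is
  equivariant, so its extension is a cocycle.
\<close>

lemma restrict_surjective: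
  assumes y: "y \<in> cocycles (sym_bar G \<rho>) p"
    and inv: "\<And>h. h \<in> carrier G \<Longrightarrow> actb h y - y \<in> coboundaries (sym_bar G \<rho>) p"
  obtains f where "f \<in> cocycles (skew_bar G \<rho>) p" "restrict_cochain G f - y \<in> coboundaries (sym_bar G \<rho>) p"
proof -
  have ym: "y \<in> multilinear_maps UNIV A p" and dy: "codiff (sym_bar G \<rho>) p y = 0"
    using y by (auto simp: cocycles_def cochains_sym_bar)
  let ?y = "avg (\<lambda>h. actb h y)"
  have m: "?y \<in> multilinear_maps UNIV A p"
    by (intro avg_mem subspace_multilinear_maps subspace_A act_bar_mem ym)
  have eq: "equivariant ?y"
    using equivariant_avg[OF cochain_values[OF ym]] unfolding avg_fun[of "\<lambda>h. actb h y"] .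
  have "codiff (sym_bar G \<rho>) p ?y = avg (\<lambda>h. 0)"
    unfolding codiff_avg by (rule avg_cong) (simp only: act_bar_codiff[OF _ ym] dy act_bar_linear(4))
  then have d: "codiff (sym_bar G \<rho>) p ?y = 0" by (simp only: avg_const)
  have "?y - y = avg (\<lambda>h. actb h y - y)" by (simp only: avg_diff avg_const)
  also have "\<dots> \<in> coboundaries (sym_bar G \<rho>) p"
    by (intro avg_mem subspace_coboundaries linear_complex_sym_bar inv)
  finally have diff: "?y - y \<in> coboundaries (sym_bar G \<rho>) p" .
  let ?f = "cut p (extend \<one> ?y)"
  have "codiff (skew_bar G \<rho>) p ?f = 0"
  proof
    fix xs
    have ext0: "extend \<one> 0 xs = 0" using extend_zero[of \<one> xs] by (simp only: zero_fun_def)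
    show "codiff (skew_bar G \<rho>) p ?f xs = 0 xs"
    proof (cases "length xs = Suc p \<and> set xs \<subseteq> A")
      case True
      then show ?thesis using codiff_cut_extend[OF m eq, of xs] by (simp only: d ext0 zero_fun_apply simp_thms)
    next
      case False
      then show ?thesis by (simp only: codiff_skew_bar if_False zero_fun_apply)
    qed
  qed
  moreover have "?f \<in> multilinear_maps A A p"
    by (rule cut_mem[OF extend_multilinear[OF m one_closed]])
  moreover have "restrict_cochain G ?f = ?y"
  proof
    fix l :: "'v sym list"
    have sub: "set (map emb l) \<subseteq> A" by auto
    show "restrict_cochain G ?f l = ?y l"
    proof (cases "length l = p")
      case True
      then show ?thesis using sub extend_map_emb[OF m True] by (simp only: restrict_cochain_def cut_def length_map simp_thms if_True)
    next
      case False
      then show ?thesis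
        using multilinear_mapsD(2)[OF m, of l] by (simp only: restrict_cochain_def cut_def length_map simp_thms if_False)
    qed
  qed
  ultimately show ?thesis
    using diff by (intro that[of ?f]) (simp_all add: cocycles_def cochains_skew_bar)
qed

theorem skew_bar_cohomology:
  "coh_iso (skew_bar G \<rho>) (sym_bar G \<rho>) p (cohomology (skew_bar G \<rho>) p)
    (coh_invariants G actb (sym_bar G \<rho>) p) (coh_map (sym_bar G \<rho>) p (restrict_cochain G))"
proof (rule coh_isoI[OF linear_complex_skew_bar linear_complex_sym_bar coh_hom_restrict subset_refl])
  note cls = coh_map_class[OF linear_complex_skew_bar linear_complex_sym_bar coh_hom_restrict]
  note coc = coh_hom_cocycle[OF coh_hom_restrict]
  have inv: "coh_class (sym_bar G \<rho>) p y \<in> coh_invariants G actb (sym_bar G \<rho>) p \<longleftrightarrow>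
      (\<forall>h\<in>carrier G. actb h y - y \<in> coboundaries (sym_bar G \<rho>) p)" if "y \<in> cocycles (sym_bar G \<rho>) p" for y
    by (rule coh_invariants_iff[OF linear_complex_sym_bar coh_hom_act_bar that])
  show "bij_betw (coh_map (sym_bar G \<rho>) p (restrict_cochain G)) (cohomology (skew_bar G \<rho>) p)
      (coh_invariants G actb (sym_bar G \<rho>) p)"
    unfolding bij_betw_def
  proof
    show "inj_on (coh_map (sym_bar G \<rho>) p (restrict_cochain G)) (cohomology (skew_bar G \<rho>) p)"
    proof (rule inj_onI)
      fix X Y assume "X \<in> cohomology (skew_bar G \<rho>) p" "Y \<in> cohomology (skew_bar G \<rho>) p"
      then obtain x y where x: "x \<in> cocycles (skew_bar G \<rho>) p" "X = coh_class (skew_bar G \<rho>) p x"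
        and y: "y \<in> cocycles (skew_bar G \<rho>) p" "Y = coh_class (skew_bar G \<rho>) p y"
        unfolding cohomology_iff by blast
      have xy: "x - y \<in> cocycles (skew_bar G \<rho>) p"
        using x y complex_vector.subspace_diff[OF subspace_cocycles[OF linear_complex_skew_bar]] by blast
      assume "coh_map (sym_bar G \<rho>) p (restrict_cochain G) X = coh_map (sym_bar G \<rho>) p (restrict_cochain G) Y"
      then have "coh_class (sym_bar G \<rho>) p (restrict_cochain G x) = coh_class (sym_bar G \<rho>) p (restrict_cochain G y)"
        unfolding x(2) y(2) cls[OF x(1)] cls[OF y(1)] .
      then have "restrict_cochain G x - restrict_cochain G y \<in> coboundaries (sym_bar G \<rho>) p"
        using coh_class_eq_iff[OF linear_complex_sym_bar coc[OF x(1)] coc[OF y(1)]] by blast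
      then have "restrict_cochain G (x - y) \<in> coboundaries (sym_bar G \<rho>) p"
        unfolding coh_hom_diff[OF linear_complex_skew_bar coh_hom_restrict x(1) y(1)] .
      then have "x - y \<in> coboundaries (skew_bar G \<rho>) p" by (rule restrict_injective[OF xy])
      then show "X = Y"
        unfolding x(2) y(2) using coh_class_eq_iff[OF linear_complex_skew_bar x(1) y(1)] by blast
    qed
    show "coh_map (sym_bar G \<rho>) p (restrict_cochain G) ` cohomology (skew_bar G \<rho>) p =
        coh_invariants G actb (sym_bar G \<rho>) p"
    proof (intro subset_antisym subsetI)
      fix Y assume "Y \<in> coh_map (sym_bar G \<rho>) p (restrict_cochain G) ` cohomology (skew_bar G \<rho>) p"
      then obtain X where "X \<in> cohomology (skew_bar G \<rho>) p" and YX: "Y = coh_map (sym_bar G \<rho>) p (restrict_cochain G) X"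
        by (rule imageE)
      then obtain x where x': "x \<in> cocycles (skew_bar G \<rho>) p" "X = coh_class (skew_bar G \<rho>) p x"
        unfolding cohomology_iff by blast
      have x: "x \<in> cocycles (skew_bar G \<rho>) p" "Y = coh_class (sym_bar G \<rho>) p (restrict_cochain G x)"
        using x' YX cls[OF x'(1)] by (simp_all only:)
      show "Y \<in> coh_invariants G actb (sym_bar G \<rho>) p"
        unfolding x(2) inv[OF coc[OF x(1)]] by (intro ballI restrict_invariant x(1))
    next
      fix Y assume Y: "Y \<in> coh_invariants G actb (sym_bar G \<rho>) p"
      then obtain y where y: "y \<in> cocycles (sym_bar G \<rho>) p" "Y = coh_class (sym_bar G \<rho>) p y"
        unfolding coh_invariants_def cohomology_iff by blast
      have "actb h y - y \<in> coboundaries (sym_bar G \<rho>) p" if "h \<in> carrier G" for h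
        using Y[unfolded y(2) inv[OF y(1)]] that by (rule bspec)
      then obtain f where f: "f \<in> cocycles (skew_bar G \<rho>) p"
        "restrict_cochain G f - y \<in> coboundaries (sym_bar G \<rho>) p"
        using restrict_surjective[OF y(1)] by blast
      have "coh_class (sym_bar G \<rho>) p (restrict_cochain G f) = coh_class (sym_bar G \<rho>) p y"
        using coh_class_eq_iff[OF linear_complex_sym_bar coc[OF f(1)] y(1)] f(2) by blast
      then have "Y = coh_map (sym_bar G \<rho>) p (restrict_cochain G) (coh_class (skew_bar G \<rho>) p f)"
        using y(2) cls[OF f(1)] by (simp only:)
      moreover have "coh_class (skew_bar G \<rho>) p f \<in> cohomology (skew_bar G \<rho>) p"
        using f(1) unfolding cohomology_iff by blast
      ultimately show "Y \<in> coh_map (sym_bar G \<rho>) p (restrict_cochain G) ` cohomology (skew_bar G \<rho>) p"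
        by (rule image_eqI)
    qed
  qed
qed

end

section \<open>Antisymmetrization and Upsilon for the skew group algebra\<close>

lemma antisymmetrize_map:
  assumes "length ws = p"
  shows "antisymmetrize p (\<lambda>l. f (map t l)) ws = antisymmetrize p f (map t ws)"
proof -
  have "map t (map (\<lambda>k. ws ! \<pi> k) [0..<p]) = map (\<lambda>k. map t ws ! \<pi> k) [0..<p]" if "\<pi> \<in> {\<pi>. \<pi> permutes {..<p}}" for \<pi>
    using that permutes_in_image[of \<pi> "{..<p}"] assms by simp
  then show ?thesis unfolding antisymmetrize_def by (simp only: cong: sum.cong)
qed

definition increasing_lists :: "nat \<Rightarrow> nat \<Rightarrow> nat \<Rightarrow> nat list set" where
  "increasing_lists n m p = {js. length js = p \<and> sorted_wrt (<) js \<and> set js \<subseteq> {m..<n}}"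

lemma increasing_lists_Suc:
  "increasing_lists n m (Suc p) = (\<lambda>(j, js). j # js) ` (SIGMA j:{m..<n}. increasing_lists n (Suc j) p)"
  by (force simp: increasing_lists_def length_Suc_conv image_iff Sigma_def)

lemma finite_increasing_lists: "finite (increasing_lists n m p)"
  by (rule finite_subset[OF _ finite_lists_length_eq[of "{m..<n}" p]]) (auto simp: increasing_lists_def)

lemma Ups_eq_sum:
  fixes bs :: "'v::complex_vector list" and A E :: "nat \<Rightarrow> 'v sym \<Rightarrow> 'v sym"
  assumes "twisted_differences bs (*) A E u"
  shows "twisted_differences.Ups bs (*) E m \<alpha> fs =
    (\<Sum>js\<in>increasing_lists (length bs) m (length fs). (\<Prod>k<length fs. E (js ! k) (fs ! k)) * \<alpha> (map ((!) bs) js))"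
proof -
  interpret twisted_differences bs "(*)" A E u by fact
  show ?thesis
  proof (induction fs arbitrary: m \<alpha>)
    case Nil
    have "increasing_lists n m 0 = {[]}" by (auto simp: increasing_lists_def)
    then show ?case by simp
  next
    case (Cons f fs)
    have "(\<Sum>js\<in>increasing_lists n m (length (f # fs)). (\<Prod>k<length (f # fs). E (js ! k) ((f # fs) ! k)) * \<alpha> (map ((!) bs) js)) =
        (\<Sum>(j, js)\<in>(SIGMA j:{m..<n}. increasing_lists n (Suc j) (length fs)).
          (\<Prod>k<Suc (length fs). E ((j # js) ! k) ((f # fs) ! k)) * \<alpha> (bs ! j # map ((!) bs) js))"
      unfolding increasing_lists_Suc list.size add_Suc_right add_0_right
      by (subst sum.reindex) (auto simp: inj_on_def intro!: sum.cong)
    also have "\<dots> = (\<Sum>j=m..<n. \<Sum>js\<in>increasing_lists n (Suc j) (length fs).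
          E j f * ((\<Prod>k<length fs. E (js ! k) (fs ! k)) * \<alpha> (bs ! j # map ((!) bs) js)))"
      by (subst sum.Sigma[symmetric]) (auto simp: finite_increasing_lists prod.lessThan_Suc_shift mult.assoc simp del: prod.lessThan_Suc)
    finally show ?case by (simp add: Cons.IH sum_distrib_left)
  qed
qed

context skew_algebra
begin

lemma smul_emb_right_apply:
  assumes "F \<in> A"
  shows "(F \<odot> emb a) k = F k * gact k a"
proof (cases "k \<in> carrier G")
  case True
  have "(F \<odot> emb a) k = (\<Sum>g\<in>carrier G. if g = k then (\<Sum>h\<in>carrier G. if h = \<one> then F k * gact k a else 0) else 0)"
    unfolding smul_apply skew_emb_def skew_single_def
    by (intro sum.cong refl) (auto simp: gact_simps intro!: sum.neutral sum.cong)
  then show ?thesis using True finite_carrier by simp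
next
  case False
  then have "F k = 0" using assms by (simp add: skew_carrier_def)
  moreover have "(F \<odot> emb a) k = 0" using False smul_mem[of F "emb a"] by (simp add: skew_carrier_def del: smul_mem)
  ultimately show ?thesis by simp
qed

abbreviation component_d :: "'g \<Rightarrow> ('v sym list \<Rightarrow> 'v sym) \<Rightarrow> 'v sym list \<Rightarrow> 'v sym" where
  "component_d k \<equiv> bar_d (*) (*) (\<lambda>m a. gact k a * m)"

lemma bar_d_component:
  assumes "\<And>l. F l \<in> A" "xs \<noteq> []"
  shows "bar_d (*) laS raS F xs k = component_d k (\<lambda>l. F l k) xs"
proof -
  have "(\<lambda>m. m k) (bar_d (*) laS raS F xs) = component_d k (\<lambda>l. F l k) (map (\<lambda>x. x) xs)"
    by (rule bar_d_transport[where A = UNIV and T = "\<lambda>m. m k" and t = "\<lambda>x. x"])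
      (use assms in \<open>simp_all add: smul_emb_apply smul_emb_right_apply mult.commute\<close>)
  then show ?thesis by simp
qed

lemma bar_d_mem:
  assumes "\<And>l. F l \<in> A"
  shows "bar_d (*) laS raS F xs \<in> A"
proof -
  have "bdry (*) raS F xs \<in> A" if "\<And>l. F l \<in> A" for F xs
    using that by (induction xs arbitrary: F rule: induct_list012)
      (auto simp: complex_vector.subspace_0[OF subspace_A] intro!: complex_vector.subspace_diff[OF subspace_A])
  then show ?thesis
    unfolding bar_d_def using assms by (intro complex_vector.subspace_diff[OF subspace_A]) auto
qed

lemma sym_koszul_eq: "sym_koszul G \<rho> = koszul_complex A laS raS"
  by (simp add: sym_koszul_def)

lemma linear_complex_sym_koszul: "linear_complex (sym_koszul G \<rho>)"
  unfolding sym_koszul_eq by (intro linear_complex_koszul subspace_A clinear_laS clinear_raS)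

lemma cochains_sym_koszul: "cochains (sym_koszul G \<rho>) p = alternating_maps A p"
  by (simp add: sym_koszul_eq koszul_complex_def)

lemma coh_hom_phi: "coh_hom (sym_bar G \<rho>) (sym_koszul G \<rho>) p (phi_star p)"
  unfolding sym_koszul_eq sym_bar_eq by (intro coh_hom_phi_star subspace_A clinear_laS clinear_raS)

lemma phi_coboundaries:
  assumes "x \<in> coboundaries (sym_bar G \<rho>) p"
  shows "phi_star p x \<in> coboundaries (sym_koszul G \<rho>) p"
  using assms unfolding sym_koszul_eq sym_bar_eq
  by (intro phi_star_coboundaries subspace_A clinear_laS clinear_raS)

lemma phi_star_apply:
  fixes k :: 'g and f :: "'v sym list \<Rightarrow> 'g \<Rightarrow> 'v sym"
  shows "phi_star p f ws k = phi_star p (\<lambda>l. f l k) ws"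
proof -
  have "clinear (\<lambda>F :: 'g \<Rightarrow> 'v sym. F k)" by (simp add: clinear_iff scaleC_fun_def)
  from phi_star_linear_image[OF this, of p f] show ?thesis by simp
qed

lemma phi_star_act:
  assumes h: "h \<in> carrier G"
  shows "phi_star p (actb h f) = act_koszul G \<rho> h (phi_star p f)"
proof
  fix ws
  have inv: "clinear (\<rho> (inv h))" using h by (simp add: clinear_action)
  show "phi_star p (actb h f) ws = act_koszul G \<rho> h (phi_star p f) ws"
  proof (cases "length ws = p")
    case True
    then have len: "length (map sym_incl ws) = p" by simp
    have "phi_star p (actb h f) ws = skew_act G \<rho> h (antisymmetrize p (\<lambda>l. f (map (gact (inv h)) l)) (map sym_incl ws))"
      unfolding phi_star_eq act_bar_def antisymmetrize_linear[OF clinear_skew_act[OF h]] using True by (simp only: if_True refl)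
    also have "\<dots> = skew_act G \<rho> h (antisymmetrize p f (map (gact (inv h)) (map sym_incl ws)))"
      unfolding antisymmetrize_map[OF len] ..
    also have "map (gact (inv h)) (map sym_incl ws) = map sym_incl (map (\<rho> (inv h)) ws)"
      by (simp add: sym_map_incl[OF inv])
    finally show ?thesis
      unfolding act_koszul_def phi_star_eq length_map using True by (simp only: if_True refl)
  next
    case False
    then show ?thesis
      unfolding act_koszul_def phi_star_eq length_map by (simp only: if_False clinearD(3)[OF clinear_skew_act[OF h]])
  qed
qed

lemma component_bimodule:
  "pointwise_bimodule {w :: 'v shifted. \<forall>l. l \<noteq> [] \<longrightarrow> w l = 0} (\<lambda>x (w :: 'v shifted) l. x * w l)"
  by (rule pointwise_bimodule.intro)
    (auto simp: complex_vector.subspace_def clinear_iff fun_eq_iff scaleC_fun_def distrib_left distrib_right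
      sym_scale_mult ac_simps)

text \<open>
  The component of a cochain at \<open>k\<close> takes values in \<open>S(V)\<close>; it is treated as a function of a list
  that vanishes away from the empty list.
\<close>

lemma phi_star_injective:
  fixes bs :: "'g \<Rightarrow> 'v list"
  assumes basis: "\<And>g. g \<in> carrier G \<Longrightarrow> ordered_basis (bs g)"
    and f: "f \<in> cocycles (sym_bar G \<rho>) p" and phi: "phi_star p f = 0"
  shows "f \<in> coboundaries (sym_bar G \<rho>) p"
proof -
  have fm: "f \<in> multilinear_maps UNIV A p" and df: "codiff (sym_bar G \<rho>) p f = 0"
    using f by (auto simp: cocycles_def cochains_sym_bar)
  let ?N = "{w :: 'v shifted. \<forall>l. l \<noteq> [] \<longrightarrow> w l = 0}" and ?L = "\<lambda>x (w :: 'v shifted) l. x * w l"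
  let ?emb = "\<lambda>k (F :: 'g \<Rightarrow> 'v sym) l. if l = ([] :: 'v sym list) then F k else 0"
  have lin: "clinear (?emb k)" for k
    by (simp add: clinear_iff fun_eq_iff scaleC_fun_def)
  have cob: "(\<lambda>xs. ?emb k (f xs)) \<in> coboundaries (bar_complex UNIV (*) ?N ?L (right_mult (\<rho> k))) p"
    if k: "k \<in> carrier G" for k
  proof (rule pointwise_cocycle_trivial[OF basis[OF k] clinear_action[OF k] component_bimodule])
    show "(\<lambda>xs. ?emb k (f xs)) \<in> multilinear_maps UNIV ?N p"
      by (rule multilinear_maps_linear_image[OF fm lin]) simp
    show "phi_star p (\<lambda>xs. ?emb k (f xs)) = 0"
      unfolding phi_star_linear_image[OF lin] phi by (simp only: zero_fun_apply if_cancel) (simp only: zero_fun_def)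
    show "codiff (bar_complex UNIV (*) ?N ?L (right_mult (\<rho> k))) p (\<lambda>xs. ?emb k (f xs)) = 0"
    proof
      fix xs
      show "codiff (bar_complex UNIV (*) ?N ?L (right_mult (\<rho> k))) p (\<lambda>xs. ?emb k (f xs)) xs = 0 xs"
      proof (cases "length xs = Suc p")
        case True
        then have ne: "xs \<noteq> []" by auto
        have "?emb k (bar_d (*) laS raS f xs) = bar_d (*) ?L (right_mult (\<rho> k)) (\<lambda>xs. ?emb k (f xs)) (map (\<lambda>x. x) xs)"
          by (rule bar_d_transport[where A = UNIV and T = "?emb k" and t = "\<lambda>x. x"])
            (use ne cochain_values[OF fm] in \<open>simp_all add: fun_eq_iff smul_emb_apply smul_emb_right_apply right_mult_def mult.commute\<close>)
        moreover have "bar_d (*) laS raS f xs = 0"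
          using fun_cong[OF df, of xs] True unfolding codiff_sym_bar zero_fun_apply by (simp only: if_True refl)
        ultimately have "bar_d (*) ?L (right_mult (\<rho> k)) (\<lambda>xs. ?emb k (f xs)) xs = 0"
          using clinearD(3)[OF lin, of k] by (simp only: list.map_ident)
        then show ?thesis
          unfolding codiff_bar zero_fun_apply using True by (simp only: subset_UNIV simp_thms if_True)
      next
        case False
        then show ?thesis unfolding codiff_bar zero_fun_apply by (simp only: simp_thms if_False)
      qed
    qed
  qed
  show ?thesis
  proof (cases p)
    case 0
    have "f xs k = 0" for xs k
    proof (cases "k \<in> carrier G")
      case True
      then have "(\<lambda>xs. ?emb k (f xs)) = 0" using cob 0 by (simp add: coboundaries_def)
      from fun_cong[OF fun_cong[OF this, of xs], of "[]"] show ?thesis by simp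
    next
      case False
      then show ?thesis using cochain_values[OF fm, of xs] by (simp add: skew_carrier_def)
    qed
    then have "f = 0" by (intro ext) simp
    then show ?thesis using 0 by (simp add: coboundaries_def)
  next
    case (Suc q)
    have "\<forall>k\<in>carrier G. \<exists>h. h \<in> multilinear_maps UNIV ?N q \<and>
        (\<lambda>xs. ?emb k (f xs)) = codiff (bar_complex UNIV (*) ?N ?L (right_mult (\<rho> k))) q h"
    proof
      fix k assume "k \<in> carrier G"
      from cob[OF this] show "\<exists>h. h \<in> multilinear_maps UNIV ?N q \<and>
          (\<lambda>xs. ?emb k (f xs)) = codiff (bar_complex UNIV (*) ?N ?L (right_mult (\<rho> k))) q h"
        unfolding Suc coboundaries_def bar_complex_def[of UNIV "(*)" ?N] nat.case cochain_complex.select_convs by blast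
    qed
    from bchoice[OF this] obtain h where h: "\<And>k. k \<in> carrier G \<Longrightarrow> h k \<in> multilinear_maps UNIV ?N q"
      and fh: "\<And>k. k \<in> carrier G \<Longrightarrow> (\<lambda>xs. ?emb k (f xs)) = codiff (bar_complex UNIV (*) ?N ?L (right_mult (\<rho> k))) q (h k)"
      by blast
    let ?h = "\<lambda>xs k. if k \<in> carrier G then h k xs [] else 0"
    have hA: "?h xs \<in> A" for xs by (simp add: skew_carrier_def)
    have hm: "?h \<in> multilinear_maps UNIV A q"
    proof -
      have "h k (xs @ (x + y) # ys) [] = h k (xs @ x # ys) [] + h k (xs @ y # ys) []"
        "h k (xs @ (a *\<^sub>C x) # ys) [] = a *\<^sub>C h k (xs @ x # ys) []"
        if "length xs + Suc (length ys) = q" "k \<in> carrier G" for k xs ys x y a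
        using h[OF that(2)] that(1) by (simp_all add: multilinear_maps_def scaleC_fun_def)
      moreover have "h k xs [] = 0" if "length xs \<noteq> q" "k \<in> carrier G" for k xs
        using multilinear_mapsD(2)[OF h[OF that(2)], of xs] that(1) by simp
      ultimately show ?thesis
        by (auto simp: multilinear_maps_def hA fun_eq_iff scaleC_fun_def)
    qed
    have "f = codiff (sym_bar G \<rho>) q ?h"
    proof (intro ext)
      fix xs k
      show "f xs k = codiff (sym_bar G \<rho>) q ?h xs k"
      proof (cases "length xs = Suc q \<and> k \<in> carrier G")
        case True
        then have ne: "xs \<noteq> []" and k: "k \<in> carrier G" and len: "length xs = Suc q" by auto
        have "f xs k = bar_d (*) ?L (right_mult (\<rho> k)) (h k) xs []"
          using fun_cong[OF fun_cong[OF fh[OF k], of xs], of "[]"] len by (simp add: codiff_bar)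
        also have "\<dots> = component_d k (\<lambda>l. h k l []) xs"
        proof -
          have "(\<lambda>w. w []) (bar_d (*) ?L (right_mult (\<rho> k)) (h k) xs) = component_d k (\<lambda>l. h k l []) (map (\<lambda>x. x) xs)"
            by (rule bar_d_transport[where A = UNIV and T = "\<lambda>w. w []" and t = "\<lambda>x. x"]) (use ne in \<open>simp_all add: right_mult_def\<close>)
          then show ?thesis by simp
        qed
        also have "\<dots> = bar_d (*) laS raS ?h xs k"
          unfolding bar_d_component[of ?h, OF hA ne] using k by simp
        finally show ?thesis using len by (simp add: codiff_sym_bar)
      next
        case False
        have "bar_d (*) laS raS ?h xs \<in> A" by (rule bar_d_mem[OF hA])
        moreover have "f xs = 0" if "length xs \<noteq> Suc q"
          using multilinear_mapsD(2)[OF fm, of xs] that Suc by simp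
        ultimately show ?thesis
          using False cochain_values[OF fm, of xs] by (auto simp: codiff_sym_bar skew_carrier_def)
      qed
    qed
    then show ?thesis
      unfolding coboundaries_def Suc nat.case cochains_sym_bar by (rule image_eqI[OF _ hm])
  qed
qed

end

context skew_algebra
begin

context
  fixes b :: "'g \<Rightarrow> 'v list" and eps :: "'g \<Rightarrow> nat \<Rightarrow> complex"
  assumes eigen: "\<And>g. g \<in> carrier G \<Longrightarrow> eigenbasis (\<rho> g) (b g) (eps g)"
begin

abbreviation Pact :: "'g \<Rightarrow> nat \<Rightarrow> 'v sym \<Rightarrow> 'v sym" where "Pact g \<equiv> partial_action (b g) (eps g)"

abbreviation Qder :: "'g \<Rightarrow> nat \<Rightarrow> 'v sym \<Rightarrow> 'v sym" where
  "Qder g j f \<equiv> Pact g j (quantum_deriv (b g) (eps g) j f)"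

abbreviation Comp :: "'g \<Rightarrow> ('v list \<Rightarrow> 'v sym) \<Rightarrow> 'v sym list \<Rightarrow> 'v sym" where
  "Comp g \<equiv> twisted_differences.Ups (b g) (*) (Qder g) 0"

lemma eigen_basis: "g \<in> carrier G \<Longrightarrow> ordered_basis (b g)"
  using eigen by (simp add: eigenbasis_def ordered_basis_def)

lemma differences:
  assumes "g \<in> carrier G"
  shows "twisted_differences (b g) (*) (Pact g) (Qder g) (\<lambda>j. (1 - eps g j) *\<^sub>C sym_incl (b g ! j))"
  by (rule quantum_differences[OF eigen_basis[OF assms]])

lemma Pact_0: "Pact g 0 f = f"
  by (simp add: partial_action_def)

lemma Pact_length: "g \<in> carrier G \<Longrightarrow> Pact g (length (b g)) f = gact g f"
  using eigen[of g] by (intro partial_action_length eigen_basis clinear_action) (auto simp: eigenbasis_def)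

lemma upsilon_apply:
  "upsilon G b eps p \<alpha> fs k = (if length fs = p \<and> k \<in> carrier G then Comp k (\<lambda>ws. \<alpha> ws k) fs else 0)"
proof -
  have "upsilon_component (b k) (eps k) p (\<lambda>ws. \<alpha> ws k) fs = Comp k (\<lambda>ws. \<alpha> ws k) fs"
    if "length fs = p" "k \<in> carrier G"
    unfolding Ups_eq_sum[OF differences[OF that(2)]]
    unfolding upsilon_component_def increasing_lists_def partial_action_def
    using that(1) by (simp add: lessThan_atLeast0)
  moreover have "upsilon G b eps p \<alpha> fs k =
      (if k \<in> carrier G then upsilon_component (b k) (eps k) p (\<lambda>ws. \<alpha> ws k) fs else 0)" if "length fs = p"
    unfolding upsilon_def using that finite_carrier by (simp add: sum_fun skew_single_def)
  moreover have "upsilon G b eps p \<alpha> fs k = 0" if "length fs \<noteq> p"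
    unfolding upsilon_def using that by simp
  ultimately show ?thesis by (cases "length fs = p") auto
qed

lemma alternating_component:
  assumes "\<alpha> \<in> alternating_maps A p"
  shows "(\<lambda>ws. \<alpha> ws k) \<in> alternating_maps UNIV p"
  using assms by (auto simp: alternating_maps_def multilinear_maps_def scaleC_fun_def)

lemma upsilon_component_eq:
  assumes \<alpha>: "\<alpha> \<in> alternating_maps A p" and k: "k \<in> carrier G"
  shows "(\<lambda>fs. upsilon G b eps p \<alpha> fs k) = Comp k (\<lambda>ws. \<alpha> ws k)"
proof
  fix fs
  interpret twisted_differences "b k" "(*)" "Pact k" "Qder k" "\<lambda>j. (1 - eps k j) *\<^sub>C sym_incl (b k ! j)"
    by (rule differences[OF k])
  have "Comp k (\<lambda>ws. \<alpha> ws k) \<in> multilinear_maps UNIV UNIV p"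
    using alternating_component[OF \<alpha>, of k] by (intro Ups_multilinear) (auto simp: alternating_maps_def)
  then have "Comp k (\<lambda>ws. \<alpha> ws k) fs = 0" if "length fs \<noteq> p"
    using that multilinear_mapsD(2) by blast
  then show "upsilon G b eps p \<alpha> fs k = Comp k (\<lambda>ws. \<alpha> ws k) fs"
    using k by (simp add: upsilon_apply)
qed

lemma upsilon_values: "upsilon G b eps p \<alpha> fs \<in> A"
  by (simp add: skew_carrier_def upsilon_apply)

lemma upsilon_mem:
  assumes \<alpha>: "\<alpha> \<in> alternating_maps A p"
  shows "upsilon G b eps p \<alpha> \<in> multilinear_maps UNIV A p"
proof -
  have slot: "upsilon G b eps p \<alpha> (xs @ (x + y) # ys) k = upsilon G b eps p \<alpha> (xs @ x # ys) k + upsilon G b eps p \<alpha> (xs @ y # ys) k"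
    "upsilon G b eps p \<alpha> (xs @ (a *\<^sub>C x) # ys) k = a *\<^sub>C upsilon G b eps p \<alpha> (xs @ x # ys) k"
    if len: "length xs + Suc (length ys) = p" for xs ys x y a k
  proof -
    have "(\<lambda>fs. upsilon G b eps p \<alpha> fs k) \<in> multilinear_maps UNIV UNIV p"
    proof (cases "k \<in> carrier G")
      case True
      interpret twisted_differences "b k" "(*)" "Pact k" "Qder k" "\<lambda>j. (1 - eps k j) *\<^sub>C sym_incl (b k ! j)"
        by (rule differences[OF True])
      show ?thesis
        unfolding upsilon_component_eq[OF \<alpha> True]
        using alternating_component[OF \<alpha>, of k] by (intro Ups_multilinear) (auto simp: alternating_maps_def)
    next
      case False
      then show ?thesis by (simp add: upsilon_apply multilinear_maps_def)
    qed
    then show "upsilon G b eps p \<alpha> (xs @ (x + y) # ys) k = upsilon G b eps p \<alpha> (xs @ x # ys) k + upsilon G b eps p \<alpha> (xs @ y # ys) k"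
      "upsilon G b eps p \<alpha> (xs @ (a *\<^sub>C x) # ys) k = a *\<^sub>C upsilon G b eps p \<alpha> (xs @ x # ys) k"
      using len by (simp_all add: multilinear_maps_def)
  qed
  have "upsilon G b eps p \<alpha> xs = 0" if "length xs \<noteq> p" for xs
    by (rule ext) (simp add: upsilon_apply that)
  then show ?thesis
    by (simp add: multilinear_maps_def upsilon_values) (simp add: fun_eq_iff slot scaleC_fun_def)
qed

lemma upsilon_codiff:
  assumes \<alpha>: "\<alpha> \<in> alternating_maps A p"
  shows "codiff (sym_bar G \<rho>) p (upsilon G b eps p \<alpha>) = upsilon G b eps (Suc p) (codiff (sym_koszul G \<rho>) p \<alpha>)"
proof (intro ext)
  fix fs k
  let ?\<kappa> = "codiff (sym_koszul G \<rho>) p \<alpha>"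
  show "codiff (sym_bar G \<rho>) p (upsilon G b eps p \<alpha>) fs k = upsilon G b eps (Suc p) ?\<kappa> fs k"
  proof (cases "length fs = Suc p \<and> k \<in> carrier G")
    case True
    then obtain f l where fs: "fs = f # l" "length l = p" by (cases fs) auto
    have k: "k \<in> carrier G" using True by simp
    interpret twisted_differences "b k" "(*)" "Pact k" "Qder k" "\<lambda>j. (1 - eps k j) *\<^sub>C sym_incl (b k ! j)"
      by (rule differences[OF k])
    let ?a = "\<lambda>ws. \<alpha> ws k"
    have \<alpha>A: "\<alpha> l \<in> A" for l
      using \<alpha> cochain_values[of \<alpha> UNIV p l] by (simp add: alternating_maps_def)
    have "codiff (sym_bar G \<rho>) p (upsilon G b eps p \<alpha>) fs k = component_d k (Comp k ?a) fs"
      using True bar_d_component[of "upsilon G b eps p \<alpha>" fs k, OF upsilon_values]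
      unfolding codiff_sym_bar upsilon_component_eq[OF \<alpha> k] by (simp add: fs)
    also have "\<dots> = Comp k (kd ?a) fs"
      using Ups_chain[of 0 f ?a l] by (simp add: bar_d_def fs Pact_0 Pact_length[OF k])
    also have "\<dots> = Comp k (\<lambda>ws. ?\<kappa> ws k) fs"
    proof (rule Ups_cong)
      fix ws :: "'v list" assume ws: "length ws = length fs"
      have "?\<kappa> ws k = altsum (\<lambda>w l. laS (sym_incl w) (\<alpha> l) - raS (\<alpha> l) (sym_incl w)) ws k"
        using ws True by (simp add: sym_koszul_eq codiff_koszul)
      also have "\<dots> = altsum (\<lambda>w l. (laS (sym_incl w) (\<alpha> l) - raS (\<alpha> l) (sym_incl w)) k) ws"
        by (rule altsum_additive[where T = "\<lambda>F. F k", symmetric]) simp_all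
      also have "\<dots> = kd ?a ws"
        by (rule altsum_cong)
          (simp add: smul_emb_apply \<alpha>A smul_emb_right_apply Pact_0 Pact_length[OF k] mult.commute)
      finally show "kd ?a ws = ?\<kappa> ws k" by simp
    qed
    finally show ?thesis using True by (simp add: upsilon_apply)
  next
    case False
    then show ?thesis
      using bar_d_mem[of "upsilon G b eps p \<alpha>" fs, OF upsilon_values] by (auto simp: codiff_sym_bar upsilon_apply skew_carrier_def)
  qed
qed

lemma phi_star_upsilon:
  assumes \<alpha>: "\<alpha> \<in> alternating_maps A p"
  shows "phi_star p (upsilon G b eps p \<alpha>) = \<alpha>"
proof (intro ext)
  fix ws k
  show "phi_star p (upsilon G b eps p \<alpha>) ws k = \<alpha> ws k"
  proof (cases "k \<in> carrier G")
    case True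
    interpret twisted_differences "b k" "(*)" "Pact k" "Qder k" "\<lambda>j. (1 - eps k j) *\<^sub>C sym_incl (b k ! j)"
      by (rule differences[OF True])
    show ?thesis
      unfolding phi_star_apply upsilon_component_eq[OF \<alpha> True] phi_star_Ups[OF alternating_component[OF \<alpha>]] ..
  next
    case False
    have "\<alpha> ws \<in> A" using \<alpha> cochain_values[of \<alpha> UNIV p ws] by (simp add: alternating_maps_def)
    then have "\<alpha> ws k = 0" using False by (simp add: skew_carrier_def)
    moreover have "phi_star p (upsilon G b eps p \<alpha>) ws k = 0"
    proof -
      have "(\<lambda>l. upsilon G b eps p \<alpha> l k) = (\<lambda>l. 0)" using False by (simp add: upsilon_apply)
      then show ?thesis unfolding phi_star_apply by (simp add: phi_star_eq antisymmetrize_def)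
    qed
    ultimately show ?thesis by simp
  qed
qed

lemma Comp_linear:
  assumes "k \<in> carrier G"
  shows "Comp k (\<lambda>l. \<alpha> l + \<beta> l) fs = Comp k \<alpha> fs + Comp k \<beta> fs" "Comp k (\<lambda>l. c *\<^sub>C \<alpha> l) fs = c *\<^sub>C Comp k \<alpha> fs"
    "Comp k (\<lambda>l. 0) fs = 0"
  using twisted_differences.Ups_add[OF differences[OF assms]] twisted_differences.Ups_scale[OF differences[OF assms]]
    twisted_differences.Ups_zero[OF differences[OF assms]] by blast+

lemma upsilon_linear:
  "upsilon G b eps p (\<alpha> + \<beta>) = upsilon G b eps p \<alpha> + upsilon G b eps p \<beta>"
  "upsilon G b eps p (c *\<^sub>C \<alpha>) = c *\<^sub>C upsilon G b eps p \<alpha>"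
  "upsilon G b eps p 0 = 0"
  by (intro ext, simp add: upsilon_apply Comp_linear scaleC_fun_def)+

lemma upsilon_coboundaries:
  assumes "\<alpha> \<in> coboundaries (sym_koszul G \<rho>) p"
  shows "upsilon G b eps p \<alpha> \<in> coboundaries (sym_bar G \<rho>) p"
proof (cases p)
  case 0
  then show ?thesis using assms upsilon_linear(3) by (simp add: coboundaries_def)
next
  case (Suc q)
  then obtain \<beta> where \<beta>: "\<beta> \<in> alternating_maps A q" and "\<alpha> = codiff (sym_koszul G \<rho>) q \<beta>"
    using assms by (auto simp: coboundaries_def cochains_sym_koszul)
  then have "upsilon G b eps p \<alpha> = codiff (sym_bar G \<rho>) q (upsilon G b eps q \<beta>)"
    by (simp only: Suc upsilon_codiff)
  then show ?thesis
    unfolding coboundaries_def Suc nat.case cochains_sym_bar by (rule image_eqI[OF _ upsilon_mem[OF \<beta>]])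
qed

lemma coh_hom_upsilon: "coh_hom (sym_koszul G \<rho>) (sym_bar G \<rho>) p (upsilon G b eps p)"
  unfolding coh_hom_def
proof (intro conjI ballI allI impI upsilon_linear upsilon_coboundaries)
  fix \<alpha> assume "\<alpha> \<in> cocycles (sym_koszul G \<rho>) p"
  then have \<alpha>: "\<alpha> \<in> alternating_maps A p" and "codiff (sym_koszul G \<rho>) p \<alpha> = 0"
    by (auto simp: cocycles_def cochains_sym_koszul)
  then have "codiff (sym_bar G \<rho>) p (upsilon G b eps p \<alpha>) = 0"
    by (simp only: upsilon_codiff upsilon_linear)
  then show "upsilon G b eps p \<alpha> \<in> cocycles (sym_bar G \<rho>) p"
    using upsilon_mem[OF \<alpha>] by (simp add: cocycles_def cochains_sym_bar)
qed

text \<open>Subtracting \<open>\<Upsilon>(\<Phi>\<^sup>* z)\<close> from \<open>z\<close> makes the antisymmetrization vanish.\<close>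

lemma phi_star_reflects_coboundaries:
  assumes z: "z \<in> cocycles (sym_bar G \<rho>) p" and phi: "phi_star p z \<in> coboundaries (sym_koszul G \<rho>) p"
  shows "z \<in> coboundaries (sym_bar G \<rho>) p"
proof -
  let ?u = "upsilon G b eps p (phi_star p z)"
  have \<alpha>: "phi_star p z \<in> cocycles (sym_koszul G \<rho>) p" by (rule coh_hom_cocycle[OF coh_hom_phi z])
  then have alt: "phi_star p z \<in> alternating_maps A p" by (simp add: cocycles_def cochains_sym_koszul)
  have "z - ?u \<in> cocycles (sym_bar G \<rho>) p"
    by (rule complex_vector.subspace_diff[OF subspace_cocycles[OF linear_complex_sym_bar] z coh_hom_cocycle[OF coh_hom_upsilon \<alpha>]])
  moreover have "phi_star p (z - ?u) = 0"
    unfolding phi_star_diff phi_star_upsilon[OF alt] by (rule diff_self)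
  ultimately have "z - ?u \<in> coboundaries (sym_bar G \<rho>) p"
    by (intro phi_star_injective[where bs = b] eigen_basis)
  from complex_vector.subspace_add[OF subspace_coboundaries[OF linear_complex_sym_bar] this upsilon_coboundaries[OF phi]]
  show ?thesis by (simp only: diff_add_cancel)
qed

text \<open>On alternating cochains the action of \<open>h\<close> is \<open>\<Phi>\<^sup>* \<circ> h \<circ> \<Upsilon>\<close>, a composition of cochain maps.\<close>

lemma coh_hom_act_koszul:
  assumes h: "h \<in> carrier G"
  shows "coh_hom (sym_koszul G \<rho>) (sym_koszul G \<rho>) p (act_koszul G \<rho> h)"
proof -
  have factor: "act_koszul G \<rho> h \<alpha> = phi_star p (actb h (upsilon G b eps p \<alpha>))" if "\<alpha> \<in> alternating_maps A p" for \<alpha>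
    unfolding phi_star_act[OF h] phi_star_upsilon[OF that] ..
  have alt: "\<alpha> \<in> alternating_maps A p" if "\<alpha> \<in> cocycles (sym_koszul G \<rho>) p" for \<alpha>
    using that by (simp add: cocycles_def cochains_sym_koszul)
  show ?thesis
    unfolding coh_hom_def
  proof (intro conjI ballI allI impI)
    fix \<alpha> \<beta> c assume \<alpha>: "\<alpha> \<in> cocycles (sym_koszul G \<rho>) p"
    show "act_koszul G \<rho> h \<alpha> \<in> cocycles (sym_koszul G \<rho>) p"
      unfolding factor[OF alt[OF \<alpha>]]
      by (intro coh_hom_cocycle[OF coh_hom_phi] coh_hom_cocycle[OF coh_hom_act_bar[OF h]] coh_hom_cocycle[OF coh_hom_upsilon] \<alpha>)
    show "act_koszul G \<rho> h (\<alpha> + \<beta>) = act_koszul G \<rho> h \<alpha> + act_koszul G \<rho> h \<beta>"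
      "act_koszul G \<rho> h (c *\<^sub>C \<alpha>) = c *\<^sub>C act_koszul G \<rho> h \<alpha>"
      by (rule ext, simp only: act_koszul_def plus_fun_apply scaleC_fun_apply clinearD[OF clinear_skew_act[OF h]])+
    show "act_koszul G \<rho> h \<alpha> \<in> coboundaries (sym_koszul G \<rho>) p" if "\<alpha> \<in> coboundaries (sym_koszul G \<rho>) p"
      unfolding factor[OF alt[OF \<alpha>]]
      by (intro phi_coboundaries act_bar_coboundaries[OF h] upsilon_coboundaries that)
  qed
qed

text \<open>
  Composing in one order gives the identity on cochains, and in the other order the identity up to the
  kernel of \<open>\<Phi>\<^sup>*\<close>, which is zero in cohomology.  Only \<open>\<Phi>\<^sup>*\<close> commutes with the action on cochains: the
  bases that define \<open>\<Upsilon>\<close> are not related by the action.  That \<open>\<Upsilon>\<close> preserves invariant classes is deduced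
  from \<open>\<Phi>\<^sup>*\<close> being injective.
\<close>

theorem upsilon_phi_star_inverse:
  "inverse_coh_isos (sym_koszul G \<rho>) (sym_bar G \<rho>) p
      (cohomology (sym_koszul G \<rho>) p) (cohomology (sym_bar G \<rho>) p)
      (coh_map (sym_bar G \<rho>) p (upsilon G b eps p)) (coh_map (sym_koszul G \<rho>) p (phi_star p))"
  "inverse_coh_isos (sym_koszul G \<rho>) (sym_bar G \<rho>) p
      (coh_invariants G (act_koszul G \<rho>) (sym_koszul G \<rho>) p)
      (coh_invariants G (act_bar G \<rho>) (sym_bar G \<rho>) p)
      (coh_map (sym_bar G \<rho>) p (upsilon G b eps p)) (coh_map (sym_koszul G \<rho>) p (phi_star p))"
proof -
  note K = linear_complex_sym_koszul and L = linear_complex_sym_bar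
  note clsU = coh_map_class[OF K L coh_hom_upsilon] and clsP = coh_map_class[OF L K coh_hom_phi]
  note cocU = coh_hom_cocycle[OF coh_hom_upsilon] and cocP = coh_hom_cocycle[OF coh_hom_phi]
  have alt: "\<alpha> \<in> alternating_maps A p" if "\<alpha> \<in> cocycles (sym_koszul G \<rho>) p" for \<alpha>
    using that by (simp add: cocycles_def cochains_sym_koszul)
  have left: "phi_star p (upsilon G b eps p x) - x \<in> coboundaries (sym_koszul G \<rho>) p"
    if "x \<in> cocycles (sym_koszul G \<rho>) p" for x
    unfolding phi_star_upsilon[OF alt[OF that]] diff_self
    by (rule complex_vector.subspace_0[OF subspace_coboundaries[OF K]])
  have right: "upsilon G b eps p (phi_star p y) - y \<in> coboundaries (sym_bar G \<rho>) p"
    if y: "y \<in> cocycles (sym_bar G \<rho>) p" for y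
  proof (rule phi_star_reflects_coboundaries)
    show "upsilon G b eps p (phi_star p y) - y \<in> cocycles (sym_bar G \<rho>) p"
      by (rule complex_vector.subspace_diff[OF subspace_cocycles[OF L] cocU[OF cocP[OF y]] y])
    show "phi_star p (upsilon G b eps p (phi_star p y) - y) \<in> coboundaries (sym_koszul G \<rho>) p"
      unfolding phi_star_diff phi_star_upsilon[OF alt[OF cocP[OF y]]] diff_self
      by (rule complex_vector.subspace_0[OF subspace_coboundaries[OF K]])
  qed
  have mapU: "coh_map (sym_bar G \<rho>) p (upsilon G b eps p) X \<in> cohomology (sym_bar G \<rho>) p"
    if "X \<in> cohomology (sym_koszul G \<rho>) p" for X
    using that clsU cocU unfolding cohomology_iff by blast
  have mapP: "coh_map (sym_koszul G \<rho>) p (phi_star p) Y \<in> cohomology (sym_koszul G \<rho>) p"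
    if "Y \<in> cohomology (sym_bar G \<rho>) p" for Y
    using that clsP cocP unfolding cohomology_iff by blast
  show "inverse_coh_isos (sym_koszul G \<rho>) (sym_bar G \<rho>) p
      (cohomology (sym_koszul G \<rho>) p) (cohomology (sym_bar G \<rho>) p)
      (coh_map (sym_bar G \<rho>) p (upsilon G b eps p)) (coh_map (sym_koszul G \<rho>) p (phi_star p))"
    by (rule inverse_coh_isosI[OF K L coh_hom_upsilon coh_hom_phi left right subset_refl subset_refl mapU mapP])
  have invK: "coh_class (sym_koszul G \<rho>) p x \<in> coh_invariants G (act_koszul G \<rho>) (sym_koszul G \<rho>) p \<longleftrightarrow>
      (\<forall>h\<in>carrier G. act_koszul G \<rho> h x - x \<in> coboundaries (sym_koszul G \<rho>) p)"
    if "x \<in> cocycles (sym_koszul G \<rho>) p" for x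
    by (rule coh_invariants_iff[OF K coh_hom_act_koszul that])
  have invL: "coh_class (sym_bar G \<rho>) p y \<in> coh_invariants G (act_bar G \<rho>) (sym_bar G \<rho>) p \<longleftrightarrow>
      (\<forall>h\<in>carrier G. actb h y - y \<in> coboundaries (sym_bar G \<rho>) p)" if "y \<in> cocycles (sym_bar G \<rho>) p" for y
    by (rule coh_invariants_iff[OF L coh_hom_act_bar that])
  have invU: "coh_map (sym_bar G \<rho>) p (upsilon G b eps p) X \<in> coh_invariants G (act_bar G \<rho>) (sym_bar G \<rho>) p"
    if X: "X \<in> coh_invariants G (act_koszul G \<rho>) (sym_koszul G \<rho>) p" for X
  proof -
    obtain x where x: "x \<in> cocycles (sym_koszul G \<rho>) p" "X = coh_class (sym_koszul G \<rho>) p x"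
      using X unfolding coh_invariants_def cohomology_iff by blast
    have "actb h (upsilon G b eps p x) - upsilon G b eps p x \<in> coboundaries (sym_bar G \<rho>) p" if h: "h \<in> carrier G" for h
    proof (rule phi_star_reflects_coboundaries)
      show "actb h (upsilon G b eps p x) - upsilon G b eps p x \<in> cocycles (sym_bar G \<rho>) p"
        by (rule complex_vector.subspace_diff[OF subspace_cocycles[OF L] coh_hom_cocycle[OF coh_hom_act_bar[OF h] cocU[OF x(1)]] cocU[OF x(1)]])
      show "phi_star p (actb h (upsilon G b eps p x) - upsilon G b eps p x) \<in> coboundaries (sym_koszul G \<rho>) p"
        unfolding phi_star_diff phi_star_act[OF h] phi_star_upsilon[OF alt[OF x(1)]]
        using X[unfolded x(2) invK[OF x(1)]] h by (rule bspec)
    qed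
    then show ?thesis
      unfolding x(2) clsU[OF x(1)] invL[OF cocU[OF x(1)]] by blast
  qed
  have invP: "coh_map (sym_koszul G \<rho>) p (phi_star p) Y \<in> coh_invariants G (act_koszul G \<rho>) (sym_koszul G \<rho>) p"
    if Y: "Y \<in> coh_invariants G (act_bar G \<rho>) (sym_bar G \<rho>) p" for Y
  proof -
    obtain y where y: "y \<in> cocycles (sym_bar G \<rho>) p" "Y = coh_class (sym_bar G \<rho>) p y"
      using Y unfolding coh_invariants_def cohomology_iff by blast
    have "act_koszul G \<rho> h (phi_star p y) - phi_star p y \<in> coboundaries (sym_koszul G \<rho>) p" if h: "h \<in> carrier G" for h
      unfolding phi_star_act[OF h, symmetric] phi_star_diff[symmetric]
      by (rule phi_coboundaries, rule bspec[OF Y[unfolded y(2) invL[OF y(1)]] h])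
    then show ?thesis
      unfolding y(2) clsP[OF y(1)] invK[OF cocP[OF y(1)]] by blast
  qed
  have sub: "coh_invariants G (act_koszul G \<rho>) (sym_koszul G \<rho>) p \<subseteq> cohomology (sym_koszul G \<rho>) p"
    "coh_invariants G (act_bar G \<rho>) (sym_bar G \<rho>) p \<subseteq> cohomology (sym_bar G \<rho>) p"
    by (auto simp: coh_invariants_def)
  show "inverse_coh_isos (sym_koszul G \<rho>) (sym_bar G \<rho>) p
      (coh_invariants G (act_koszul G \<rho>) (sym_koszul G \<rho>) p)
      (coh_invariants G (act_bar G \<rho>) (sym_bar G \<rho>) p)
      (coh_map (sym_bar G \<rho>) p (upsilon G b eps p)) (coh_map (sym_koszul G \<rho>) p (phi_star p))"
    by (rule inverse_coh_isosI[OF K L coh_hom_upsilon coh_hom_phi left right sub invU invP])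
qed

end

end

theorem corollary5p4:
  fixes G :: "('g, 'x) monoid_scheme"
    and \<rho> :: "'g \<Rightarrow> 'v::complex_vector \<Rightarrow> 'v"
    and b :: "'g \<Rightarrow> 'v list"
    and eps :: "'g \<Rightarrow> nat \<Rightarrow> complex"
    and p :: nat
  assumes "group G" and "finite (carrier G)"
    and "\<exists>B. finite_dimensional_vector_space (scaleC :: complex \<Rightarrow> 'v \<Rightarrow> 'v) B"
    and "linear_action G \<rho>"
    and "\<forall>g\<in>carrier G. eigenbasis (\<rho> g) (b g) (eps g)"
  shows "inverse_coh_isos (sym_koszul G \<rho>) (sym_bar G \<rho>) p
      (cohomology (sym_koszul G \<rho>) p) (cohomology (sym_bar G \<rho>) p)
      (coh_map (sym_bar G \<rho>) p (upsilon G b eps p)) (coh_map (sym_koszul G \<rho>) p (phi_star p))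
    \<and> inverse_coh_isos (sym_koszul G \<rho>) (sym_bar G \<rho>) p
      (coh_invariants G (act_koszul G \<rho>) (sym_koszul G \<rho>) p)
      (coh_invariants G (act_bar G \<rho>) (sym_bar G \<rho>) p)
      (coh_map (sym_bar G \<rho>) p (upsilon G b eps p)) (coh_map (sym_koszul G \<rho>) p (phi_star p))
    \<and> coh_iso (skew_bar G \<rho>) (sym_bar G \<rho>) p
      (cohomology (skew_bar G \<rho>) p) (coh_invariants G (act_bar G \<rho>) (sym_bar G \<rho>) p)
      (coh_map (sym_bar G \<rho>) p (restrict_cochain G))"
proof -
  interpret skew_algebra G \<rho>
    using assms(1,2,4) by (simp add: skew_algebra_def skew_algebra_axioms_def)
  have eigen: "eigenbasis (\<rho> g) (b g) (eps g)" if "g \<in> carrier G" for g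
    using assms(5) that by blast
  show ?thesis
    by (intro conjI upsilon_phi_star_inverse[OF eigen] skew_bar_cohomology)
qed

end
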